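(* Fix a positive integer $j$ and a real number $c$. The distribution of the number of $j$-cycles of the permutation in $S_n$ obtained after multiplying $$\left\lfloor \frac{n}{2j}\bigl(\log n+(j-1)\log\log n+c\bigr)\right\rfloor$$ independent random transpositions, starting from the identity, converges to the Poisson$\left(\frac1j\left(1+\frac{e^{-c}}{j!}\right)\right)$ distribution as $n\to\infty$.
   Context: The random transposition walk on $S_n$ is driven by the probability measure $P$ on $S_n$ with $P(\pi)=1/\binom n2$ if $\pi$ is a transposition (a $2$-cycle), and $P(\pi)=0$ otherwise (the identity is not chosen). At each step one moves from $g$ to $hg$ with $h$ sampled independently from $P$; after $k$ steps started at the identity the law of the permutation is the $k$-fold convolution $P^{*k}$. Convergence is convergence in distribution. *)

theory Defs
  imports "HOL-Probability.Probability" "HOL-Combinatorics.Orbits"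
begin

text \<open>
  The symmetric group \<open>S\<^sub>n\<close> is represented by the functions \<open>p\<close> on \<open>nat\<close> with
  \<open>p permutes {1..n}\<close>, which are the identity outside \<open>{1..n}\<close>.
\<close>

definition transpositions :: "nat \<Rightarrow> (nat \<Rightarrow> nat) set" where
  "transpositions n = {Transposition.transpose a b | a b. 1 \<le> a \<and> a < b \<and> b \<le> n}"

text \<open>
  The set of transpositions is nonempty only for \<open>n \<ge> 2\<close>; for smaller \<open>n\<close> the following
  value is unspecified, which has no bearing on limits as \<open>n\<close> tends to infinity.
\<close>

definition transposition_pmf :: "nat \<Rightarrow> (nat \<Rightarrow> nat) pmf" where
  "transposition_pmf n = pmf_of_set (transpositions n)"

definition convolution_pmf :: "('a \<Rightarrow> 'a) pmf \<Rightarrow> ('a \<Rightarrow> 'a) pmf \<Rightarrow> ('a \<Rightarrow> 'a) pmf" where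
  "convolution_pmf P Q = map_pmf (\<lambda>(h, g). h \<circ> g) (pair_pmf P Q)"

primrec transposition_walk :: "nat \<Rightarrow> nat \<Rightarrow> (nat \<Rightarrow> nat) pmf" where
  "transposition_walk n 0 = return_pmf id"
| "transposition_walk n (Suc k) =
     convolution_pmf (transposition_pmf n) (transposition_walk n k)"

text \<open>
  A cycle of \<open>p\<close> is identified with its support; fixed points count as \<open>1\<close>-cycles.
\<close>

definition num_cycles :: "nat \<Rightarrow> nat \<Rightarrow> (nat \<Rightarrow> nat) \<Rightarrow> nat" where
  "num_cycles n j p = card {C. C \<subseteq> {1..n} \<and> cyclic_on p C \<and> card C = j}"

text \<open>
  For the finitely many \<open>n\<close> for which the floor may be negative, \<open>nat\<close> truncates it to \<open>0\<close>.
\<close>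

definition num_steps :: "nat \<Rightarrow> real \<Rightarrow> nat \<Rightarrow> nat" where
  "num_steps j c n =
     nat \<lfloor>real n / (2 * real j) * (ln (real n) + (real j - 1) * ln (ln (real n)) + c)\<rfloor>"

lemma bij_betw_transpositions:
  "bij_betw (\<lambda>A. Transposition.transpose (Min A) (Max A)) {A. A \<subseteq> {1..n} \<and> card A = 2} (transpositions n)"
  unfolding bij_betw_def
proof
  have *: "\<exists>a b. A = {a, b} \<and> a < b \<and> Min A = a \<and> Max A = b" if card2: "card A = 2" for A :: "nat set"
  proof -
    obtain x y where "A = {x, y}" "x \<noteq> y" using card2 by (auto simp: card_2_iff)
    then have "A = {min x y, max x y}" "min x y < max x y" by (auto simp: min_def max_def)
    then show ?thesis by (intro exI[of _ "min x y"] exI[of _ "max x y"]) auto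
  qed
  have supp: "{x. Transposition.transpose a b x \<noteq> x} = {a, b}" if "a < b" for a b :: nat
    using that by (auto simp: Transposition.transpose_def)
  show "inj_on (\<lambda>A. Transposition.transpose (Min A) (Max A)) {A. A \<subseteq> {1..n} \<and> card A = 2}"
  proof (rule inj_onI)
    fix A B :: "nat set"
    assume "A \<in> {A. A \<subseteq> {1..n} \<and> card A = 2}" "B \<in> {A. A \<subseteq> {1..n} \<and> card A = 2}"
      and eq: "Transposition.transpose (Min A) (Max A) = Transposition.transpose (Min B) (Max B)"
    then obtain a b c d where "A = {a, b}" "a < b" "Min A = a" "Max A = b"
      "B = {c, d}" "c < d" "Min B = c" "Max B = d" using *[of A] *[of B] by auto
    with eq supp[of a b] supp[of c d] show "A = B" by metis
  qed
  show "(\<lambda>A. Transposition.transpose (Min A) (Max A)) ` {A. A \<subseteq> {1..n} \<and> card A = 2} = transpositions n"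
  proof (intro equalityI subsetI)
    fix p assume "p \<in> (\<lambda>A. Transposition.transpose (Min A) (Max A)) ` {A. A \<subseteq> {1..n} \<and> card A = 2}"
    then obtain A where A: "A \<subseteq> {1..n}" "card A = 2" "p = Transposition.transpose (Min A) (Max A)" by auto
    with *[of A] obtain a b where "A = {a, b}" "a < b" "p = Transposition.transpose a b" by auto
    with A(1) show "p \<in> transpositions n" unfolding transpositions_def by auto
  next
    fix p assume "p \<in> transpositions n"
    then obtain a b where ab: "p = Transposition.transpose a b" "1 \<le> a" "a < b" "b \<le> n"
      by (auto simp: transpositions_def)
    then show "p \<in> (\<lambda>A. Transposition.transpose (Min A) (Max A)) ` {A. A \<subseteq> {1..n} \<and> card A = 2}"
      by (intro image_eqI[of _ _ "{a, b}"]) (auto simp: min_def max_def)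
  qed
qed

lemma card_transpositions: "card (transpositions n) = n choose 2"
  using bij_betw_same_card[OF bij_betw_transpositions[of n]] by (simp add: n_subsets)

lemma pmf_transposition_pmf:
  assumes "n \<ge> 2"
  shows "pmf (transposition_pmf n) p =
           (if p \<in> transpositions n then 1 / real (n choose 2) else 0)"
proof -
  have "card (transpositions n) > 0"
    using assms by (simp add: card_transpositions)
  then have "transpositions n \<noteq> {}" "finite (transpositions n)"
    by (simp_all add: card_gt_0_iff)
  then show ?thesis
    by (simp add: transposition_pmf_def card_transpositions indicator_def)
qed

end

theory Submission
  imports Defs "HOL-Real_Asymp.Real_Asymp"
begin

text \<open>
  The proof is by the method of moments. For a family \<open>\<mu>\<close> of lengths let \<open>F \<mu>\<close> be the number of ways of
  choosing disjoint cycles of these lengths, each with a starting point. For \<open>m\<close> copies of \<open>j\<close> this is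
  \<open>j ^ m\<close> times the falling factorial of the number of \<open>j\<close>-cycles. The mean of \<open>F \<mu>\<close> after one more
  transposition is a combination of means \<open>F \<nu>\<close> at the present time, with \<open>sum \<nu> \<le> sum \<mu>\<close>: a length is
  cut in two, two lengths are joined, or a length is removed or shortened. To leading order the system
  is solved by the product of \<open>1 + x i\<close> over the lengths \<open>i\<close> of \<open>\<mu>\<close>, where
  \<open>x i = i ^ (i - 1) / i! * n * exp (- i s) * s ^ (i - 1)\<close> at time \<open>k = n s / 2\<close>. The term \<open>1\<close> is the
  contribution of the mixed points, and \<open>x i\<close> that of the isolated trees of size \<open>i\<close> in the graph of the
  transpositions used so far; that it satisfies the equation is Abel's identity. All coefficients are
  nonnegative up to lower order, so the error is controlled by comparison, by induction on the
  lengths. At the critical time \<open>x j\<close> tends to \<open>exp (- c) / j!\<close>.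
\<close>

section \<open>Abel's identity\<close>

text \<open>At the critical time \<open>n * ln n ^ (j - 1) * \<theta> ^ j\<close> is bounded, where
  \<theta> is the discrete form of \<open>exp (- s)\<close>. So \<theta> is \<open>n\<close> to the
  power \<open>- 1 / j\<close> up to logarithms, and an error made of one factor \<theta>, bounded
  factors and any power of \<open>ln n\<close> vanishes. This is why every estimate is made only up
  to powers of the logarithm: constants and the elapsed time, of order \<open>ln n\<close>, need no
  bookkeeping. The obstacle is that the system is not triangular. Removals and cuts lower
  \<open>2 * sum \<mu> - card\<close>, but joins raise it. Joins carry a coefficient
  \<open>1 / n\<close>, yet they can be charged to the error only once the means are known to have
  the right size, far below the trivial \<open>n ^ card\<close>; that bound is won one power of
  \<open>n\<close> at a time. A cut also has coefficient \<open>1 / n\<close>, but it creates a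
  second factor that may itself be of size \<open>n\<close>, so it belongs to the leading order,
  where it produces the quadratic term solved by the tree numbers.\<close>

lemma alternating_binomial_power:
  assumes "m < n"
  shows "(\<Sum>r\<le>n. (-1) ^ r * real (n choose r) * (x - real r) ^ m) = 0"
  using assms
proof (induction n arbitrary: m x)
  case 0
  then show ?case by simp
next
  case (Suc n)
  define f where "f = (\<lambda>y::real. \<Sum>r\<le>n. (-1) ^ r * real (n choose r) * (y - real r) ^ m)"
  have "(\<Sum>r\<le>Suc n. (-1) ^ r * real (Suc n choose r) * (x - real r) ^ m) = f x - f (x - 1)"
  proof -
    have "(\<Sum>r\<le>Suc n. (-1) ^ r * real (Suc n choose r) * (x - real r) ^ m) =
      x ^ m + (\<Sum>r\<le>n. (-1) ^ Suc r * real (Suc n choose Suc r) * (x - real (Suc r)) ^ m)"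
      by (subst sum.atMost_Suc_shift) simp
    also have "(\<Sum>r\<le>n. (-1) ^ Suc r * real (Suc n choose Suc r) * (x - real (Suc r)) ^ m) =
      (\<Sum>r\<le>n. (-1) ^ Suc r * real (n choose Suc r) * (x - real (Suc r)) ^ m) - f (x - 1)"
      unfolding f_def sum_subtractf[symmetric] by (intro sum.cong refl) (simp add: algebra_simps)
    also have "x ^ m + ((\<Sum>r\<le>n. (-1) ^ Suc r * real (n choose Suc r) * (x - real (Suc r)) ^ m) - f (x - 1)) =
      (\<Sum>r\<le>Suc n. (-1) ^ r * real (n choose r) * (x - real r) ^ m) - f (x - 1)"
      by (subst sum.atMost_Suc_shift) simp
    also have "(\<Sum>r\<le>Suc n. (-1) ^ r * real (n choose r) * (x - real r) ^ m) = f x"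
      unfolding f_def by simp
    finally show ?thesis .
  qed
  \<comment> \<open>Pascal's rule has reduced the sum to a difference of \<open>f\<close>, a sum of
    one order lower. The derivative of \<open>f\<close> is \<open>m\<close> times the sum with
    exponent \<open>m - 1\<close>, which vanishes by induction, so \<open>f\<close> is
    constant.\<close>
  also have "f x - f (x - 1) = 0"
  proof (cases m)
    case 0
    then show ?thesis by (simp add: f_def)
  next
    case (Suc m')
    have "(f has_field_derivative 0) (at y)" for y
    proof -
      have "(f has_field_derivative (\<Sum>r\<le>n. (-1) ^ r * real (n choose r) * (real m * (y - real r) ^ m'))) (at y)"
      proof -
        have "((\<lambda>y. (y - real r) ^ m) has_field_derivative real m * (y - real r) ^ (m - 1)) (at y)" for r
          by (auto intro!: derivative_eq_intros)
        then show ?thesis unfolding f_def using Suc by (intro DERIV_sum DERIV_cmult) simp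
      qed
      moreover have "(\<Sum>r\<le>n. (-1) ^ r * real (n choose r) * (real m * (y - real r) ^ m')) =
        real m * (\<Sum>r\<le>n. (-1) ^ r * real (n choose r) * (y - real r) ^ m')"
        by (simp add: sum_distrib_left mult_ac)
      ultimately show ?thesis using Suc.IH[of m' y] Suc.prems Suc by simp
    qed
    then show ?thesis using DERIV_isconst_all[of f] by auto
  qed
  finally show ?case .
qed

text \<open>Both sides are polynomials in \<open>y\<close>, and the derivative of each is
  \<open>n\<close> times the same side for \<open>n - 1\<close> at \<open>y + 1\<close>; by
  induction they differ by a constant. At \<open>y = - n\<close> the right side vanishes for
  \<open>n \<ge> 2\<close>, and the left side becomes an alternating binomial sum of the powers
  \<open>r ^ (n - 1)\<close>, which is zero.\<close>

lemma abel_identity: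
  assumes "n \<ge> 1"
  shows "(\<Sum>r=1..n. real (n choose r) * real r ^ (r - 1) * (y + real (n - r)) ^ (n - r)) =
    real n * (y + real n) ^ (n - 1)"
  using assms
proof (induction n arbitrary: y rule: nat_induct_at_least)
  case base
  then show ?case by simp
next
  case (Suc n)
  define f where "f = (\<lambda>y. (\<Sum>r=1..Suc n. real (Suc n choose r) * real r ^ (r - 1) * (y + real (Suc n - r)) ^ (Suc n - r))
     - real (Suc n) * (y + real (Suc n)) ^ n)"
  have "(f has_field_derivative 0) (at y)" for y
  proof -
    have "((\<lambda>y. (y + real (Suc n - r)) ^ (Suc n - r)) has_field_derivative
        real (Suc n - r) * (y + real (Suc n - r)) ^ (Suc n - r - 1)) (at y)" for r
      by (auto intro!: derivative_eq_intros)
    then have "(f has_field_derivative (\<Sum>r=1..Suc n. real (Suc n choose r) * real r ^ (r - 1) *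
        (real (Suc n - r) * (y + real (Suc n - r)) ^ (Suc n - r - 1))) - real (Suc n) * (real n * (y + real (Suc n)) ^ (n - 1))) (at y)"
      unfolding f_def by (intro DERIV_diff DERIV_sum DERIV_cmult) (auto intro!: derivative_eq_intros)
    moreover have "(\<Sum>r=1..Suc n. real (Suc n choose r) * real r ^ (r - 1) *
        (real (Suc n - r) * (y + real (Suc n - r)) ^ (Suc n - r - 1))) =
        (\<Sum>r=1..n. real (Suc n) * (real (n choose r) * real r ^ (r - 1) * ((y + 1) + real (n - r)) ^ (n - r)))"
    proof -
      have absorb: "real (Suc n choose r) * real (Suc n - r) = real (Suc n) * real (n choose r)" if "r \<le> n" for r
      proof -
        have "(Suc n - r) * (Suc n choose r) = Suc n * (n choose r)"
          using binomial_absorb_comp[of "Suc n" r] by simp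
        then show ?thesis by (metis mult.commute of_nat_mult)
      qed
      have "real (Suc n choose r) * real r ^ (r - 1) * (real (Suc n - r) * (y + real (Suc n - r)) ^ (Suc n - r - 1)) =
        real (Suc n) * (real (n choose r) * real r ^ (r - 1) * ((y + 1) + real (n - r)) ^ (n - r))" if "r \<in> {1..n}" for r
      proof -
        have e: "Suc n - r - 1 = n - r" "y + real (Suc n - r) = (y + 1) + real (n - r)"
          using that by (auto simp: of_nat_diff)
        have "real (Suc n choose r) * real r ^ (r - 1) * (real (Suc n - r) * ((y + 1) + real (n - r)) ^ (n - r)) =
          real (Suc n choose r) * real (Suc n - r) * (real r ^ (r - 1) * ((y + 1) + real (n - r)) ^ (n - r))"
          by (simp only: mult_ac)
        also have "real (Suc n choose r) * real (Suc n - r) = real (Suc n) * real (n choose r)"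
          using that by (intro absorb) simp
        finally show ?thesis unfolding e by (simp only: mult.assoc)
      qed
      then have eq: "(\<Sum>r=1..n. real (Suc n choose r) * real r ^ (r - 1) * (real (Suc n - r) * (y + real (Suc n - r)) ^ (Suc n - r - 1))) =
        (\<Sum>r=1..n. real (Suc n) * (real (n choose r) * real r ^ (r - 1) * ((y + 1) + real (n - r)) ^ (n - r)))"
        by (rule sum.cong[OF refl])
      show ?thesis unfolding eq[symmetric] by (rule sum.mono_neutral_right) (auto simp: not_le)
    qed
    moreover have "\<dots> = real (Suc n) * (real n * ((y + 1) + real n) ^ (n - 1))"
      unfolding sum_distrib_left[symmetric] Suc.IH ..
    ultimately show ?thesis by (simp add: add_ac)
  qed
  then have const: "f y = f (- real (Suc n))" using DERIV_isconst_all[of f] by blast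
  have "f (- real (Suc n)) = (\<Sum>r=1..Suc n. real (Suc n choose r) * real r ^ (r - 1) * (- real r) ^ (Suc n - r))"
    using Suc.hyps by (auto simp: f_def of_nat_diff intro!: sum.cong)
  also have "\<dots> = (\<Sum>r=1..Suc n. (-1) ^ Suc n * ((-1) ^ r * real (Suc n choose r) * (0 - real r) ^ n * (-1) ^ n))"
  proof (rule sum.cong[OF refl])
    fix r assume r: "r \<in> {1..Suc n}"
    have "real r ^ (r - 1) * (- real r) ^ (Suc n - r) = real r ^ n * (-1) ^ (Suc n - r)"
    proof -
      have "real r ^ (r - 1) * (- real r) ^ (Suc n - r) = real r ^ (r - 1) * (real r ^ (Suc n - r) * (-1) ^ (Suc n - r))"
        by (subst power_minus) simp
      also have "\<dots> = real r ^ (r - 1 + (Suc n - r)) * (-1) ^ (Suc n - r)" by (simp add: power_add)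
      also have "r - 1 + (Suc n - r) = n" using r by auto
      finally show ?thesis .
    qed
    moreover have "(-1 :: real) ^ (Suc n - r) = (-1) ^ Suc n * (-1) ^ r"
      using r by (auto simp: minus_one_power_iff)
    ultimately have l: "real r ^ (r - 1) * (- real r) ^ (Suc n - r) = real r ^ n * ((-1) ^ Suc n * (-1) ^ r)"
      by simp
    have z: "(0 - real r) ^ n * (-1) ^ n = real r ^ n"
      by (simp add: power_mult_distrib[symmetric])
    have "(-1) ^ Suc n * ((-1) ^ r * real (Suc n choose r) * (0 - real r) ^ n * (-1) ^ n) =
      (-1) ^ Suc n * ((-1) ^ r * real (Suc n choose r) * ((0 - real r) ^ n * (-1) ^ n))"
      by (simp only: mult.assoc)
    also have "\<dots> = real (Suc n choose r) * (real r ^ n * ((-1) ^ Suc n * (-1) ^ r))"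
      unfolding z by (simp only: mult_ac)
    finally show "real (Suc n choose r) * real r ^ (r - 1) * (- real r) ^ (Suc n - r) =
      (-1) ^ Suc n * ((-1) ^ r * real (Suc n choose r) * (0 - real r) ^ n * (-1) ^ n)"
      unfolding l[symmetric] by (simp only: mult.assoc)
  qed
  also have "\<dots> = (-1) ^ Suc n * (-1) ^ n * (\<Sum>r=1..Suc n. (-1) ^ r * real (Suc n choose r) * (0 - real r) ^ n)"
    by (simp only: sum_distrib_left mult_ac)
  also have "(\<Sum>r=1..Suc n. (-1) ^ r * real (Suc n choose r) * (0 - real r) ^ n) =
    (\<Sum>r\<le>Suc n. (-1) ^ r * real (Suc n choose r) * (0 - real r) ^ n)"
    using Suc.hyps by (intro sum.mono_neutral_left) auto
  also have "\<dots> = 0" by (rule alternating_binomial_power) simp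
  finally show ?case using const unfolding f_def by simp
qed

definition tree_weight :: "nat \<Rightarrow> real" where
  "tree_weight i = real i ^ (i - 1) / fact i"

text \<open>There are \<open>i - r\<close> pairs of positions \<open>u < v < i\<close> at distance
  \<open>r\<close>.\<close>

lemma sum_gaps:
  fixes f :: "nat \<Rightarrow> real"
  shows "(\<Sum>v<i. \<Sum>u<v. f (v - u)) = (\<Sum>r=1..<i. real (i - r) * f r)"
proof (induction i)
  case (Suc i)
  have "(\<Sum>u<i. f (i - u)) = (\<Sum>r=1..<Suc i. f r)"
    by (rule sum.reindex_bij_witness[of _ "\<lambda>r. i - r" "\<lambda>u. i - u"]) auto
  moreover have "(\<Sum>r=1..<Suc i. real (Suc i - r) * f r) = (\<Sum>r=1..<Suc i. real (i - r) * f r) + (\<Sum>r=1..<Suc i. f r)"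
    unfolding sum.distrib[symmetric] by (intro sum.cong) (auto simp: Suc_diff_le algebra_simps)
  moreover have "(\<Sum>r=1..<Suc i. real (i - r) * f r) = (\<Sum>r=1..<i. real (i - r) * f r)"
    by (cases "i = 0") auto
  ultimately show ?case using Suc by simp
qed simp

text \<open>Abel's identity at \<open>y = 0\<close> with the term \<open>r = i\<close> split off. In
  terms of trees both sides count trees with a marked edge: deleting one of the \<open>i - 1\<close>
  edges leaves trees of sizes \<open>r\<close> and \<open>i - r\<close>.\<close>

lemma tree_weight_recurrence:
  "(\<Sum>v<i. \<Sum>u<v. tree_weight (v - u) * tree_weight (i - (v - u))) = real (i - 1) * tree_weight i"
proof (cases "i = 0")
  case False
  have "(\<Sum>v<i. \<Sum>u<v. tree_weight (v - u) * tree_weight (i - (v - u))) =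
    (\<Sum>r=1..<i. real (i - r) * (tree_weight r * tree_weight (i - r)))"
    by (rule sum_gaps)
  also have "\<dots> = (\<Sum>r=1..<i. real (i choose r) * real r ^ (r - 1) * (0 + real (i - r)) ^ (i - r) / fact i)"
  proof (rule sum.cong[OF refl])
    fix r assume r: "r \<in> {1..<i}"
    have "real (i - r) * real (i - r) ^ (i - r - 1) = real (i - r) ^ (i - r)"
      using r by (metis Suc_diff_1 atLeastLessThan_iff power_Suc zero_less_diff)
    moreover have "real (i choose r) / fact i = 1 / (fact r * fact (i - r))"
      using r by (simp add: binomial_fact)
    ultimately have "real (i - r) * tree_weight (i - r) = real (i - r) ^ (i - r) / fact (i - r)"
      and c: "real (i choose r) / fact i = 1 / (fact r * fact (i - r))"
      by (simp_all add: tree_weight_def)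
    then have "real (i - r) * (tree_weight r * tree_weight (i - r)) =
      tree_weight r * (real (i - r) ^ (i - r) / fact (i - r))"
      by (metis mult.left_commute)
    also have "\<dots> = real r ^ (r - 1) * real (i - r) ^ (i - r) * (1 / (fact r * fact (i - r)))"
      by (simp add: tree_weight_def)
    also have "\<dots> = real (i choose r) * real r ^ (r - 1) * (0 + real (i - r)) ^ (i - r) / fact i"
      unfolding c[symmetric] by simp
    finally show "real (i - r) * (tree_weight r * tree_weight (i - r)) =
      real (i choose r) * real r ^ (r - 1) * (0 + real (i - r)) ^ (i - r) / fact i" .
  qed
  also have "\<dots> = ((\<Sum>r=1..i. real (i choose r) * real r ^ (r - 1) * (0 + real (i - r)) ^ (i - r)) - real i ^ (i - 1)) / fact i"
  proof -
    have "{1..i} = insert i {1..<i}" using False by auto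
    then show ?thesis by (simp add: sum_divide_distrib)
  qed
  also have "\<dots> = (real i * real i ^ (i - 1) - real i ^ (i - 1)) / fact i"
    using False abel_identity[of i 0] by simp
  also have "\<dots> = real (i - 1) * tree_weight i"
    using False by (simp add: tree_weight_def of_nat_diff field_simps)
  finally show ?thesis .
qed simp

section \<open>Convergence to the Poisson distribution\<close>

lemma alternating_binomial_partial_sum:
  "(\<Sum>m\<le>M. (-1) ^ m * real (Suc k choose m)) = (-1) ^ M * real (k choose M)"
  by (induction M) (simp_all add: algebra_simps)

text \<open>Truncated inclusion-exclusion. After \<open>N choose r\<close> is factored out, a
  partial alternating sum of the binomial row \<open>N - r\<close> remains; for \<open>N > r\<close>
  it is a single signed coefficient of the row \<open>N - r - 1\<close>. Bounding by the last term
  kept is enough, because the limits of these terms tend to zero.\<close>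

lemma bonferroni:
  "\<bar>of_bool (N = r) - (\<Sum>m\<le>M. (-1) ^ m * (real (N choose (r + m)) * real ((r + m) choose r)))\<bar>
    \<le> real (N choose (r + M)) * real ((r + M) choose r)"
proof (cases "r \<le> N")
  case True
  have *: "real (N choose (r + m)) * real ((r + m) choose r) = real (N choose r) * real ((N - r) choose m)" for m
  proof (cases "r + m \<le> N")
    case True
    then have "(N choose (r + m)) * ((r + m) choose r) = (N choose r) * ((N - r) choose m)"
      using choose_mult[of r "r + m" N] by simp
    then show ?thesis by (metis of_nat_mult)
  next
    case False
    then have "N - r < m" using \<open>r \<le> N\<close> by linarith
    then show ?thesis using False by (simp add: binomial_eq_0)
  qed
  have "\<bar>of_bool (N = r) - (\<Sum>m\<le>M. (-1) ^ m * (real (N choose r) * real ((N - r) choose m)))\<bar>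
    \<le> real (N choose r) * real ((N - r) choose M)"
  proof (cases "N = r")
    case True
    have "(\<Sum>m\<le>M. (-1) ^ m * real (0 choose m)) = (1::real)"
      by (induction M) auto
    then show ?thesis using True by simp
  next
    case False
    then obtain k where k: "N - r = Suc k" using \<open>r \<le> N\<close> by (metis Suc_diff_Suc le_neq_implies_less)
    have "(\<Sum>m\<le>M. (-1) ^ m * (real (N choose r) * real (Suc k choose m))) =
      real (N choose r) * ((-1) ^ M * real (k choose M))"
      by (subst alternating_binomial_partial_sum[symmetric], unfold sum_distrib_left)
        (simp only: mult.left_commute)
    moreover have "\<bar>real (N choose r) * ((-1) ^ M * real (k choose M))\<bar> = real (N choose r) * real (k choose M)"
      by (simp add: abs_mult power_abs)
    moreover have "real (k choose M) \<le> real (Suc k choose M)"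
      by (cases M) simp_all
    ultimately show ?thesis using False k by (auto intro!: mult_left_mono)
  qed
  then show ?thesis unfolding * .
next
  case False
  then show ?thesis by (simp add: binomial_eq_0)
qed

text \<open>A point mass differs from a truncated sum of binomial moments by at most one further
  moment, and the limits of these truncated sums are partial sums of an exponential series. The
  truncation \<open>M\<close> is fixed before \<open>n\<close> grows, so each tolerance involves
  only finitely many moments.\<close>

theorem pmf_tendsto_poisson:
  fixes p :: "nat \<Rightarrow> nat pmf" and rate :: real
  assumes fin: "\<And>n. finite (set_pmf (p n))"
    and lim: "\<And>m. (\<lambda>n. measure_pmf.expectation (p n) (\<lambda>N. real (N choose m))) \<longlonglongrightarrow> rate ^ m / fact m"
  shows "(\<lambda>n. pmf (p n) r) \<longlonglongrightarrow> rate ^ r / fact r * exp (- rate)"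
proof (rule LIMSEQ_I)
  fix e :: real assume "0 < e"
  define E where "E n m = measure_pmf.expectation (p n) (\<lambda>N. real (N choose m))" for n m
  define S where "S n M = (\<Sum>m\<le>M. (-1) ^ m * (E n (r + m) * real ((r + m) choose r)))" for n M
  define R where "R n M = E n (r + M) * real ((r + M) choose r)" for n M
  define S' where "S' M = (\<Sum>m\<le>M. rate ^ r / fact r * ((- rate) ^ m / fact m))" for M
  define R' where "R' M = rate ^ r / fact r * (rate ^ M / fact M)" for M
  have int: "integrable (measure_pmf (p n)) f" for n and f :: "nat \<Rightarrow> real"
    by (rule integrable_measure_pmf_finite[OF fin])
  have bound: "\<bar>pmf (p n) r - S n M\<bar> \<le> R n M" for n M
  proof -
    have "pmf (p n) r = measure_pmf.expectation (p n) (\<lambda>N. of_bool (N = r))"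
    proof -
      have "(\<lambda>N. of_bool (N = r)) = (indicator {r} :: nat \<Rightarrow> real)" by (auto simp: indicator_def)
      then show ?thesis by (simp add: pmf.rep_eq)
    qed
    moreover have "S n M = measure_pmf.expectation (p n)
      (\<lambda>N. \<Sum>m\<le>M. (-1) ^ m * (real (N choose (r + m)) * real ((r + m) choose r)))"
      unfolding S_def E_def using int by (simp add: Bochner_Integration.integral_sum)
    ultimately have eq: "pmf (p n) r - S n M = measure_pmf.expectation (p n)
      (\<lambda>N. of_bool (N = r) - (\<Sum>m\<le>M. (-1) ^ m * (real (N choose (r + m)) * real ((r + m) choose r))))"
      using int by simp
    have "\<bar>pmf (p n) r - S n M\<bar> \<le> measure_pmf.expectation (p n)
      (\<lambda>N. \<bar>of_bool (N = r) - (\<Sum>m\<le>M. (-1) ^ m * (real (N choose (r + m)) * real ((r + m) choose r)))\<bar>)"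
      unfolding eq by (rule integral_abs_bound)
    also have "\<dots> \<le> measure_pmf.expectation (p n) (\<lambda>N. real (N choose (r + M)) * real ((r + M) choose r))"
    proof (rule integral_mono)
      fix N
      show "\<bar>of_bool (N = r) - (\<Sum>m\<le>M. (-1) ^ m * (real (N choose (r + m)) * real ((r + m) choose r)))\<bar>
        \<le> real (N choose (r + M)) * real ((r + M) choose r)" by (rule bonferroni)
    qed (rule int)+
    also have "\<dots> = R n M" unfolding R_def E_def by simp
    finally show ?thesis .
  qed
  have coeff: "rate ^ (r + m) / fact (r + m) * real ((r + m) choose r) = rate ^ r / fact r * (rate ^ m / fact m)" for m
    by (simp add: binomial_fact power_add)
  have limE: "(\<lambda>n. E n m) \<longlonglongrightarrow> rate ^ m / fact m" for m
    unfolding E_def by (rule lim)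
  have R: "(\<lambda>n. R n M) \<longlonglongrightarrow> R' M" for M
    unfolding R_def R'_def coeff[symmetric] by (intro tendsto_intros limE)
  have S: "(\<lambda>n. S n M) \<longlonglongrightarrow> S' M" for M
  proof -
    have "(\<lambda>n. S n M) \<longlonglongrightarrow> (\<Sum>m\<le>M. (-1) ^ m * (rate ^ (r + m) / fact (r + m) * real ((r + m) choose r)))"
      unfolding S_def by (intro tendsto_intros limE)
    also have "(\<Sum>m\<le>M. (-1) ^ m * (rate ^ (r + m) / fact (r + m) * real ((r + m) choose r))) = S' M"
      unfolding S'_def coeff by (intro sum.cong refl) (simp add: power_minus[of rate])
    finally show ?thesis .
  qed
  have expo: "(\<lambda>m. x ^ m / fact m) sums exp x" for x :: real
    using exp_converges[of x] by (simp add: field_simps)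
  have S': "S' \<longlonglongrightarrow> rate ^ r / fact r * exp (- rate)"
    unfolding S'_def sum_distrib_left[symmetric]
    by (intro tendsto_intros) (use expo[of "- rate"] in \<open>simp add: sums_def_le\<close>)
  have R': "R' \<longlonglongrightarrow> rate ^ r / fact r * 0"
    unfolding R'_def using expo[of rate]
    by (intro tendsto_mult tendsto_const summable_LIMSEQ_zero) (rule sums_summable)
  have "\<forall>\<^sub>F M in sequentially. \<bar>S' M - rate ^ r / fact r * exp (- rate)\<bar> < e / 4"
    using tendstoD[OF S', of "e / 4"] \<open>0 < e\<close> by (simp add: dist_real_def)
  moreover have "\<forall>\<^sub>F M in sequentially. R' M < e / 4"
    using order_tendstoD(2)[OF R', of "e / 4"] \<open>0 < e\<close> by simp
  ultimately obtain M where M: "\<bar>S' M - rate ^ r / fact r * exp (- rate)\<bar> < e / 4" "R' M < e / 4"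
    by (metis (mono_tags, lifting) eventually_conj eventually_sequentially order_refl)
  have "\<forall>\<^sub>F n in sequentially. \<bar>S n M - S' M\<bar> < e / 4"
    using tendstoD[OF S, of "e / 4"] \<open>0 < e\<close> by (simp add: dist_real_def)
  moreover have "\<forall>\<^sub>F n in sequentially. R n M < e / 4"
    using order_tendstoD(2)[OF R M(2)] .
  ultimately have "\<forall>\<^sub>F n in sequentially. norm (pmf (p n) r - rate ^ r / fact r * exp (- rate)) < e"
  proof eventually_elim
    case (elim n)
    then show ?case using M bound[of n M]
      unfolding real_norm_def abs_less_iff abs_le_iff by linarith
  qed
  then show "\<exists>no. \<forall>n\<ge>no. norm (pmf (p n) r - rate ^ r / fact r * exp (- rate)) < e"
    by (simp add: eventually_sequentially)
qed

text \<open>The distribution function at a real \<open>x\<close> is a finite sum of point masses,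
  hence converges at every \<open>x\<close>, even at the jumps of the limit.\<close>

lemma weak_conv_m_nat_pmf:
  fixes p :: "nat \<Rightarrow> nat pmf" and q :: "nat pmf"
  assumes "\<And>r. (\<lambda>n. pmf (p n) r) \<longlonglongrightarrow> pmf q r"
  shows "weak_conv_m (\<lambda>n. distr (measure_pmf (p n)) borel real) (distr (measure_pmf q) borel real)"
proof -
  have cdf: "cdf (distr (measure_pmf P) borel real) x = (\<Sum>r\<in>{r. real r \<le> x}. pmf P r)" for P x
  proof -
    have fin: "finite {r. real r \<le> x}"
      by (rule finite_subset[of _ "{..nat \<lceil>x\<rceil>}"]) (auto simp: le_nat_iff, linarith)
    have "cdf (distr (measure_pmf P) borel real) x = measure (measure_pmf P) {r. real r \<le> x}"
      by (simp add: cdf_def measure_distr vimage_def)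
    also have "\<dots> = (\<Sum>r\<in>{r. real r \<le> x}. pmf P r)"
      by (rule measure_measure_pmf_finite[OF fin])
    finally show ?thesis .
  qed
  show ?thesis
    unfolding weak_conv_m_def weak_conv_def cdf by (intro allI impI tendsto_sum assms)
qed

section \<open>Families of cycles written as words\<close>

text \<open>A cycle with a starting point is written as a repetition-free word that begins there, so
  no quotient by rotations is taken. The value \<open>undefined\<close> outside \<open>I\<close>
  makes the words on \<open>I\<close> determine \<open>w\<close>, and the set finite for finite
  \<open>I\<close>.\<close>

definition placements :: "nat \<Rightarrow> nat set \<Rightarrow> (nat \<Rightarrow> nat) \<Rightarrow> (nat \<Rightarrow> nat list) set" where
  "placements n I \<mu> =
     {w. (\<forall>t\<in>I. length (w t) = \<mu> t \<and> distinct (w t) \<and> set (w t) \<subseteq> {1..n}) \<and>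
         (\<forall>t. t \<notin> I \<longrightarrow> w t = undefined) \<and> disjoint_family_on (\<lambda>t. set (w t)) I}"

text \<open>For an involution \<open>h\<close> this says that the words are cycles of
  \<open>h \<circ> \<sigma>\<close>. With \<open>h\<close> moved to the other side, the condition
  speaks of \<sigma> itself and can be compared with cycles of \<sigma> even when \<open>h\<close>
  is chosen depending on \<open>w\<close>.\<close>

definition follows :: "(nat \<Rightarrow> nat) \<Rightarrow> (nat \<Rightarrow> nat) \<Rightarrow> nat set \<Rightarrow> (nat \<Rightarrow> nat list) \<Rightarrow> bool" where
  "follows h \<sigma> I w \<longleftrightarrow> (\<forall>t\<in>I. map \<sigma> (w t) = map h (rotate1 (w t)))"

definition cycle_families :: "nat \<Rightarrow> (nat \<Rightarrow> nat) \<Rightarrow> nat set \<Rightarrow> (nat \<Rightarrow> nat) \<Rightarrow> (nat \<Rightarrow> nat list) set" where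
  "cycle_families n \<sigma> I \<mu> = {w \<in> placements n I \<mu>. \<forall>t\<in>I. map \<sigma> (w t) = rotate1 (w t)}"

lemma finite_placements: "finite I \<Longrightarrow> finite (placements n I \<mu>)"
proof -
  assume "finite I"
  then have "finite (PiE I (\<lambda>t. {xs. set xs \<subseteq> {1..n} \<and> length xs = \<mu> t}))"
    by (intro finite_PiE finite_lists_length_eq) auto
  moreover have "placements n I \<mu> \<subseteq> PiE I (\<lambda>t. {xs. set xs \<subseteq> {1..n} \<and> length xs = \<mu> t})"
    by (auto simp: placements_def PiE_def extensional_def)
  ultimately show ?thesis by (rule finite_subset[rotated])
qed

lemma finite_cycle_families: "finite I \<Longrightarrow> finite (cycle_families n \<sigma> I \<mu>)"
  by (simp add: cycle_families_def finite_placements)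

section \<open>Effect of a transposition on cyclic words\<close>

lemma map_transpose_other:
  "a \<notin> set xs \<Longrightarrow> b \<notin> set xs \<Longrightarrow> map (Transposition.transpose a b) xs = xs"
  by (rule map_idI) (metis transpose_apply_other)

lemma append_split:
  "length xs = length xs' \<Longrightarrow> xs @ ys = xs' @ ys' \<longleftrightarrow> xs = xs' \<and> ys = ys'"
  by simp

lemma map_transpose_tl_hd:
  assumes "a \<notin> set p" "b \<notin> set p"
  shows "map (Transposition.transpose a b) (tl p) = tl p"
    "p \<noteq> [] \<Longrightarrow> Transposition.transpose a b (hd p) = hd p"
  using map_transpose_other[OF assms] assms by (metis map_tl) (metis assms hd_in_set transpose_apply_other)

text \<open>The transposition swaps \<open>hd q\<close> and \<open>hd s\<close> in the list of
  successors: the last letter of \<open>q\<close> returns to \<open>hd q\<close>, and the letter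
  before \<open>q\<close> jumps to \<open>hd s\<close>. Comparing pieces of equal length separates
  the two resulting cycles.\<close>

lemma word_cut:
  assumes "distinct (p @ q @ s)" "q \<noteq> []" "s \<noteq> []"
  shows "map \<sigma> (p @ q @ s) = map (Transposition.transpose (hd q) (hd s)) (rotate1 (p @ q @ s)) \<longleftrightarrow>
    map \<sigma> q = rotate1 q \<and> map \<sigma> (p @ s) = rotate1 (p @ s)"
proof -
  obtain a q' where q: "q = a # q'" using assms(2) by (cases q) auto
  obtain b s' where s: "s = b # s'" using assms(3) by (cases s) auto
  let ?h = "Transposition.transpose a b" and ?e = "if p = [] then [b] else [hd p]"
  have other: "map ?h q' = q'" "map ?h s' = s'"
    using assms(1) unfolding q s by (simp_all add: map_transpose_other)
  have "a \<notin> set p" "b \<notin> set p" using assms(1) unfolding q s by auto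
  note otherp = map_transpose_tl_hd[OF this]
  have r1: "map ?h (rotate1 (p @ q @ s)) = tl (p @ [b]) @ ((q' @ [a]) @ (s' @ ?e))"
    using other otherp unfolding q s by (cases p) simp_all
  have r2: "rotate1 (p @ s) = tl (p @ [b]) @ (s' @ ?e)"
    unfolding s by (cases p) simp_all
  have "map \<sigma> p @ (map \<sigma> q @ map \<sigma> s) = tl (p @ [b]) @ ((q' @ [a]) @ (s' @ ?e)) \<longleftrightarrow>
    map \<sigma> p = tl (p @ [b]) \<and> map \<sigma> q @ map \<sigma> s = (q' @ [a]) @ (s' @ ?e)"
    by (rule append_split) simp
  moreover have "map \<sigma> q @ map \<sigma> s = (q' @ [a]) @ (s' @ ?e) \<longleftrightarrow> map \<sigma> q = q' @ [a] \<and> map \<sigma> s = s' @ ?e"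
    by (rule append_split) (simp add: q)
  moreover have "map \<sigma> p @ map \<sigma> s = tl (p @ [b]) @ (s' @ ?e) \<longleftrightarrow> map \<sigma> p = tl (p @ [b]) \<and> map \<sigma> s = s' @ ?e"
    by (rule append_split) simp
  moreover have "rotate1 q = q' @ [a]" "hd q = a" "hd s = b" by (simp_all add: q s)
  ultimately show ?thesis
    unfolding r2 map_append \<open>rotate1 q = _\<close> \<open>hd q = a\<close> \<open>hd s = b\<close> r1[unfolded map_append] by blast
qed

text \<open>With the successors \<open>hd s\<close> and \<open>hd s'\<close> swapped, each word
  continues into the other: \<open>p\<close> is followed by \<open>s'\<close>, and \<open>p'\<close>
  by \<open>s\<close>. One implication suffices, since joins enter the estimates as an error and are
  only bounded from above.\<close>

lemma word_join:
  assumes "distinct (p @ s @ p' @ s')" "s \<noteq> []" "s' \<noteq> []"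
    and "map \<sigma> (p @ s) = map (Transposition.transpose (hd s) (hd s')) (rotate1 (p @ s))"
    and "map \<sigma> (p' @ s') = map (Transposition.transpose (hd s) (hd s')) (rotate1 (p' @ s'))"
  shows "map \<sigma> (p @ s' @ p' @ s) = rotate1 (p @ s' @ p' @ s)"
proof -
  obtain a q where s: "s = a # q" using assms(2) by (cases s) auto
  obtain b q' where s': "s' = b # q'" using assms(3) by (cases s') auto
  let ?h = "Transposition.transpose a b"
  have other: "map ?h q = q" "map ?h q' = q'"
    using assms(1) unfolding s s' by (simp_all add: map_transpose_other)
  have "a \<notin> set p" "b \<notin> set p" using assms(1) unfolding s s' by auto
  note otherp = map_transpose_tl_hd[OF this]
  have "a \<notin> set p'" "b \<notin> set p'" using assms(1) unfolding s s' by auto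
  note otherp' = map_transpose_tl_hd[OF this]
  let ?e = "if p = [] then [b] else [hd p]" and ?e' = "if p' = [] then [a] else [hd p']"
  have "map ?h (rotate1 (p @ s)) = tl (p @ [b]) @ (q @ ?e)"
    using other otherp unfolding s by (cases p) simp_all
  then have "map \<sigma> p @ map \<sigma> s = tl (p @ [b]) @ (q @ ?e)"
    using assms(4) by (simp add: s s')
  moreover have "map \<sigma> p @ map \<sigma> s = tl (p @ [b]) @ (q @ ?e) \<longleftrightarrow> map \<sigma> p = tl (p @ [b]) \<and> map \<sigma> s = q @ ?e"
    by (rule append_split) simp
  ultimately have A: "map \<sigma> p = tl (p @ [b])" "map \<sigma> s = q @ ?e" by blast+
  have "map ?h (rotate1 (p' @ s')) = tl (p' @ [a]) @ (q' @ ?e')"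
    using other otherp' unfolding s' by (cases p') simp_all
  then have "map \<sigma> p' @ map \<sigma> s' = tl (p' @ [a]) @ (q' @ ?e')"
    using assms(5) by (simp add: s s')
  moreover have "map \<sigma> p' @ map \<sigma> s' = tl (p' @ [a]) @ (q' @ ?e') \<longleftrightarrow> map \<sigma> p' = tl (p' @ [a]) \<and> map \<sigma> s' = q' @ ?e'"
    by (rule append_split) simp
  ultimately have B: "map \<sigma> p' = tl (p' @ [a])" "map \<sigma> s' = q' @ ?e'" by blast+
  have "rotate1 (p @ s' @ p' @ s) = tl (p @ [b]) @ (q' @ ?e') @ tl (p' @ [a]) @ (q @ ?e)"
    unfolding s s' by (cases p; cases p') simp_all
  then show ?thesis unfolding map_append A B by simp
qed

text \<open>Replacing the successor \<open>hd s\<close> by the outside point \<open>b\<close> opens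
  the cycle there: read from \<open>hd s\<close>, the word is a path of \<sigma> that leaves to
  \<open>b\<close>.\<close>

lemma word_out:
  assumes "distinct (p @ s)" "s \<noteq> []" "b \<notin> set (p @ s)"
  shows "map \<sigma> (p @ s) = map (Transposition.transpose (hd s) b) (rotate1 (p @ s)) \<longleftrightarrow>
    map \<sigma> (s @ p) = tl (s @ p) @ [b]"
proof -
  obtain a q where s: "s = a # q" using assms(2) by (cases s) auto
  let ?h = "Transposition.transpose a b" and ?e = "if p = [] then [b] else [hd p]"
  have other: "map ?h q = q"
    using assms unfolding s by (simp add: map_transpose_other)
  have "a \<notin> set p" "b \<notin> set p" using assms unfolding s by auto
  note otherp = map_transpose_tl_hd[OF this]
  have r: "map ?h (rotate1 (p @ s)) = tl (p @ [b]) @ (q @ ?e)"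
    using other otherp unfolding s by (cases p) simp_all
  have r2: "tl (s @ p) @ [b] = (q @ ?e) @ tl (p @ [b])"
    unfolding s by (cases p) simp_all
  have "map \<sigma> p @ map \<sigma> s = tl (p @ [b]) @ (q @ ?e) \<longleftrightarrow> map \<sigma> p = tl (p @ [b]) \<and> map \<sigma> s = q @ ?e"
    by (rule append_split) simp
  moreover have "map \<sigma> s @ map \<sigma> p = (q @ ?e) @ tl (p @ [b]) \<longleftrightarrow> map \<sigma> s = q @ ?e \<and> map \<sigma> p = tl (p @ [b])"
    by (rule append_split) (simp add: s)
  moreover have "hd s = a" by (simp add: s)
  ultimately show ?thesis unfolding map_append r2 \<open>hd s = a\<close> r[unfolded map_append] by blast
qed

lemma placementsD:
  assumes "w \<in> placements n I \<mu>"
  shows "t \<in> I \<Longrightarrow> length (w t) = \<mu> t" "t \<in> I \<Longrightarrow> distinct (w t)" "t \<in> I \<Longrightarrow> set (w t) \<subseteq> {1..n}"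
    "t \<notin> I \<Longrightarrow> w t = undefined" "s \<in> I \<Longrightarrow> t \<in> I \<Longrightarrow> s \<noteq> t \<Longrightarrow> set (w s) \<inter> set (w t) = {}"
  using assms by (auto simp: placements_def disjoint_family_on_def)

lemma placementsI:
  assumes "\<And>t. t \<in> I \<Longrightarrow> length (w t) = \<mu> t" "\<And>t. t \<in> I \<Longrightarrow> distinct (w t)"
    "\<And>t. t \<in> I \<Longrightarrow> set (w t) \<subseteq> {1..n}" "\<And>t. t \<notin> I \<Longrightarrow> w t = undefined"
    "\<And>s t. s \<in> I \<Longrightarrow> t \<in> I \<Longrightarrow> s \<noteq> t \<Longrightarrow> set (w s) \<inter> set (w t) = {}"
  shows "w \<in> placements n I \<mu>"
  using assms by (auto simp: placements_def disjoint_family_on_def)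

lemma follows_other:
  assumes "w \<in> placements n I \<mu>" "s \<in> I" "a \<notin> set (w s)" "b \<notin> set (w s)"
    and "follows (Transposition.transpose a b) \<sigma> I w"
  shows "map \<sigma> (w s) = rotate1 (w s)"
proof -
  have "map (Transposition.transpose a b) (rotate1 (w s)) = rotate1 (w s)"
    using assms by (intro map_transpose_other) auto
  then show ?thesis using assms(2,5) by (auto simp: follows_def)
qed

text \<open>The segment from position \<open>u\<close> up to \<open>v\<close> is cut out and stored
  at the fresh index \<open>f\<close>; splicing it back in at position \<open>u\<close> is the
  inverse. By \<open>word_cut\<close> both maps respect the cycle conditions.\<close>

lemma card_cut:
  assumes t: "t \<in> I" and f: "f \<notin> I" and uv: "u < v" "v < \<mu> t"
  shows "card {w \<in> placements n I \<mu>. follows (Transposition.transpose (w t ! u) (w t ! v)) \<sigma> I w} =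
    card (cycle_families n \<sigma> (insert f I) (\<mu>(t := \<mu> t - (v - u), f := v - u)))" (is "card ?A = card ?B")
proof -
  define \<phi> :: "(nat \<Rightarrow> nat list) \<Rightarrow> nat \<Rightarrow> nat list" where
    "\<phi> = (\<lambda>w. w(t := take u (w t) @ drop v (w t), f := take (v - u) (drop u (w t))))"
  define \<psi> :: "(nat \<Rightarrow> nat list) \<Rightarrow> nat \<Rightarrow> nat list" where
    "\<psi> = (\<lambda>w. w(t := take u (w t) @ w f @ drop u (w t), f := undefined))"
  have tf: "t \<noteq> f" using t f by auto
  have split: "xs = take u xs @ take (v - u) (drop u xs) @ drop v xs"
    if "length xs = \<mu> t" for xs :: "nat list"
    using that uv by (metis append_take_drop_id drop_drop le_add_diff_inverse2 less_imp_le)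
  have hds: "xs ! u = hd (take (v - u) (drop u xs))" "xs ! v = hd (drop v xs)"
      "take (v - u) (drop u xs) \<noteq> []" "drop v xs \<noteq> []"
    if "length xs = \<mu> t" for xs :: "nat list"
    using that uv by (auto simp: hd_drop_conv_nth hd_take)
  have "bij_betw \<phi> ?A ?B"
  proof (rule bij_betw_byWitness[where f' = \<psi>])
    show "\<forall>w\<in>?A. \<psi> (\<phi> w) = w"
    proof
      fix w assume "w \<in> ?A"
      then have w: "w \<in> placements n I \<mu>" by simp
      have "take u (w t) @ take (v - u) (drop u (w t)) @ drop v (w t) = w t"
        using split[of "w t"] placementsD(1)[OF w t] by simp
      then show "\<psi> (\<phi> w) = w"
        using placementsD(1)[OF w t] placementsD(4)[OF w f] tf uv
        by (auto simp: \<phi>_def \<psi>_def fun_eq_iff)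
    qed
    show "\<forall>w\<in>?B. \<phi> (\<psi> w) = w"
    proof
      fix w assume "w \<in> ?B"
      then have w: "w \<in> placements n (insert f I) (\<mu>(t := \<mu> t - (v - u), f := v - u))"
        by (simp add: cycle_families_def)
      have "length (w t) = \<mu> t - (v - u)" "length (w f) = v - u"
        using placementsD(1)[OF w] t f tf by auto
      then show "\<phi> (\<psi> w) = w"
        using tf uv by (auto simp: \<phi>_def \<psi>_def fun_eq_iff)
    qed
    show "\<phi> ` ?A \<subseteq> ?B"
    proof (rule image_subsetI)
      fix w assume "w \<in> ?A"
      then have w: "w \<in> placements n I \<mu>" and fl: "follows (Transposition.transpose (w t ! u) (w t ! v)) \<sigma> I w"
        by auto
      let ?p = "take u (w t)" and ?q = "take (v - u) (drop u (w t))" and ?s = "drop v (w t)"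
      note len = placementsD(1)[OF w t]
      have wt: "w t = ?p @ ?q @ ?s" by (rule split[OF len])
      have dist: "distinct (?p @ ?q @ ?s)" using placementsD(2)[OF w t] wt by simp
      then have dist2: "distinct (?p @ ?s)" "distinct ?q"
        by (simp_all only: distinct_append set_append) blast
      have "map \<sigma> (?p @ ?q @ ?s) = map (Transposition.transpose (hd ?q) (hd ?s)) (rotate1 (?p @ ?q @ ?s))"
        using fl t hds[OF len] by (simp add: follows_def wt[symmetric])
      then have cyc: "map \<sigma> ?q = rotate1 ?q" "map \<sigma> (?p @ ?s) = rotate1 (?p @ ?s)"
        using word_cut[OF dist hds(3,4)[OF len]] by blast+
      have other: "map \<sigma> (w s) = rotate1 (w s)" if "s \<in> I" "s \<noteq> t" for s
        using placementsD(5)[OF w that(1) t that(2)] len uv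
        by (intro follows_other[OF w that(1) _ _ fl]) (auto dest: nth_mem)
      have set: "set (?p @ ?s) \<subseteq> set (w t)" "set ?q \<subseteq> set (w t)"
        by (auto dest: in_set_takeD in_set_dropD)
      have phi: "\<phi> w t = ?p @ ?s" "\<phi> w f = ?q" "\<And>s. s \<noteq> t \<Longrightarrow> s \<noteq> f \<Longrightarrow> \<phi> w s = w s"
        using tf by (simp_all add: \<phi>_def)
      have "\<phi> w \<in> placements n (insert f I) (\<mu>(t := \<mu> t - (v - u), f := v - u))"
      proof (rule placementsI)
        fix s assume "s \<in> insert f I"
        then consider "s = t" | "s = f" | "s \<in> I" "s \<noteq> t" "s \<noteq> f" using f by blast
        then show "length (\<phi> w s) = (\<mu>(t := \<mu> t - (v - u), f := v - u)) s"
        proof cases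
          case 1 then show ?thesis using len uv tf by (simp add: \<phi>_def)
        next
          case 2 then show ?thesis using len uv by (simp add: \<phi>_def)
        next
          case 3 then show ?thesis using placementsD(1)[OF w, of s] by (simp add: \<phi>_def)
        qed
        show "distinct (\<phi> w s)"
          using \<open>s \<in> insert f I\<close> dist2 placementsD(2)[OF w, of s] phi by (metis insertE)
        show "set (\<phi> w s) \<subseteq> {1..n}"
          using \<open>s \<in> insert f I\<close> set placementsD(3)[OF w, of s] placementsD(3)[OF w t] phi
          by (metis insertE subset_trans)
      next
        fix s assume "s \<notin> insert f I"
        then show "\<phi> w s = undefined" using placementsD(4)[OF w] t by (auto simp: \<phi>_def)
      next
        fix s s' assume ss: "s \<in> insert f I" "s' \<in> insert f I" "s \<noteq> s'"
        \<comment> \<open>\<open>g\<close> sends a new index to the old word that contains its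
          letters. Disjointness is inherited from different old words, and only the pair
          \<open>t\<close>, \<open>f\<close> needs the distinctness of the word that was
          cut.\<close>
        define g where "g = (\<lambda>x. if x = f then t else x)"
        have sub: "set (\<phi> w x) \<subseteq> set (w (g x))" for x
          using set phi by (metis g_def order_refl)
        show "set (\<phi> w s) \<inter> set (\<phi> w s') = {}"
        proof (cases "g s = g s'")
          case True
          then have "{s, s'} = {t, f}" using \<open>s \<noteq> s'\<close> by (auto simp: g_def split: if_splits)
          moreover have "set (\<phi> w t) \<inter> set (\<phi> w f) = {}"
            unfolding phi using dist by (simp only: distinct_append set_append) blast
          ultimately show ?thesis by (metis doubleton_eq_iff inf_commute)
        next
          case False
          have "g s \<in> I" "g s' \<in> I" using ss t by (auto simp: g_def)
          then have "set (w (g s)) \<inter> set (w (g s')) = {}" using placementsD(5)[OF w] False by blast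
          then show ?thesis using sub[of s] sub[of s'] by blast
        qed
      qed
      moreover have "map \<sigma> (\<phi> w s) = rotate1 (\<phi> w s)" if "s \<in> insert f I" for s
        using cyc other[of s] phi that by (metis insertE)
      ultimately show "\<phi> w \<in> ?B" by (simp add: cycle_families_def)
    qed
    show "\<psi> ` ?B \<subseteq> ?A"
    proof (rule image_subsetI)
      fix w assume "w \<in> ?B"
      then have w: "w \<in> placements n (insert f I) (\<mu>(t := \<mu> t - (v - u), f := v - u))"
        and c: "\<And>s. s \<in> insert f I \<Longrightarrow> map \<sigma> (w s) = rotate1 (w s)" by (auto simp: cycle_families_def)
      have len: "length (w t) = \<mu> t - (v - u)" "length (w f) = v - u"
        using placementsD(1)[OF w] t f tf by auto
      let ?p = "take u (w t)" and ?q = "w f" and ?s = "drop u (w t)"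
      have ne: "?q \<noteq> []" "?s \<noteq> []" using len uv by auto
      have disj: "set (w t) \<inter> set (w f) = {}" using placementsD(5)[OF w] t tf by auto
      have dwt: "distinct (w t)" "distinct (w f)" using placementsD(2)[OF w] t by auto
      have sets: "set ?p \<union> set ?s = set (w t)"
        by (metis append_take_drop_id set_append)
      have "distinct (?p @ ?s)" using dwt by simp
      then have dist: "distinct (?p @ ?q @ ?s)" using disj sets dwt(2)
        by (simp only: distinct_append set_append) blast
      have psi: "\<psi> w t = ?p @ ?q @ ?s" "\<And>s. s \<noteq> t \<Longrightarrow> s \<noteq> f \<Longrightarrow> \<psi> w s = w s"
        using tf by (simp_all add: \<psi>_def)
      have nth: "\<psi> w t ! u = hd ?q" "\<psi> w t ! v = hd ?s"
        using len uv ne by (auto simp: psi nth_append hd_conv_nth)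
      have ft: "map \<sigma> (\<psi> w t) = map (Transposition.transpose (\<psi> w t ! u) (\<psi> w t ! v)) (rotate1 (\<psi> w t))"
      proof -
        have "map \<sigma> (?p @ ?q @ ?s) = map (Transposition.transpose (hd ?q) (hd ?s)) (rotate1 (?p @ ?q @ ?s))"
          using word_cut[OF dist ne, of \<sigma>] c[of t] c[of f] t by simp
        then show ?thesis unfolding nth unfolding psi(1) .
      qed
      have setpsi: "set (\<psi> w t) = set (w t) \<union> set (w f)"
        unfolding psi(1) using sets by auto
      have fs: "map \<sigma> (\<psi> w s) = map (Transposition.transpose (\<psi> w t ! u) (\<psi> w t ! v)) (rotate1 (\<psi> w s))"
        if s: "s \<in> I" "s \<noteq> t" for s
      proof -
        have "s \<noteq> f" using s f by auto
        have "set (w s) \<inter> set (w t) = {}" "set (w s) \<inter> set (w f) = {}"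
          using placementsD(5)[OF w, of s t] placementsD(5)[OF w, of s f] s t f by auto
        moreover have "hd ?q \<in> set (w f)" "hd ?s \<in> set (w t)"
          using ne hd_in_set in_set_dropD by metis+
        ultimately have "map (Transposition.transpose (\<psi> w t ! u) (\<psi> w t ! v)) (rotate1 (w s)) = rotate1 (w s)"
          unfolding nth by (intro map_transpose_other) auto
        then show ?thesis using c[of s] s \<open>s \<noteq> f\<close> by (simp add: psi)
      qed
      have "\<psi> w \<in> placements n I \<mu>"
      proof (rule placementsI)
        fix s assume s: "s \<in> I"
        then have "s \<noteq> f" using f by auto
        show "length (\<psi> w s) = \<mu> s"
        proof (cases "s = t")
          case True then show ?thesis using len uv by (simp add: psi)
        next
          case False then show ?thesis using placementsD(1)[OF w, of s] s \<open>s \<noteq> f\<close> by (simp add: psi)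
        qed
        show "distinct (\<psi> w s)"
          using placementsD(2)[OF w, of s] s \<open>s \<noteq> f\<close> dist psi by (metis insertI2)
        show "set (\<psi> w s) \<subseteq> {1..n}"
        proof (cases "s = t")
          case True then show ?thesis
            using placementsD(3)[OF w, of t] placementsD(3)[OF w, of f] t setpsi by simp
        next
          case False then show ?thesis using placementsD(3)[OF w, of s] s \<open>s \<noteq> f\<close> by (simp add: psi)
        qed
      next
        fix s assume s: "s \<notin> I"
        then show "\<psi> w s = undefined"
          using placementsD(4)[OF w, of s] t psi(2)[of s] by (cases "s = f") (auto simp: \<psi>_def)
      next
        fix s s' assume ss: "s \<in> I" "s' \<in> I" "s \<noteq> s'"
        then have "s \<noteq> f" "s' \<noteq> f" using f by auto
        moreover have "set (\<psi> w x) = set (w x)" if "x \<noteq> t" "x \<noteq> f" for x using that by (simp add: psi)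
        moreover have "set (w x) \<inter> (set (w t) \<union> set (w f)) = {}" if "x \<in> I" "x \<noteq> t" for x
          using placementsD(5)[OF w, of x t] placementsD(5)[OF w, of x f] that t f by blast
        moreover have "set (w s) \<inter> set (w s') = {}"
          using placementsD(5)[OF w, of s s'] ss by simp
        ultimately show "set (\<psi> w s) \<inter> set (\<psi> w s') = {}"
          using ss setpsi by (metis Int_commute)
      qed
      moreover have "follows (Transposition.transpose (\<psi> w t ! u) (\<psi> w t ! v)) \<sigma> I (\<psi> w)"
        unfolding follows_def using ft fs by metis
      ultimately show "\<psi> w \<in> ?A" by simp
    qed
  qed
  then show ?thesis by (rule bij_betw_same_card)
qed

text \<open>The word of \<open>t'\<close>, read from its position \<open>u'\<close>, is spliced into
  the word of \<open>t\<close> at position \<open>u\<close>. The lengths of the four pieces are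
  known, so both words can be recovered.\<close>

lemma card_join:
  assumes I: "finite I" and t: "t \<in> I" "t' \<in> I" "t \<noteq> t'" and u: "u < \<mu> t" "u' < \<mu> t'"
  shows "card {w \<in> placements n I \<mu>. follows (Transposition.transpose (w t ! u) (w t' ! u')) \<sigma> I w} \<le>
    card (cycle_families n \<sigma> (I - {t'}) (\<mu>(t := \<mu> t + \<mu> t')))" (is "card ?A \<le> card ?B")
proof (rule card_inj_on_le)
  define \<phi> :: "(nat \<Rightarrow> nat list) \<Rightarrow> nat \<Rightarrow> nat list" where
    "\<phi> = (\<lambda>w. w(t := take u (w t) @ drop u' (w t') @ take u' (w t') @ drop u (w t), t' := undefined))"
  show "finite ?B" using I by (intro finite_cycle_families) auto
  show "inj_on \<phi> ?A"
  proof (rule inj_onI)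
    fix w x assume wx: "w \<in> ?A" "x \<in> ?A" and eq: "\<phi> w = \<phi> x"
    have w: "w \<in> placements n I \<mu>" and x: "x \<in> placements n I \<mu>" using wx by auto
    note len = placementsD(1)[OF w] placementsD(1)[OF x]
    have "\<phi> w t = \<phi> x t" using eq by simp
    then have "take u (w t) @ drop u' (w t') @ take u' (w t') @ drop u (w t) =
      take u (x t) @ drop u' (x t') @ take u' (x t') @ drop u (x t)"
      using t by (simp add: \<phi>_def)
    then have e: "take u (w t) = take u (x t)" "drop u' (w t') = drop u' (x t')"
      "take u' (w t') = take u' (x t')" "drop u (w t) = drop u (x t)"
      using len t u by (auto simp: append_eq_append_conv)
    have "w t = x t" "w t' = x t'" using e by (metis append_take_drop_id)+
    moreover have "w s = x s" if "s \<noteq> t" "s \<noteq> t'" for s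
      using fun_cong[OF eq, of s] that by (simp add: \<phi>_def)
    ultimately show "w = x" by (metis ext)
  qed
  show "\<phi> ` ?A \<subseteq> ?B"
  proof (rule image_subsetI)
    fix w assume "w \<in> ?A"
    then have w: "w \<in> placements n I \<mu>" and fl: "follows (Transposition.transpose (w t ! u) (w t' ! u')) \<sigma> I w"
      by auto
    note len = placementsD(1)[OF w t(1)] placementsD(1)[OF w t(2)]
    let ?p = "take u (w t)" and ?s = "drop u (w t)" and ?p' = "take u' (w t')" and ?s' = "drop u' (w t')"
    have ne: "?s \<noteq> []" "?s' \<noteq> []" and hd: "w t ! u = hd ?s" "w t' ! u' = hd ?s'"
      using len u by (auto simp: hd_drop_conv_nth)
    have sets: "set ?p \<union> set ?s = set (w t)" "set ?p' \<union> set ?s' = set (w t')"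
      by (metis append_take_drop_id set_append)+
    have "distinct (?p @ ?s)" "distinct (?p' @ ?s')"
      using placementsD(2)[OF w] t by auto
    moreover have disj: "set (w t) \<inter> set (w t') = {}" using placementsD(5)[OF w t] .
    ultimately have dist: "distinct (?p @ ?s @ ?p' @ ?s')" using sets
      by (simp only: distinct_append set_append) blast
    then have dist': "distinct (?p @ ?s' @ ?p' @ ?s)"
      by (simp only: distinct_append set_append) blast
    have "map \<sigma> (?p @ ?s) = map (Transposition.transpose (hd ?s) (hd ?s')) (rotate1 (?p @ ?s))"
      "map \<sigma> (?p' @ ?s') = map (Transposition.transpose (hd ?s) (hd ?s')) (rotate1 (?p' @ ?s'))"
      using fl t hd by (simp_all add: follows_def)
    then have cyc: "map \<sigma> (?p @ ?s' @ ?p' @ ?s) = rotate1 (?p @ ?s' @ ?p' @ ?s)"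
      by (rule word_join[OF dist ne])
    have phi: "\<phi> w t = ?p @ ?s' @ ?p' @ ?s" "\<And>s. s \<noteq> t \<Longrightarrow> s \<noteq> t' \<Longrightarrow> \<phi> w s = w s"
      using t by (simp_all add: \<phi>_def)
    have setphi: "set (\<phi> w t) = set (w t) \<union> set (w t')"
      using sets t by (auto simp: \<phi>_def)
    have other: "map \<sigma> (w s) = rotate1 (w s)" if "s \<in> I" "s \<noteq> t" "s \<noteq> t'" for s
      using placementsD(5)[OF w that(1) t(1) that(2)] placementsD(5)[OF w that(1) t(2) that(3)] len u
      by (intro follows_other[OF w that(1) _ _ fl]) (auto dest: nth_mem)
    have "\<phi> w \<in> placements n (I - {t'}) (\<mu>(t := \<mu> t + \<mu> t'))"
    proof (rule placementsI)
      fix s assume s: "s \<in> I - {t'}"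
      show "length (\<phi> w s) = (\<mu>(t := \<mu> t + \<mu> t')) s"
        using placementsD(1)[OF w, of s] s t len u phi by (cases "s = t") auto
      show "set (\<phi> w s) \<subseteq> {1..n}"
        using placementsD(3)[OF w, of s] placementsD(3)[OF w, of t'] s t setphi phi
        by (cases "s = t") (simp_all del: atLeastAtMost_iff)
      show "distinct (\<phi> w s)"
        using placementsD(2)[OF w, of s] s dist' phi by (metis DiffE singletonI)
    next
      fix s assume "s \<notin> I - {t'}"
      then show "\<phi> w s = undefined" using placementsD(4)[OF w] t by (auto simp: \<phi>_def)
    next
      fix s s' assume ss: "s \<in> I - {t'}" "s' \<in> I - {t'}" "s \<noteq> s'"
      moreover have "set (\<phi> w x) = set (w x)" if "x \<noteq> t" "x \<noteq> t'" for x using that by (simp add: phi)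
      moreover have "set (w x) \<inter> (set (w t) \<union> set (w t')) = {}" if "x \<in> I - {t'}" "x \<noteq> t" for x
        using placementsD(5)[OF w, of x t] placementsD(5)[OF w, of x t'] that t by blast
      moreover have "set (w s) \<inter> set (w s') = {}"
        using placementsD(5)[OF w, of s s'] ss by simp
      ultimately show "set (\<phi> w s) \<inter> set (\<phi> w s') = {}"
        using ss setphi by (metis DiffE Int_commute singletonI)
    qed
    moreover have "map \<sigma> (\<phi> w s) = rotate1 (\<phi> w s)" if "s \<in> I - {t'}" for s
      using cyc other[of s] phi that by (metis DiffE singletonI)
    ultimately show "\<phi> w \<in> ?B" by (simp add: cycle_families_def)
  qed
qed

section \<open>Multiplication by a transposition\<close>

definition trail :: "('a \<Rightarrow> 'a) \<Rightarrow> nat \<Rightarrow> 'a \<Rightarrow> 'a list" where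
  "trail \<sigma> i x = map (\<lambda>m. (\<sigma> ^^ m) x) [0..<i]"

lemma length_trail [simp]: "length (trail \<sigma> i x) = i"
  by (simp add: trail_def)

lemma trail_nth [simp]: "m < i \<Longrightarrow> trail \<sigma> i x ! m = (\<sigma> ^^ m) x"
  by (simp add: trail_def)

lemma set_trail: "set (trail \<sigma> i x) = (\<lambda>m. (\<sigma> ^^ m) x) ` {..<i}"
  by (auto simp: trail_def)

lemma hd_trail: "0 < i \<Longrightarrow> hd (trail \<sigma> i x) = x"
  by (simp add: hd_conv_nth trail_def upt_conv_Cons)

lemma map_trail: "map \<sigma> (trail \<sigma> i x) = tl (trail \<sigma> i x @ [(\<sigma> ^^ i) x])"
proof (rule nth_equalityI)
  fix m assume "m < length (map \<sigma> (trail \<sigma> i x))"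
  then show "map \<sigma> (trail \<sigma> i x) ! m = tl (trail \<sigma> i x @ [(\<sigma> ^^ i) x]) ! m"
    by (cases "Suc m = i") (auto simp: nth_tl nth_append)
qed simp

text \<open>Each letter is the image of the preceding one, so the first letter determines the word
  and its exit point.\<close>

lemma trail_unique:
  assumes "P \<noteq> []" "map \<sigma> P = tl P @ [b]"
  shows "P = trail \<sigma> (length P) (hd P)" "b = (\<sigma> ^^ length P) (hd P)"
proof -
  have step: "\<sigma> (P ! m) = (P @ [b]) ! Suc m" if "m < length P" for m
  proof -
    have "\<sigma> (P ! m) = map \<sigma> P ! m" using that by simp
    also have "\<dots> = tl (P @ [b]) ! m" using assms by simp
    finally show ?thesis using that by (simp add: nth_tl)
  qed
  have *: "(P @ [b]) ! m = (\<sigma> ^^ m) (hd P)" if "m \<le> length P" for m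
    using that
  proof (induction m)
    case 0 then show ?case using assms(1) by (simp add: hd_conv_nth nth_append)
  next
    case (Suc m)
    then show ?case using step[of m] by (simp add: nth_append)
  qed
  show "P = trail \<sigma> (length P) (hd P)"
  proof (rule nth_equalityI)
    fix m assume "m < length P"
    then show "P ! m = trail \<sigma> (length P) (hd P) ! m" using *[of m] by (simp add: nth_append)
  qed simp
  show "b = (\<sigma> ^^ length P) (hd P)" using *[of "length P"] by simp
qed

lemma distinct_trail:
  assumes "inj \<sigma>" "\<And>r. 0 < r \<Longrightarrow> r < i \<Longrightarrow> (\<sigma> ^^ r) x \<noteq> x"
  shows "distinct (trail \<sigma> i x)"
proof -
  have "(\<sigma> ^^ a) x \<noteq> (\<sigma> ^^ b) x" if "a < b" "b < i" for a b
  proof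
    assume "(\<sigma> ^^ a) x = (\<sigma> ^^ b) x"
    also have "(\<sigma> ^^ b) x = (\<sigma> ^^ a) ((\<sigma> ^^ (b - a)) x)"
      using that by (simp add: funpow_add[symmetric, THEN fun_cong, unfolded o_def])
    finally have "x = (\<sigma> ^^ (b - a)) x" using inj_fn[OF assms(1), of a] by (simp add: inj_eq)
    then show False using assms(2)[of "b - a"] that by (metis diff_is_0_eq less_imp_diff_less not_gr_zero not_le)
  qed
  then show ?thesis
    unfolding distinct_conv_nth by (metis length_trail nat_neq_iff trail_nth)
qed

text \<open>The letters of a cycle word form a set mapped onto itself, and injectivity forbids
  entering such a set from outside. Hence the orbit of a point outside a family of cycles never
  meets the family.\<close>

lemma cycle_word_invariant:
  assumes "map \<sigma> w = rotate1 w" "inj \<sigma>" "(\<sigma> ^^ m) x \<in> set w"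
  shows "x \<in> set w"
proof -
  have im: "\<sigma> ` set w = set w" using arg_cong[OF assms(1), of set] by simp
  have pre: "y \<in> set w" if "\<sigma> y \<in> set w" for y
    using that inj_image_mem_iff[OF assms(2), of y "set w"] unfolding im by blast
  show ?thesis using assms(3) by (induction m) (auto dest: pre)
qed

definition points :: "nat set \<Rightarrow> (nat \<Rightarrow> nat list) \<Rightarrow> nat set" where
  "points I w = (\<Union>t\<in>I. set (w t))"

text \<open>The case in which exactly one of the two transposed points lies in the family. The pairs
  record \<open>b\<close> because the transpositions are counted, although the word turns out to
  determine it.\<close>

definition departures ::
  "nat \<Rightarrow> (nat \<Rightarrow> nat) \<Rightarrow> nat set \<Rightarrow> (nat \<Rightarrow> nat) \<Rightarrow> nat \<Rightarrow> nat \<Rightarrow> ((nat \<Rightarrow> nat list) \<times> nat) set" where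
  "departures n \<sigma> I \<mu> t u = {(w, b). w \<in> placements n I \<mu> \<and> b \<in> {1..n} - points I w \<and>
     follows (Transposition.transpose (w t ! u) b) \<sigma> I w}"

text \<open>By \<open>word_out\<close> the word \<open>t\<close>, read from position
  \<open>u\<close>, is a path of \<sigma>. Its letter there therefore determines the whole word and
  the outside point.\<close>

lemma departure_trail:
  assumes "(w, b) \<in> departures n \<sigma> I \<mu> t u" "t \<in> I" "u < \<mu> t"
  shows "drop u (w t) @ take u (w t) = trail \<sigma> (\<mu> t) (w t ! u)" "b = (\<sigma> ^^ \<mu> t) (w t ! u)"
proof -
  have w: "w \<in> placements n I \<mu>" and fl: "follows (Transposition.transpose (w t ! u) b) \<sigma> I w"
    and b: "b \<notin> points I w" using assms(1) by (auto simp: departures_def)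
  note len = placementsD(1)[OF w assms(2)]
  let ?p = "take u (w t)" and ?s = "drop u (w t)"
  have ne: "?s \<noteq> []" "w t ! u = hd ?s" using len assms(3) by (auto simp: hd_drop_conv_nth)
  have "b \<notin> set (?p @ ?s)" using b assms(2) by (auto simp: points_def)
  moreover have "map \<sigma> (?p @ ?s) = map (Transposition.transpose (hd ?s) b) (rotate1 (?p @ ?s))"
    using fl assms(2) ne(2) by (simp add: follows_def)
  moreover have "distinct (?p @ ?s)" using placementsD(2)[OF w assms(2)] by simp
  ultimately have "map \<sigma> (?s @ ?p) = tl (?s @ ?p) @ [b]" using word_out[OF _ ne(1)] by blast
  from trail_unique[OF _ this] show "?s @ ?p = trail \<sigma> (\<mu> t) (w t ! u)" "b = (\<sigma> ^^ \<mu> t) (w t ! u)"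
    using ne len by (metis append_is_Nil_conv hd_append2 length_append length_drop length_take add.commute append_take_drop_id)+
qed

lemma placements_remove:
  assumes "w \<in> placements n I \<mu>"
  shows "w(t := undefined) \<in> placements n (I - {t}) \<mu>"
proof (rule placementsI)
  fix s s' assume "s \<in> I - {t}" "s' \<in> I - {t}" "s \<noteq> s'"
  then show "set ((w(t := undefined)) s) \<inter> set ((w(t := undefined)) s') = {}"
    using placementsD(5)[OF assms, of s s'] by simp
qed (use placementsD(1-4)[OF assms] in auto)

lemma placements_insert:
  assumes w: "w \<in> placements n (I - {t}) \<mu>" and t: "t \<in> I"
    and xs: "length xs = i" "distinct xs" "set xs \<subseteq> {1..n}" "set xs \<inter> points (I - {t}) w = {}"
  shows "w(t := xs) \<in> placements n I (\<mu>(t := i))"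
proof (rule placementsI)
  fix s s' assume ss: "s \<in> I" "s' \<in> I" "s \<noteq> s'"
  have "set xs \<inter> set (w x) = {}" if "x \<in> I" "x \<noteq> t" for x
    using xs(4) that by (auto simp: points_def)
  moreover have "set (w s) \<inter> set (w s') = {}" if "s \<noteq> t" "s' \<noteq> t"
    using placementsD(5)[OF w, of s s'] ss that by simp
  ultimately show "set ((w(t := xs)) s) \<inter> set ((w(t := xs)) s') = {}"
    using ss by (metis Int_commute fun_upd_other fun_upd_same)
next
  fix s assume s: "s \<in> I"
  show "length ((w(t := xs)) s) = (\<mu>(t := i)) s"
    using s xs(1) placementsD(1)[OF w, of s] by (cases "s = t") simp_all
  show "distinct ((w(t := xs)) s)"
    using s xs(2) placementsD(2)[OF w, of s] by (cases "s = t") simp_all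
  show "set ((w(t := xs)) s) \<subseteq> {1..n}"
    using s xs(3) placementsD(3)[OF w, of s] by (cases "s = t") simp_all
next
  fix s assume "s \<notin> I"
  then show "(w(t := xs)) s = undefined" using placementsD(4)[OF w, of s] t by (cases "s = t") simp_all
qed

lemma finite_departures: "finite I \<Longrightarrow> finite (departures n \<sigma> I \<mu> t u)"
  by (rule finite_subset[of _ "placements n I \<mu> \<times> {1..n}"]) (auto simp: departures_def finite_placements)

lemma departure_remove:
  assumes "t \<in> I" "u < \<mu> t" and wb: "(w, b) \<in> departures n \<sigma> I \<mu> t u"
  shows "(w(t := undefined), w t ! u) \<in> cycle_families n \<sigma> (I - {t}) \<mu> \<times> {1..n}"
proof -
  have w: "w \<in> placements n I \<mu>" and fl: "follows (Transposition.transpose (w t ! u) b) \<sigma> I w"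
    and b: "b \<notin> points I w" using wb by (auto simp: departures_def)
  have mem: "w t ! u \<in> set (w t)" using placementsD(1)[OF w assms(1)] assms(2) by simp
  have "map \<sigma> (w s) = rotate1 (w s)" if "s \<in> I" "s \<noteq> t" for s
    using b that mem placementsD(5)[OF w that(1) assms(1) that(2)]
    by (intro follows_other[OF w that(1) _ _ fl]) (auto simp: points_def)
  then show ?thesis
    using placements_remove[OF w, of t] mem placementsD(3)[OF w assms(1)]
    by (auto simp: cycle_families_def)
qed

text \<open>Given the other words, a departing word is determined by one letter, for which there are
  at most \<open>n\<close> choices.\<close>

lemma card_departures_le:
  assumes I: "finite I" and t: "t \<in> I" and u: "u < \<mu> t"
  shows "card (departures n \<sigma> I \<mu> t u) \<le> n * card (cycle_families n \<sigma> (I - {t}) \<mu>)"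
proof -
  have "card (departures n \<sigma> I \<mu> t u) \<le> card (cycle_families n \<sigma> (I - {t}) \<mu> \<times> {1..n})"
  proof (rule card_inj_on_le)
    show "finite (cycle_families n \<sigma> (I - {t}) \<mu> \<times> {1..n})" using I by (simp add: finite_cycle_families)
    show "(\<lambda>(w, b). (w(t := undefined), w t ! u)) ` departures n \<sigma> I \<mu> t u \<subseteq> cycle_families n \<sigma> (I - {t}) \<mu> \<times> {1..n}"
      using departure_remove[where \<mu> = \<mu>, OF t u] by auto
    show "inj_on (\<lambda>(w, b). (w(t := undefined), w t ! u)) (departures n \<sigma> I \<mu> t u)"
    proof (rule inj_onI, clarify)
      fix w b x c
      assume wb: "(w, b) \<in> departures n \<sigma> I \<mu> t u" and xc: "(x, c) \<in> departures n \<sigma> I \<mu> t u"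
        and eq: "w(t := undefined) = x(t := undefined)" "w t ! u = x t ! u"
      note P = departure_trail[where \<mu> = \<mu>, OF wb t u] departure_trail[where \<mu> = \<mu>, OF xc t u]
      have len: "length (w t) = \<mu> t" "length (x t) = \<mu> t"
        using wb xc t by (auto simp: departures_def dest: placementsD(1))
      have "drop u (w t) @ take u (w t) = drop u (x t) @ take u (x t)" using P eq by simp
      then have "drop u (w t) = drop u (x t) \<and> take u (w t) = take u (x t)"
        by (subst (asm) append_split) (simp_all add: len)
      then have "w t = x t" by (metis append_take_drop_id)
      then have "w = x" using eq(1) by (metis fun_upd_triv fun_upd_upd)
      then show "w = x \<and> b = c" using P by simp
    qed
  qed
  then show ?thesis by (simp add: card_cartesian_product mult.commute)
qed

lemma card_points:
  assumes "finite I" "w \<in> placements n I \<mu>"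
  shows "card (points I w) = sum \<mu> I"
proof -
  have "card (points I w) = (\<Sum>t\<in>I. card (set (w t)))"
    unfolding points_def using assms placementsD(5)[OF assms(2)]
    by (intro card_UN_disjoint) auto
  also have "\<dots> = sum \<mu> I"
    using placementsD(1,2)[OF assms(2)] by (intro sum.cong) (auto simp: distinct_card)
  finally show ?thesis .
qed

text \<open>Every point \<open>x\<close> extends along its orbit to a departure, with two kinds of
  exception: \<open>x\<close> lies in another word of the family, or its orbit closes after at most
  \<open>\<mu> t\<close> steps. The two extra terms on the right bound these exceptions; the second
  records the closed orbit as a word of its own length \<open>r\<close>.\<close>

lemma card_departures_ge:
  assumes I: "finite I" and t: "t \<in> I" and u: "u < \<mu> t" and \<sigma>: "\<sigma> permutes {1..n}"
  shows "n * card (cycle_families n \<sigma> (I - {t}) \<mu>) \<le> card (departures n \<sigma> I \<mu> t u) +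
    sum \<mu> (I - {t}) * card (cycle_families n \<sigma> (I - {t}) \<mu>) +
    (\<Sum>r=1..\<mu> t. card (cycle_families n \<sigma> I (\<mu>(t := r))))"
proof -
  let ?C = "cycle_families n \<sigma> (I - {t}) \<mu>"
  let ?X1 = "Sigma ?C (points (I - {t}))"
  let ?X2 = "(\<lambda>(w, b). (w(t := undefined), w t ! u)) ` departures n \<sigma> I \<mu> t u"
  let ?X3 = "\<Union>r\<in>{1..\<mu> t}. (\<lambda>w. (w(t := undefined), w t ! 0)) ` cycle_families n \<sigma> I (\<mu>(t := r))"
  have inj: "inj \<sigma>" using \<sigma> by (rule permutes_inj)
  have orbit_in: "(\<sigma> ^^ m) x \<in> {1..n}" if "x \<in> {1..n}" for m x
  proof (induction m)
    case (Suc m)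
    then show ?case using permutes_in_image[OF \<sigma>, of "(\<sigma> ^^ m) x"] by (simp only: funpow.simps o_apply)
  qed (use that in simp)
  have "?C \<times> {1..n} \<subseteq> ?X1 \<union> ?X2 \<union> ?X3"
  proof (rule subsetI)
    fix y assume "y \<in> ?C \<times> {1..n}"
    then obtain w x where y: "y = (w, x)" and w: "w \<in> ?C" and x: "x \<in> {1..n}" by auto
    have wp: "w \<in> placements n (I - {t}) \<mu>" using w by (simp add: cycle_families_def)
    have wt: "w(t := undefined) = w" using placementsD(4)[OF wp, of t] by (simp add: fun_upd_idem)
    have wc: "map \<sigma> (w s) = rotate1 (w s)" if "s \<in> I - {t}" for s
      using w that by (simp add: cycle_families_def)
    show "y \<in> ?X1 \<union> ?X2 \<union> ?X3"
    proof (cases "x \<in> points (I - {t}) w")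
      case True
      then show ?thesis using w y by blast
    next
      case False
      then have avoid: "(\<sigma> ^^ m) x \<notin> points (I - {t}) w" for m
        using cycle_word_invariant[OF wc inj] by (auto simp: points_def)
      then have avoid': "set (trail \<sigma> m x) \<inter> points (I - {t}) w = {}" for m
        by (auto simp: set_trail)
      have in_n: "set (trail \<sigma> m x) \<subseteq> {1..n}" for m
        using orbit_in[OF x] by (auto simp: set_trail)
      \<comment> \<open>A return after exactly \<open>\<mu> t\<close> steps is an exception as well:
        the exit point would then be \<open>x\<close>, which lies inside the word.\<close>
      show ?thesis
      proof (cases "\<exists>r. 0 < r \<and> r \<le> \<mu> t \<and> (\<sigma> ^^ r) x = x")
        case True
        define r where "r = (LEAST r. 0 < r \<and> r \<le> \<mu> t \<and> (\<sigma> ^^ r) x = x)"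
        have r: "0 < r" "r \<le> \<mu> t" "(\<sigma> ^^ r) x = x"
          using LeastI_ex[OF True] by (simp_all add: r_def)
        have dist: "distinct (trail \<sigma> r x)"
        proof (rule distinct_trail[OF inj])
          fix q assume "0 < q" "q < r"
          then show "(\<sigma> ^^ q) x \<noteq> x" using not_less_Least[of q] r(2) unfolding r_def by fastforce
        qed
        have "w(t := trail \<sigma> r x) \<in> placements n I (\<mu>(t := r))"
          by (rule placements_insert[OF wp t]) (use dist in_n avoid' in auto)
        moreover have "map \<sigma> (trail \<sigma> r x) = rotate1 (trail \<sigma> r x)"
        proof -
          have "trail \<sigma> r x \<noteq> []" using r(1) by (simp add: trail_def)
          then have "rotate1 (trail \<sigma> r x) = tl (trail \<sigma> r x) @ [x]"
            using hd_trail[OF r(1), of \<sigma> x] by (cases "trail \<sigma> r x") auto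
          then show ?thesis using map_trail[of \<sigma> r x] r(3) \<open>trail \<sigma> r x \<noteq> []\<close> by simp
        qed
        ultimately have cf: "w(t := trail \<sigma> r x) \<in> cycle_families n \<sigma> I (\<mu>(t := r))"
          using wc by (simp add: cycle_families_def)
        have "y \<in> (\<lambda>w. (w(t := undefined), w t ! 0)) ` cycle_families n \<sigma> I (\<mu>(t := r))"
          by (rule image_eqI[OF _ cf]) (use wt r in \<open>simp add: y\<close>)
        moreover have "r \<in> {1..\<mu> t}" using r(1,2) by simp
        ultimately show ?thesis by blast
      next
        case False
        define P where "P = trail \<sigma> (\<mu> t) x"
        \<comment> \<open>The path is rotated so that its start \<open>x\<close> stands at position
          \<open>u\<close>.\<close>
        define ws where "ws = drop (\<mu> t - u) P @ take (\<mu> t - u) P"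
        have P: "length P = \<mu> t" "P \<noteq> []" "hd P = x"
          using u by (auto simp: P_def trail_def hd_trail[unfolded trail_def])
        have split: "take u ws = drop (\<mu> t - u) P" "drop u ws = take (\<mu> t - u) P"
          using P u by (auto simp: ws_def)
        have sets: "set ws = set P"
          unfolding ws_def by (metis Un_commute append_take_drop_id set_append)
        have "distinct P" unfolding P_def by (rule distinct_trail[OF inj]) (use False in \<open>meson less_imp_le\<close>)
        moreover have len: "length ws = \<mu> t" using P u by (simp add: ws_def)
        ultimately have dist: "distinct ws" using P by (intro card_distinct) (simp add: sets distinct_card)
        define b where "b = (\<sigma> ^^ \<mu> t) x"
        have b: "b \<notin> set P"
        proof
          assume "b \<in> set P"
          then obtain m where m: "m < \<mu> t" "(\<sigma> ^^ \<mu> t) x = (\<sigma> ^^ m) x" by (auto simp: P_def set_trail b_def)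
          have "(\<sigma> ^^ \<mu> t) x = (\<sigma> ^^ m) ((\<sigma> ^^ (\<mu> t - m)) x)"
            using m(1) by (simp add: funpow_add[symmetric, THEN fun_cong, unfolded o_def])
          then have "(\<sigma> ^^ (\<mu> t - m)) x = x" using m inj_fn[OF inj, of m] by (simp add: inj_eq)
          moreover have "0 < \<mu> t - m" "\<mu> t - m \<le> \<mu> t" using m(1) by simp_all
          ultimately show False using False by blast
        qed
        have ne: "drop u ws \<noteq> []" using len u by simp
        have nth: "hd (drop u ws) = x" "ws ! u = x"
        proof -
          show "hd (drop u ws) = x" unfolding split using P u by (simp add: hd_take)
          then show "ws ! u = x" using len u by (simp add: hd_drop_conv_nth)
        qed
        have pl: "w(t := ws) \<in> placements n I \<mu>"
          using placements_insert[OF wp t len dist, unfolded sets] in_n[of "\<mu> t"] avoid'[of "\<mu> t"]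
          by (simp add: P_def)
        have "map \<sigma> (drop u ws @ take u ws) = tl (drop u ws @ take u ws) @ [b]"
        proof -
          have "drop u ws @ take u ws = P" unfolding split by simp
          then show ?thesis using map_trail[of \<sigma> "\<mu> t" x] P by (simp add: b_def P_def)
        qed
        then have ft: "map \<sigma> ws = map (Transposition.transpose x b) (rotate1 ws)"
          using word_out[of "take u ws" "drop u ws" b \<sigma>] dist ne b sets nth by simp
        have fs: "map \<sigma> (w s) = map (Transposition.transpose x b) (rotate1 (w s))" if "s \<in> I - {t}" for s
        proof -
          have "x \<notin> set (w s)" "b \<notin> set (w s)"
            using avoid[of 0] avoid[of "\<mu> t"] that by (auto simp: b_def points_def)
          then show ?thesis using wc[OF that] by (simp add: map_transpose_other)
        qed
        have "follows (Transposition.transpose x b) \<sigma> I (w(t := ws))"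
          using ft fs by (simp add: follows_def)
        moreover have "b \<notin> points I (w(t := ws))"
          using b avoid[of "\<mu> t"] sets by (auto simp: points_def b_def split: if_splits)
        moreover have "b \<in> {1..n}" using orbit_in[OF x] by (simp add: b_def)
        ultimately have dep: "(w(t := ws), b) \<in> departures n \<sigma> I \<mu> t u"
          using pl nth by (simp add: departures_def)
        have "y \<in> ?X2" by (rule image_eqI[OF _ dep]) (use wt nth in \<open>simp add: y\<close>)
        then show ?thesis by blast
      qed
    qed
  qed
  moreover have finC: "finite ?C" using I by (simp add: finite_cycle_families)
  moreover have finX1: "finite ?X1" using finC I by (intro finite_SigmaI) (auto simp: points_def)
  moreover have finX2: "finite ?X2" using finite_departures[OF I] by simp
  moreover have finX3: "finite ?X3" using finite_cycle_families[OF I] by simp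
  ultimately have "card (?C \<times> {1..n}) \<le> card (?X1 \<union> ?X2 \<union> ?X3)"
    by (intro card_mono) auto
  also have "\<dots> \<le> card ?X1 + card ?X2 + card ?X3"
    using card_Un_le[of "?X1 \<union> ?X2" ?X3] card_Un_le[of ?X1 ?X2] by linarith
  also have "card ?X1 = (\<Sum>w\<in>?C. card (points (I - {t}) w))"
    using finC I by (intro card_SigmaI) (auto simp: points_def)
  also have "\<dots> = (\<Sum>w\<in>?C. sum \<mu> (I - {t}))"
    using I by (intro sum.cong refl card_points) (auto simp: cycle_families_def)
  also have "card ?X2 \<le> card (departures n \<sigma> I \<mu> t u)"
    by (rule card_image_le[OF finite_departures[OF I]])
  also have "card ?X3 \<le> (\<Sum>r=1..\<mu> t. card ((\<lambda>w. (w(t := undefined), w t ! 0)) ` cycle_families n \<sigma> I (\<mu>(t := r))))"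
    by (rule card_UN_le) simp
  also have "\<dots> \<le> (\<Sum>r=1..\<mu> t. card (cycle_families n \<sigma> I (\<mu>(t := r))))"
    by (intro sum_mono card_image_le finite_cycle_families I)
  finally show ?thesis by (simp add: card_cartesian_product mult.commute add.commute)
qed

section \<open>Summation over all transpositions\<close>

lemma sum_transpositions:
  fixes g :: "(nat \<Rightarrow> nat) \<Rightarrow> nat"
  shows "2 * (\<Sum>h\<in>transpositions n. g h) =
    (\<Sum>a\<in>{1..n}. \<Sum>b\<in>{1..n} - {a}. g (Transposition.transpose a b))"
proof -
  let ?L = "{(a, b). a \<in> {1..n} \<and> b \<in> {1..n} \<and> a < b}"
  let ?G = "{(a, b). a \<in> {1..n} \<and> b \<in> {1..n} \<and> b < a}"
  have fin: "finite ?L" "finite ?G"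
    by (rule finite_subset[of _ "{1..n} \<times> {1..n}"]; auto)+
  have img: "transpositions n = (\<lambda>(a, b). Transposition.transpose a b) ` ?L"
    by (force simp: transpositions_def image_iff)
  have inj: "inj_on (\<lambda>(a, b). Transposition.transpose a b) ?L"
  proof (rule inj_onI, clarify)
    fix a b c d :: nat
    assume "a < b" "c < d" and eq: "Transposition.transpose a b = Transposition.transpose c d"
    have "{x. Transposition.transpose a b x \<noteq> x} = {a, b}" "{x. Transposition.transpose c d x \<noteq> x} = {c, d}"
      using \<open>a < b\<close> \<open>c < d\<close> by (auto simp: Transposition.transpose_def)
    then have "{a, b} = {c, d}" using eq by simp
    then show "a = c \<and> b = d" using \<open>a < b\<close> \<open>c < d\<close> by (auto simp: doubleton_eq_iff)
  qed
  have 1: "(\<Sum>h\<in>transpositions n. g h) = (\<Sum>(a, b)\<in>?L. g (Transposition.transpose a b))"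
    unfolding img by (subst sum.reindex[OF inj]) (simp add: case_prod_unfold)
  have 2: "(\<Sum>(a, b)\<in>?L. g (Transposition.transpose a b)) = (\<Sum>(a, b)\<in>?G. g (Transposition.transpose a b))"
    by (rule sum.reindex_bij_witness[of _ "\<lambda>(a, b). (b, a)" "\<lambda>(a, b). (b, a)"])
      (auto simp: transpose_commute)
  have "(\<Sum>a\<in>{1..n}. \<Sum>b\<in>{1..n} - {a}. g (Transposition.transpose a b)) =
    (\<Sum>(a, b)\<in>(SIGMA a:{1..n}. {1..n} - {a}). g (Transposition.transpose a b))"
    by (rule sum.Sigma) auto
  also have "(SIGMA a:{1..n}. {1..n} - {a}) = ?L \<union> ?G" by auto
  also have "(\<Sum>(a, b)\<in>?L \<union> ?G. g (Transposition.transpose a b)) =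
    (\<Sum>(a, b)\<in>?L. g (Transposition.transpose a b)) + (\<Sum>(a, b)\<in>?G. g (Transposition.transpose a b))"
    using fin by (intro sum.union_disjoint) auto
  finally show ?thesis using 1 2 by simp
qed

lemma sum_ordered_pairs_split:
  fixes g :: "nat \<Rightarrow> nat \<Rightarrow> nat"
  assumes "finite X" "U \<subseteq> X" and sym: "\<And>a b. g a b = g b a"
  shows "(\<Sum>a\<in>X. \<Sum>b\<in>X - {a}. g a b) = (\<Sum>a\<in>X - U. \<Sum>b\<in>X - U - {a}. g a b) +
    2 * (\<Sum>a\<in>U. \<Sum>b\<in>X - U. g a b) + (\<Sum>a\<in>U. \<Sum>b\<in>U - {a}. g a b)"
proof -
  have fU: "finite U" using assms finite_subset by blast
  have "(\<Sum>a\<in>X. \<Sum>b\<in>X - {a}. g a b) = (\<Sum>a\<in>X - U. \<Sum>b\<in>X - {a}. g a b) + (\<Sum>a\<in>U. \<Sum>b\<in>X - {a}. g a b)"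
    using assms by (simp add: sum.subset_diff)
  also have "(\<Sum>a\<in>X - U. \<Sum>b\<in>X - {a}. g a b) = (\<Sum>a\<in>X - U. (\<Sum>b\<in>X - U - {a}. g a b) + (\<Sum>b\<in>U. g a b))"
  proof (rule sum.cong[OF refl])
    fix a assume "a \<in> X - U"
    then have "X - {a} = (X - U - {a}) \<union> U" "(X - U - {a}) \<inter> U = {}" using assms(2) by auto
    then show "(\<Sum>b\<in>X - {a}. g a b) = (\<Sum>b\<in>X - U - {a}. g a b) + (\<Sum>b\<in>U. g a b)"
      using assms(1) fU by (metis finite_Diff sum.union_disjoint)
  qed
  also have "(\<Sum>a\<in>U. \<Sum>b\<in>X - {a}. g a b) = (\<Sum>a\<in>U. (\<Sum>b\<in>X - U. g a b) + (\<Sum>b\<in>U - {a}. g a b))"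
  proof (rule sum.cong[OF refl])
    fix a assume "a \<in> U"
    then have "X - {a} = (X - U) \<union> (U - {a})" "(X - U) \<inter> (U - {a}) = {}" using assms(2) by auto
    then show "(\<Sum>b\<in>X - {a}. g a b) = (\<Sum>b\<in>X - U. g a b) + (\<Sum>b\<in>U - {a}. g a b)"
      using assms(1) fU by (metis finite_Diff sum.union_disjoint)
  qed
  finally have split: "(\<Sum>a\<in>X. \<Sum>b\<in>X - {a}. g a b) =
    (\<Sum>a\<in>X - U. (\<Sum>b\<in>X - U - {a}. g a b) + (\<Sum>b\<in>U. g a b)) +
    (\<Sum>a\<in>U. (\<Sum>b\<in>X - U. g a b) + (\<Sum>b\<in>U - {a}. g a b))" .
  have "(\<Sum>a\<in>X - U. \<Sum>b\<in>U. g a b) = (\<Sum>b\<in>U. \<Sum>a\<in>X - U. g a b)"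
    by (rule sum.swap)
  also have "\<dots> = (\<Sum>a\<in>U. \<Sum>b\<in>X - U. g a b)"
    by (intro sum.cong refl sym)
  finally show ?thesis using split by (simp only: sum.distrib)
qed

lemma sum_points:
  assumes "finite I" "w \<in> placements n I \<mu>"
  shows "(\<Sum>a\<in>points I w. f a) = (\<Sum>t\<in>I. \<Sum>u<\<mu> t. f (w t ! u))"
proof -
  have "(\<Sum>a\<in>points I w. f a) = (\<Sum>t\<in>I. sum f (set (w t)))"
    unfolding points_def using assms(1) placementsD(5)[OF assms(2)]
    by (intro sum.UNION_disjoint) auto
  also have "\<dots> = (\<Sum>t\<in>I. \<Sum>u<\<mu> t. f (w t ! u))"
  proof (rule sum.cong[OF refl])
    fix t assume "t \<in> I"
    note t = placementsD(1,2)[OF assms(2) this]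
    have "bij_betw ((!) (w t)) {..<\<mu> t} (set (w t))"
      using t by (intro bij_betw_nth) auto
    from sum.reindex_bij_betw[OF this, of f] show "sum f (set (w t)) = (\<Sum>u<\<mu> t. f (w t ! u))" by simp
  qed
  finally show ?thesis .
qed

lemma placements_nth_eq_iff:
  assumes "w \<in> placements n I \<mu>" "t \<in> I" "t' \<in> I" "u < \<mu> t" "u' < \<mu> t'"
  shows "w t ! u = w t' ! u' \<longleftrightarrow> t = t' \<and> u = u'"
proof (cases "t = t'")
  case True
  then show ?thesis using placementsD(1,2)[OF assms(1,2)] assms by (simp add: nth_eq_iff_index_eq)
next
  case False
  have "w t ! u \<in> set (w t)" "w t' ! u' \<in> set (w t')"
    using placementsD(1)[OF assms(1)] assms by auto
  then show ?thesis using placementsD(5)[OF assms(1-3) False] False by auto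
qed

lemma sum_points_pairs:
  fixes g :: "nat \<Rightarrow> nat \<Rightarrow> nat"
  assumes "finite I" and w: "w \<in> placements n I \<mu>"
  shows "(\<Sum>a\<in>points I w. \<Sum>b\<in>points I w - {a}. g a b) =
    (\<Sum>t\<in>I. \<Sum>u<\<mu> t. \<Sum>t'\<in>I. \<Sum>u'<\<mu> t'. if t = t' \<and> u = u' then 0 else g (w t ! u) (w t' ! u'))"
proof -
  have fin: "finite (points I w)" using assms(1) by (simp add: points_def)
  have "(\<Sum>a\<in>points I w. \<Sum>b\<in>points I w - {a}. g a b) =
    (\<Sum>a\<in>points I w. \<Sum>b\<in>points I w. if a = b then 0 else g a b)"
    using fin by (intro sum.cong refl sum.mono_neutral_cong_left) auto
  also have "\<dots> = (\<Sum>t\<in>I. \<Sum>u<\<mu> t. \<Sum>t'\<in>I. \<Sum>u'<\<mu> t'. if w t ! u = w t' ! u' then 0 else g (w t ! u) (w t' ! u'))"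
    by (simp add: sum_points[OF assms])
  also have "\<dots> = (\<Sum>t\<in>I. \<Sum>u<\<mu> t. \<Sum>t'\<in>I. \<Sum>u'<\<mu> t'. if t = t' \<and> u = u' then 0 else g (w t ! u) (w t' ! u'))"
    using placements_nth_eq_iff[OF w] by (intro sum.cong refl if_cong) auto
  finally show ?thesis .
qed

lemma cycle_families_transposition:
  assumes "h \<in> transpositions n"
  shows "cycle_families n (h \<circ> \<sigma>) I \<mu> = {w \<in> placements n I \<mu>. follows h \<sigma> I w}"
proof -
  obtain a b where h: "h = Transposition.transpose a b" using assms by (auto simp: transpositions_def)
  have hh: "map h (map h xs) = xs" for xs by (simp add: h)
  have "map (h \<circ> \<sigma>) xs = rotate1 xs \<longleftrightarrow> map \<sigma> xs = map h (rotate1 xs)" for xs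
  proof -
    have "map (h \<circ> \<sigma>) xs = map h (map \<sigma> xs)" by simp
    then show ?thesis using hh by metis
  qed
  then show ?thesis by (simp only: cycle_families_def follows_def)
qed

text \<open>An exact count over ordered pairs of transposed points, sorted by how many of them lie
  in the family. With none the words must be cycles of \<sigma>; with one they are departures,
  doubled for the order of the pair; with two the pair is given by two different positions.\<close>

lemma sum_cycle_families_transpositions:
  assumes I: "finite I"
  shows "2 * (\<Sum>h\<in>transpositions n. card (cycle_families n (h \<circ> \<sigma>) I \<mu>)) =
    (n - sum \<mu> I) * (n - sum \<mu> I - 1) * card (cycle_families n \<sigma> I \<mu>) +
    2 * (\<Sum>t\<in>I. \<Sum>u<\<mu> t. card (departures n \<sigma> I \<mu> t u)) +
    (\<Sum>t\<in>I. \<Sum>u<\<mu> t. \<Sum>t'\<in>I. \<Sum>u'<\<mu> t'. if t = t' \<and> u = u' then 0 else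
       card {w \<in> placements n I \<mu>. follows (Transposition.transpose (w t ! u) (w t' ! u')) \<sigma> I w})"
proof -
  let ?Pl = "placements n I \<mu>" and ?d = "sum \<mu> I"
  have fin: "finite ?Pl" by (rule finite_placements[OF I])
  have card_eq: "card {w \<in> ?Pl. Q w} = (\<Sum>w\<in>?Pl. of_bool (Q w))" for Q
    unfolding card_eq_sum sum.inter_filter[OF fin] of_bool_def by (rule refl)
  define g where "g = (\<lambda>w a b. of_bool (follows (Transposition.transpose a b) \<sigma> I w) :: nat)"
  have "2 * (\<Sum>h\<in>transpositions n. card (cycle_families n (h \<circ> \<sigma>) I \<mu>)) =
    2 * (\<Sum>h\<in>transpositions n. \<Sum>w\<in>?Pl. of_bool (follows h \<sigma> I w))"
    by (intro arg_cong[of _ _ "\<lambda>x. 2 * x"] sum.cong refl) (simp only: cycle_families_transposition card_eq)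
  also have "\<dots> = (\<Sum>w\<in>?Pl. 2 * (\<Sum>h\<in>transpositions n. of_bool (follows h \<sigma> I w)))"
    by (subst sum.swap) (simp only: sum_distrib_left)
  also have "\<dots> = (\<Sum>w\<in>?Pl. \<Sum>a\<in>{1..n}. \<Sum>b\<in>{1..n} - {a}. g w a b)"
    by (simp only: sum_transpositions g_def)
  also have "\<dots> = (\<Sum>w\<in>?Pl. (n - ?d) * (n - ?d - 1) * of_bool (follows id \<sigma> I w) +
     2 * (\<Sum>t\<in>I. \<Sum>u<\<mu> t. \<Sum>b\<in>{1..n} - points I w. g w (w t ! u) b) +
     (\<Sum>t\<in>I. \<Sum>u<\<mu> t. \<Sum>t'\<in>I. \<Sum>u'<\<mu> t'. if t = t' \<and> u = u' then 0 else g w (w t ! u) (w t' ! u')))"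
  proof (rule sum.cong[OF refl])
    fix w assume w: "w \<in> ?Pl"
    let ?U = "points I w"
    have U: "?U \<subseteq> {1..n}" using placementsD(3)[OF w] by (auto simp: points_def)
    have cU: "card ({1..n} - ?U) = n - ?d"
      using U card_points[OF I w] by (simp add: card_Diff_subset finite_subset)
    have "(\<Sum>a\<in>{1..n}. \<Sum>b\<in>{1..n} - {a}. g w a b) = (\<Sum>a\<in>{1..n} - ?U. \<Sum>b\<in>{1..n} - ?U - {a}. g w a b) +
      2 * (\<Sum>a\<in>?U. \<Sum>b\<in>{1..n} - ?U. g w a b) + (\<Sum>a\<in>?U. \<Sum>b\<in>?U - {a}. g w a b)"
      by (rule sum_ordered_pairs_split[OF _ U]) (simp_all add: g_def transpose_commute)
    also have "(\<Sum>a\<in>{1..n} - ?U. \<Sum>b\<in>{1..n} - ?U - {a}. g w a b) =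
      (\<Sum>a\<in>{1..n} - ?U. \<Sum>b\<in>{1..n} - ?U - {a}. of_bool (follows id \<sigma> I w))"
    proof (intro sum.cong refl)
      fix a b assume "a \<in> {1..n} - ?U" "b \<in> {1..n} - ?U - {a}"
      then have "map (Transposition.transpose a b) (rotate1 (w t)) = rotate1 (w t)" if "t \<in> I" for t
        using that by (intro map_transpose_other) (auto simp: points_def)
      then show "g w a b = of_bool (follows id \<sigma> I w)" by (simp add: g_def follows_def)
    qed
    also have "\<dots> = (\<Sum>a\<in>{1..n} - ?U. (n - ?d - 1) * of_bool (follows id \<sigma> I w))"
      using cU by (intro sum.cong refl) (simp add: card_Diff_singleton del: of_bool_eq)
    also have "\<dots> = (n - ?d) * (n - ?d - 1) * of_bool (follows id \<sigma> I w)"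
      using cU by simp
    finally show "(\<Sum>a\<in>{1..n}. \<Sum>b\<in>{1..n} - {a}. g w a b) = (n - ?d) * (n - ?d - 1) * of_bool (follows id \<sigma> I w) +
     2 * (\<Sum>t\<in>I. \<Sum>u<\<mu> t. \<Sum>b\<in>{1..n} - points I w. g w (w t ! u) b) +
     (\<Sum>t\<in>I. \<Sum>u<\<mu> t. \<Sum>t'\<in>I. \<Sum>u'<\<mu> t'. if t = t' \<and> u = u' then 0 else g w (w t ! u) (w t' ! u'))"
      unfolding sum_points_pairs[OF I w] unfolding sum_points[OF I w] .
  qed
  also have "\<dots> = (n - ?d) * (n - ?d - 1) * (\<Sum>w\<in>?Pl. of_bool (follows id \<sigma> I w)) +
     2 * (\<Sum>w\<in>?Pl. \<Sum>t\<in>I. \<Sum>u<\<mu> t. \<Sum>b\<in>{1..n} - points I w. g w (w t ! u) b) +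
     (\<Sum>w\<in>?Pl. \<Sum>t\<in>I. \<Sum>u<\<mu> t. \<Sum>t'\<in>I. \<Sum>u'<\<mu> t'. if t = t' \<and> u = u' then 0 else g w (w t ! u) (w t' ! u'))"
    by (simp only: sum.distrib sum_distrib_left)
  also have "(\<Sum>w\<in>?Pl. of_bool (follows id \<sigma> I w)) = card (cycle_families n \<sigma> I \<mu>)"
    unfolding cycle_families_def card_eq by (simp add: follows_def)
  also have "(\<Sum>w\<in>?Pl. \<Sum>t\<in>I. \<Sum>u<\<mu> t. \<Sum>b\<in>{1..n} - points I w. g w (w t ! u) b) =
    (\<Sum>t\<in>I. \<Sum>u<\<mu> t. \<Sum>w\<in>?Pl. \<Sum>b\<in>{1..n} - points I w. g w (w t ! u) b)"
    by (subst sum.swap, rule sum.cong[OF refl], rule sum.swap)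
  also have "\<dots> = (\<Sum>t\<in>I. \<Sum>u<\<mu> t. card (departures n \<sigma> I \<mu> t u))"
  proof (intro sum.cong refl)
    fix t u
    have "departures n \<sigma> I \<mu> t u = (SIGMA w:?Pl. {b \<in> {1..n} - points I w. follows (Transposition.transpose (w t ! u) b) \<sigma> I w})"
      by (auto simp: departures_def)
    then have "card (departures n \<sigma> I \<mu> t u) =
      (\<Sum>w\<in>?Pl. card {b \<in> {1..n} - points I w. follows (Transposition.transpose (w t ! u) b) \<sigma> I w})"
      using fin by simp
    also have "\<dots> = (\<Sum>w\<in>?Pl. \<Sum>b\<in>{1..n} - points I w. g w (w t ! u) b)"
      by (intro sum.cong refl) (simp only: g_def card_eq_sum sum.inter_filter[OF finite_Diff[OF finite_atLeastAtMost]] of_bool_def)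
    finally show "(\<Sum>w\<in>?Pl. \<Sum>b\<in>{1..n} - points I w. g w (w t ! u) b) = card (departures n \<sigma> I \<mu> t u)" ..
  qed
  also have "(\<Sum>w\<in>?Pl. \<Sum>t\<in>I. \<Sum>u<\<mu> t. \<Sum>t'\<in>I. \<Sum>u'<\<mu> t'. if t = t' \<and> u = u' then 0 else g w (w t ! u) (w t' ! u')) =
    (\<Sum>t\<in>I. \<Sum>w\<in>?Pl. \<Sum>u<\<mu> t. \<Sum>t'\<in>I. \<Sum>u'<\<mu> t'. if t = t' \<and> u = u' then 0 else g w (w t ! u) (w t' ! u'))"
    by (rule sum.swap)
  also have "\<dots> = (\<Sum>t\<in>I. \<Sum>u<\<mu> t. \<Sum>w\<in>?Pl. \<Sum>t'\<in>I. \<Sum>u'<\<mu> t'. if t = t' \<and> u = u' then 0 else g w (w t ! u) (w t' ! u'))"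
    by (intro sum.cong refl sum.swap)
  also have "\<dots> = (\<Sum>t\<in>I. \<Sum>u<\<mu> t. \<Sum>t'\<in>I. \<Sum>w\<in>?Pl. \<Sum>u'<\<mu> t'. if t = t' \<and> u = u' then 0 else g w (w t ! u) (w t' ! u'))"
    by (intro sum.cong refl sum.swap)
  also have "\<dots> = (\<Sum>t\<in>I. \<Sum>u<\<mu> t. \<Sum>t'\<in>I. \<Sum>u'<\<mu> t'. \<Sum>w\<in>?Pl. if t = t' \<and> u = u' then 0 else g w (w t ! u) (w t' ! u'))"
    by (intro sum.cong refl sum.swap)
  also have "\<dots> = (\<Sum>t\<in>I. \<Sum>u<\<mu> t. \<Sum>t'\<in>I. \<Sum>u'<\<mu> t'. if t = t' \<and> u = u' then 0 else
       card {w \<in> placements n I \<mu>. follows (Transposition.transpose (w t ! u) (w t' ! u')) \<sigma> I w})"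
  proof (intro sum.cong refl)
    fix t u t' u'
    show "(\<Sum>w\<in>?Pl. if t = t' \<and> u = u' then 0 else g w (w t ! u) (w t' ! u')) =
      (if t = t' \<and> u = u' then 0 else
       card {w \<in> placements n I \<mu>. follows (Transposition.transpose (w t ! u) (w t' ! u')) \<sigma> I w})"
      unfolding card_eq g_def by (cases "t = t' \<and> u = u'") (simp_all only: if_True if_False sum.neutral_const simp_thms)
  qed
  finally show ?thesis .
qed

section \<open>Factorial moments of the number of cycles\<close>

lemma rotate1_eq: "xs \<noteq> [] \<Longrightarrow> rotate1 xs = tl xs @ [hd xs]"
  by (cases xs) auto

lemma cycle_word_trail:
  assumes "xs \<noteq> []" "map \<sigma> xs = rotate1 xs"
  shows "xs = trail \<sigma> (length xs) (hd xs)" "(\<sigma> ^^ length xs) (hd xs) = hd xs"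
proof -
  have *: "map \<sigma> xs = tl xs @ [hd xs]" using assms by (simp add: rotate1_eq)
  show "xs = trail \<sigma> (length xs) (hd xs)" by (rule trail_unique(1)[OF assms(1) *])
  show "(\<sigma> ^^ length xs) (hd xs) = hd xs" using trail_unique(2)[OF assms(1) *] by simp
qed

lemma trail_cycle_word:
  assumes "0 < j" "(\<sigma> ^^ j) x = x"
  shows "map \<sigma> (trail \<sigma> j x) = rotate1 (trail \<sigma> j x)"
proof -
  have ne: "trail \<sigma> j x \<noteq> []" using assms(1) by (simp add: trail_def)
  have "map \<sigma> (trail \<sigma> j x) = tl (trail \<sigma> j x) @ [x]"
    using map_trail[of \<sigma> j x] ne assms(2) by simp
  then show ?thesis by (simp only: rotate1_eq[OF ne] hd_trail[OF assms(1)])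
qed

lemma cycle_word_cyclic:
  assumes "xs \<noteq> []" "map \<sigma> xs = rotate1 xs"
  shows "cyclic_on \<sigma> (set xs)"
proof -
  let ?x = "hd xs"
  have im: "\<sigma> ` set xs = set xs" using arg_cong[OF assms(2), of set] by simp
  have "set xs = orbit \<sigma> ?x"
  proof
    show "set xs \<subseteq> orbit \<sigma> ?x"
    proof
      fix y assume "y \<in> set xs"
      then obtain m where m: "y = (\<sigma> ^^ m) ?x"
        using cycle_word_trail(1)[OF assms] set_trail[of \<sigma> "length xs" ?x] by auto
      have "?x = (\<sigma> ^^ length xs) ?x" using cycle_word_trail(2)[OF assms] by simp
      then show "y \<in> orbit \<sigma> ?x"
        unfolding orbit_altdef m using assms(1)
        by (cases "m = 0") (auto intro: exI[of _ "length xs"] exI[of _ m])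
    qed
    show "orbit \<sigma> ?x \<subseteq> set xs"
    proof
      fix y assume "y \<in> orbit \<sigma> ?x"
      then show "y \<in> set xs" by induction (use assms(1) im in auto)
    qed
  qed
  then show ?thesis using assms(1) unfolding cyclic_on_def by (metis hd_in_set)
qed

lemma cyclic_on_trail:
  assumes "cyclic_on \<sigma> C" "finite C" "x \<in> C"
  shows "distinct (trail \<sigma> (card C) x)" "set (trail \<sigma> (card C) x) = C" "(\<sigma> ^^ card C) x = x"
proof -
  have orb: "C = orbit \<sigma> x" using assms by (simp add: cyclic_on_alldef)
  then have x: "x \<in> orbit \<sigma> x" using assms by simp
  define k where "k = funpow_dist1 \<sigma> x x"
  have C: "C = (\<lambda>n. (\<sigma> ^^ n) x) ` {0..<k}"
    unfolding orb k_def by (rule orbit_conv_funpow_dist1[OF x])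
  have inj: "inj_on (\<lambda>n. (\<sigma> ^^ n) x) {0..<k}"
    unfolding k_def by (rule inj_on_funpow_dist1[OF x])
  have k: "card C = k" using card_image[OF inj] C by simp
  show "set (trail \<sigma> (card C) x) = C" unfolding k set_trail using C by (simp add: atLeast0LessThan)
  show "distinct (trail \<sigma> (card C) x)"
    unfolding k trail_def using inj by (simp add: distinct_map atLeast0LessThan)
  show "(\<sigma> ^^ card C) x = x" unfolding k k_def by (rule funpow_dist1_prop[OF x])
qed

lemma cyclic_on_disjoint:
  assumes "cyclic_on \<sigma> C" "cyclic_on \<sigma> D" "C \<noteq> D"
  shows "C \<inter> D = {}"
  using assms by (auto simp: cyclic_on_alldef)

lemma card_cycle_words_avoiding:
  assumes j: "0 < j" and fin: "finite I" and w: "w \<in> cycle_families n \<sigma> I (\<lambda>_. j)"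
  shows "card {xs. length xs = j \<and> distinct xs \<and> set xs \<subseteq> {1..n} \<and> map \<sigma> xs = rotate1 xs \<and>
      set xs \<inter> points I w = {}} = j * (num_cycles n j \<sigma> - card I)" (is "card ?W = _")
proof -
  define \<C> where "\<C> = {C. C \<subseteq> {1..n} \<and> cyclic_on \<sigma> C \<and> card C = j}"
  define \<D> where "\<D> = (\<lambda>s. set (w s)) ` I"
  have finC: "finite \<C>" unfolding \<C>_def by (rule finite_subset[of _ "Pow {1..n}"]) auto
  have wp: "w \<in> placements n I (\<lambda>_. j)" using w by (simp add: cycle_families_def)
  have ne: "w s \<noteq> []" if "s \<in> I" for s using placementsD(1)[OF wp that] j by auto
  have DC: "\<D> \<subseteq> \<C>"
  proof
    fix C assume "C \<in> \<D>"
    then obtain s where s: "s \<in> I" "C = set (w s)" by (auto simp: \<D>_def)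
    have "map \<sigma> (w s) = rotate1 (w s)" using w s by (simp add: cycle_families_def)
    then have "cyclic_on \<sigma> C" using cycle_word_cyclic[OF ne[OF s(1)]] s by simp
    then show "C \<in> \<C>" using placementsD(1-3)[OF wp s(1)] s by (auto simp: \<C>_def distinct_card)
  qed
  have cardD: "card \<D> = card I"
    unfolding \<D>_def
  proof (rule card_image, rule inj_onI)
    fix s t assume "s \<in> I" "t \<in> I" "set (w s) = set (w t)"
    then show "s = t" using placementsD(5)[OF wp, of s t] ne[of s] by (metis Int_absorb set_empty)
  qed
  have finmem: "finite C" if "C \<in> \<C>" for C using that by (auto simp: \<C>_def intro: finite_subset)
  have "bij_betw (trail \<sigma> j) (\<Union>(\<C> - \<D>)) ?W"
  proof (rule bij_betwI')
    fix x y assume "x \<in> \<Union>(\<C> - \<D>)" "y \<in> \<Union>(\<C> - \<D>)"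
    show "trail \<sigma> j x = trail \<sigma> j y \<longleftrightarrow> x = y" by (metis hd_trail[OF j])
  next
    fix x assume "x \<in> \<Union>(\<C> - \<D>)"
    then obtain C where C: "C \<in> \<C>" "C \<notin> \<D>" "x \<in> C" by auto
    then have C': "cyclic_on \<sigma> C" "C \<subseteq> {1..n}" "card C = j" by (auto simp: \<C>_def)
    note tr = cyclic_on_trail[OF C'(1) finmem[OF C(1)] C(3), unfolded C'(3)]
    have "C \<inter> set (w s) = {}" if "s \<in> I" for s
    proof (rule cyclic_on_disjoint[OF C'(1)])
      show "cyclic_on \<sigma> (set (w s))" "C \<noteq> set (w s)" using DC that C(2) by (auto simp: \<D>_def \<C>_def)
    qed
    then have "C \<inter> points I w = {}" by (auto simp: points_def)
    then show "trail \<sigma> j x \<in> ?W" using tr C'(2) trail_cycle_word[OF j tr(3)] by simp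
  next
    fix xs assume xs: "xs \<in> ?W"
    then have ne: "xs \<noteq> []" using j by auto
    have cyc: "map \<sigma> xs = rotate1 xs" using xs by simp
    have "set xs \<in> \<C>" using xs cycle_word_cyclic[OF ne cyc] by (auto simp: \<C>_def distinct_card)
    moreover have "set xs \<notin> \<D>"
    proof
      assume "set xs \<in> \<D>"
      then have "set xs \<subseteq> points I w" by (auto simp: \<D>_def points_def)
      moreover have "set xs \<inter> points I w = {}" using xs by simp
      ultimately have "set xs = {}" by (metis inf.absorb1)
      then show False using ne by simp
    qed
    ultimately have "hd xs \<in> \<Union>(\<C> - \<D>)" using hd_in_set[OF ne] by (metis DiffI UnionI)
    moreover have "xs = trail \<sigma> j (hd xs)" using cycle_word_trail(1)[OF ne cyc] xs by simp
    ultimately show "\<exists>x\<in>\<Union>(\<C> - \<D>). xs = trail \<sigma> j x" by (rule bexI[rotated])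
  qed
  then have "card ?W = card (\<Union>(\<C> - \<D>))" by (rule bij_betw_same_card[symmetric])
  also have "\<dots> = (\<Sum>C\<in>\<C> - \<D>. card C)"
  proof (rule card_Union_disjoint)
    show "pairwise disjnt (\<C> - \<D>)"
      using cyclic_on_disjoint[of \<sigma>] by (auto simp: pairwise_def disjnt_def \<C>_def)
  qed (use finmem in auto)
  also have "\<dots> = (\<Sum>C\<in>\<C> - \<D>. j)" by (intro sum.cong) (auto simp: \<C>_def)
  also have "\<dots> = j * (card \<C> - card I)"
    using card_Diff_subset[OF finite_subset[OF DC finC] DC] cardD by simp
  finally show ?thesis by (simp add: num_cycles_def \<C>_def)
qed

text \<open>The words are chosen one after another, and each uses up one cycle. When the cycles run
  out, truncated subtraction makes a factor zero, as required.\<close>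

lemma card_cycle_families_const:
  assumes j: "0 < j" and fin: "finite I"
  shows "card (cycle_families n \<sigma> I (\<lambda>_. j)) = (\<Prod>m<card I. j * (num_cycles n j \<sigma> - m))"
  using fin
proof (induction I rule: finite_induct)
  case empty
  have "cycle_families n \<sigma> {} (\<lambda>_. j) = {\<lambda>_. undefined}"
    by (auto simp: cycle_families_def placements_def disjoint_family_on_def)
  then show ?case by simp
next
  case (insert t I)
  let ?W = "\<lambda>w. {xs. length xs = j \<and> distinct xs \<and> set xs \<subseteq> {1..n} \<and> map \<sigma> xs = rotate1 xs \<and>
      set xs \<inter> points I w = {}}"
  let ?S = "SIGMA w:cycle_families n \<sigma> I (\<lambda>_. j). ?W w"
  have It: "insert t I - {t} = I" using insert.hyps by auto
  have "bij_betw (\<lambda>(w, xs). w(t := xs)) ?S (cycle_families n \<sigma> (insert t I) (\<lambda>_. j))"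
  proof (rule bij_betw_byWitness[where f' = "\<lambda>w. (w(t := undefined), w t)"])
    show "\<forall>a\<in>?S. (\<lambda>w. (w(t := undefined), w t)) ((\<lambda>(w, xs). w(t := xs)) a) = a"
    proof
      fix a assume "a \<in> ?S"
      then obtain w xs where a: "a = (w, xs)" and w: "w \<in> cycle_families n \<sigma> I (\<lambda>_. j)" by auto
      have "w t = undefined"
        using w insert.hyps placementsD(4)[of w n I "\<lambda>_. j" t] by (simp add: cycle_families_def)
      then show "(\<lambda>w. (w(t := undefined), w t)) ((\<lambda>(w, xs). w(t := xs)) a) = a"
        by (simp add: a fun_upd_idem)
    qed
    show "\<forall>w\<in>cycle_families n \<sigma> (insert t I) (\<lambda>_. j). (\<lambda>(w, xs). w(t := xs)) (w(t := undefined), w t) = w"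
      by simp
    show "(\<lambda>(w, xs). w(t := xs)) ` ?S \<subseteq> cycle_families n \<sigma> (insert t I) (\<lambda>_. j)"
    proof (rule image_subsetI)
      fix a assume "a \<in> ?S"
      then obtain w xs where a: "a = (w, xs)" and w: "w \<in> cycle_families n \<sigma> I (\<lambda>_. j)"
        and xs: "length xs = j" "distinct xs" "set xs \<subseteq> {1..n}" "map \<sigma> xs = rotate1 xs" "set xs \<inter> points I w = {}"
        by auto
      have "w(t := xs) \<in> placements n (insert t I) ((\<lambda>_. j)(t := j))"
        by (rule placements_insert) (use w xs It in \<open>auto simp: cycle_families_def\<close>)
      then have "w(t := xs) \<in> placements n (insert t I) (\<lambda>_. j)"
        by (simp add: fun_upd_def)
      then show "(\<lambda>(w, xs). w(t := xs)) a \<in> cycle_families n \<sigma> (insert t I) (\<lambda>_. j)"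
        using w xs by (simp add: cycle_families_def a)
    qed
    show "(\<lambda>w. (w(t := undefined), w t)) ` cycle_families n \<sigma> (insert t I) (\<lambda>_. j) \<subseteq> ?S"
    proof (rule image_subsetI)
      fix w assume w: "w \<in> cycle_families n \<sigma> (insert t I) (\<lambda>_. j)"
      then have wp: "w \<in> placements n (insert t I) (\<lambda>_. j)" by (simp add: cycle_families_def)
      have "w(t := undefined) \<in> cycle_families n \<sigma> I (\<lambda>_. j)"
        using placements_remove[OF wp, of t] w insert.hyps unfolding It by (auto simp: cycle_families_def)
      moreover have "set (w t) \<inter> points I (w(t := undefined)) = {}"
      proof -
        have "set (w t) \<inter> set (w s) = {}" if "s \<in> I" for s
          using placementsD(5)[OF wp, of t s] that insert.hyps by auto
        moreover have "(w(t := undefined)) s = w s" if "s \<in> I" for s using that insert.hyps by auto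
        ultimately show ?thesis unfolding points_def by (simp only: Int_UN_distrib UN_simps cong: SUP_cong) simp
      qed
      ultimately show "(w(t := undefined), w t) \<in> ?S"
        using placementsD(1-3)[OF wp, of t] w by (auto simp: cycle_families_def)
    qed
  qed
  then have "card (cycle_families n \<sigma> (insert t I) (\<lambda>_. j)) = card ?S"
    by (rule bij_betw_same_card[symmetric])
  also have "\<dots> = (\<Sum>w\<in>cycle_families n \<sigma> I (\<lambda>_. j). card (?W w))"
  proof (rule card_SigmaI)
    show "\<forall>w\<in>cycle_families n \<sigma> I (\<lambda>_. j). finite (?W w)"
      by (intro ballI finite_subset[OF _ finite_lists_length_eq[of "{1..n}" j]]) auto
  qed (rule finite_cycle_families[OF insert.hyps(1)])
  also have "\<dots> = (\<Sum>w\<in>cycle_families n \<sigma> I (\<lambda>_. j). j * (num_cycles n j \<sigma> - card I))"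
    by (intro sum.cong refl card_cycle_words_avoiding j insert.hyps)
  finally show ?case using insert by (simp add: mult.commute)
qed

lemma card_cycle_families_binomial:
  assumes "0 < j" "finite I"
  shows "real (card (cycle_families n \<sigma> I (\<lambda>_. j))) =
    real j ^ card I * fact (card I) * real (num_cycles n j \<sigma> choose card I)"
proof -
  have "(\<Prod>m<l. j * (N - m)) = j ^ l * (fact l * (N choose l))" for N l
  proof -
    have "(\<Prod>m<l. N - m) = fact l * (N choose l)"
    proof (cases "l \<le> N")
      case True
      have "(\<Prod>m<l. N - m) * fact (N - l) = fact N" using True
      proof (induction l)
        case (Suc l)
        then have "fact (N - l) = (N - l) * fact (N - Suc l)"
          by (metis Suc_diff_Suc Suc_le_lessD fact_Suc of_nat_id)
        then show ?case using Suc by (simp add: mult.assoc)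
      qed simp
      also have "\<dots> = fact l * (N choose l) * fact (N - l)"
        using binomial_fact_lemma[OF True] by (simp add: mult_ac)
      finally show ?thesis by simp
    next
      case False
      then have "(\<Prod>m<l. N - m) = 0" by (intro prod_zero) auto
      then show ?thesis using False by (simp add: binomial_eq_0)
    qed
    then show ?thesis by (simp add: prod.distrib)
  qed
  then show ?thesis
    using card_cycle_families_const[OF assms, of n \<sigma>] by (simp add: mult.assoc)
qed

section \<open>Evolution of the mean number of families\<close>

abbreviation cycle_count :: "nat \<Rightarrow> nat set \<Rightarrow> (nat \<Rightarrow> nat) \<Rightarrow> (nat \<Rightarrow> nat) \<Rightarrow> real" where
  "cycle_count n I \<mu> \<sigma> \<equiv> real (card (cycle_families n \<sigma> I \<mu>))"

lemma sum_off_diagonal: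
  fixes g :: "nat \<Rightarrow> nat \<Rightarrow> real"
  assumes sym: "\<And>a b. g a b = g b a"
  shows "(\<Sum>u<i. \<Sum>u'<i. if u = u' then 0 else g u u') = 2 * (\<Sum>v<i. \<Sum>u<v. g u v)"
proof (induction i)
  case (Suc i)
  have "(\<Sum>u<Suc i. \<Sum>u'<Suc i. if u = u' then 0 else g u u') =
    (\<Sum>u<i. (\<Sum>u'<i. if u = u' then 0 else g u u') + g u i) + (\<Sum>u'<i. g i u')"
    by simp
  also have "\<dots> = (\<Sum>u<i. \<Sum>u'<i. if u = u' then 0 else g u u') + 2 * (\<Sum>u<i. g u i)"
    by (simp add: sum.distrib sym[of i])
  finally show ?case using Suc by simp
qed simp

text \<open>The main terms take \<open>n\<close> departures for each remaining family and position,
  and all cuts; the errors are the exceptions to departures and the joins. The coefficient of a cut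
  is no larger in order than those of the errors, but a cut gains a word, worth up to a factor
  \<open>n\<close>, and so has to be kept.\<close>

lemma cycle_count_step:
  assumes I: "finite I" and f: "f \<notin> I" and \<sigma>: "\<sigma> permutes {1..n}" and n: "sum \<mu> I + 1 \<le> n"
  shows "\<bar>2 * (\<Sum>h\<in>transpositions n. cycle_count n I \<mu> (h \<circ> \<sigma>)) -
      ((real n - real (sum \<mu> I)) * (real n - real (sum \<mu> I) - 1) * cycle_count n I \<mu> \<sigma> +
       2 * (\<Sum>t\<in>I. real (\<mu> t) * (real n * cycle_count n (I - {t}) \<mu> \<sigma>)) +
       2 * (\<Sum>t\<in>I. \<Sum>v<\<mu> t. \<Sum>u<v. cycle_count n (insert f I) (\<mu>(t := \<mu> t - (v - u), f := v - u)) \<sigma>))\<bar>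
    \<le> 2 * (\<Sum>t\<in>I. real (\<mu> t) * (real (sum \<mu> I) * cycle_count n (I - {t}) \<mu> \<sigma> +
            (\<Sum>r=1..\<mu> t. cycle_count n I (\<mu>(t := r)) \<sigma>))) +
      (\<Sum>t\<in>I. \<Sum>t'\<in>I - {t}. real (\<mu> t) * (real (\<mu> t') * cycle_count n (I - {t'}) (\<mu>(t := \<mu> t + \<mu> t')) \<sigma>))"
proof -
  let ?d = "sum \<mu> I" and ?c = "\<lambda>I \<mu>. cycle_count n I \<mu> \<sigma>"
  define P where "P t u t' u' = real (card {w \<in> placements n I \<mu>. follows (Transposition.transpose (w t ! u) (w t' ! u')) \<sigma> I w})"
    for t u t' u'
  define D where "D t u = real (card (departures n \<sigma> I \<mu> t u))" for t u
  define J where "J = (\<Sum>t\<in>I. \<Sum>t'\<in>I - {t}. \<Sum>u<\<mu> t. \<Sum>u'<\<mu> t'. P t u t' u')"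
  define R where "R = (\<Sum>t\<in>I. \<Sum>u<\<mu> t. D t u)"
  define C where "C = (\<Sum>t\<in>I. \<Sum>v<\<mu> t. \<Sum>u<v. cycle_count n (insert f I) (\<mu>(t := \<mu> t - (v - u), f := v - u)) \<sigma>)"
  have "2 * (\<Sum>h\<in>transpositions n. cycle_count n I \<mu> (h \<circ> \<sigma>)) =
    real (2 * (\<Sum>h\<in>transpositions n. card (cycle_families n (h \<circ> \<sigma>) I \<mu>)))" by simp
  also have "\<dots> = real ((n - ?d) * (n - ?d - 1)) * ?c I \<mu> + 2 * R +
    (\<Sum>t\<in>I. \<Sum>u<\<mu> t. \<Sum>t'\<in>I. \<Sum>u'<\<mu> t'. if t = t' \<and> u = u' then 0 else P t u t' u')"
    unfolding sum_cycle_families_transpositions[OF I] R_def D_def P_def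
    by (simp only: of_nat_add of_nat_mult of_nat_sum of_nat_numeral of_nat_0 if_distrib[of real])
  also have "(\<Sum>t\<in>I. \<Sum>u<\<mu> t. \<Sum>t'\<in>I. \<Sum>u'<\<mu> t'. if t = t' \<and> u = u' then 0 else P t u t' u') = 2 * C + J"
  proof -
    have "(\<Sum>t\<in>I. \<Sum>u<\<mu> t. \<Sum>t'\<in>I. \<Sum>u'<\<mu> t'. if t = t' \<and> u = u' then 0 else P t u t' u') =
      (\<Sum>t\<in>I. \<Sum>t'\<in>I. \<Sum>u<\<mu> t. \<Sum>u'<\<mu> t'. if t = t' \<and> u = u' then 0 else P t u t' u')"
      by (intro sum.cong refl sum.swap)
    also have "\<dots> = (\<Sum>t\<in>I. 2 * (\<Sum>v<\<mu> t. \<Sum>u<v. cycle_count n (insert f I) (\<mu>(t := \<mu> t - (v - u), f := v - u)) \<sigma>) +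
      (\<Sum>t'\<in>I - {t}. \<Sum>u<\<mu> t. \<Sum>u'<\<mu> t'. P t u t' u'))"
    proof (rule sum.cong[OF refl])
      fix t assume t: "t \<in> I"
      have sym: "P t u t u' = P t u' t u" for u u'
        unfolding P_def by (simp add: transpose_commute)
      have "(\<Sum>u<\<mu> t. \<Sum>u'<\<mu> t. if t = t \<and> u = u' then 0 else P t u t u') = 2 * (\<Sum>v<\<mu> t. \<Sum>u<v. P t u t v)"
        using sum_off_diagonal[of "\<lambda>u u'. P t u t u'", OF sym] by simp
      also have "(\<Sum>v<\<mu> t. \<Sum>u<v. P t u t v) =
        (\<Sum>v<\<mu> t. \<Sum>u<v. cycle_count n (insert f I) (\<mu>(t := \<mu> t - (v - u), f := v - u)) \<sigma>)"
        unfolding P_def by (intro sum.cong refl arg_cong[of _ _ real] card_cut[OF t f]) auto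
      finally have 1: "(\<Sum>u<\<mu> t. \<Sum>u'<\<mu> t. if t = t \<and> u = u' then 0 else P t u t u') =
        2 * (\<Sum>v<\<mu> t. \<Sum>u<v. cycle_count n (insert f I) (\<mu>(t := \<mu> t - (v - u), f := v - u)) \<sigma>)" .
      have 2: "(\<Sum>t'\<in>I - {t}. \<Sum>u<\<mu> t. \<Sum>u'<\<mu> t'. if t = t' \<and> u = u' then 0 else P t u t' u') =
        (\<Sum>t'\<in>I - {t}. \<Sum>u<\<mu> t. \<Sum>u'<\<mu> t'. P t u t' u')"
        by (intro sum.cong refl) auto
      show "(\<Sum>t'\<in>I. \<Sum>u<\<mu> t. \<Sum>u'<\<mu> t'. if t = t' \<and> u = u' then 0 else P t u t' u') =
        2 * (\<Sum>v<\<mu> t. \<Sum>u<v. cycle_count n (insert f I) (\<mu>(t := \<mu> t - (v - u), f := v - u)) \<sigma>) +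
        (\<Sum>t'\<in>I - {t}. \<Sum>u<\<mu> t. \<Sum>u'<\<mu> t'. P t u t' u')"
        by (subst sum.remove[OF I t]) (simp only: 1 2)
    qed
    finally show ?thesis by (simp only: sum.distrib sum_distrib_left C_def J_def)
  qed
  \<comment> \<open>\<open>n\<close> exceeds the number of points of the family, so neither
    subtraction truncates.\<close>
  also have "real ((n - ?d) * (n - ?d - 1)) = (real n - real ?d) * (real n - real ?d - 1)"
    using n by (simp add: of_nat_diff)
  finally have main: "2 * (\<Sum>h\<in>transpositions n. cycle_count n I \<mu> (h \<circ> \<sigma>)) =
    (real n - real ?d) * (real n - real ?d - 1) * ?c I \<mu> + 2 * R + (2 * C + J)" .
  have J_nonneg: "0 \<le> J" unfolding J_def P_def by (intro sum_nonneg) auto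
  have J_le: "J \<le> (\<Sum>t\<in>I. \<Sum>t'\<in>I - {t}. real (\<mu> t) * (real (\<mu> t') * ?c (I - {t'}) (\<mu>(t := \<mu> t + \<mu> t'))))"
    unfolding J_def
  proof (intro sum_mono)
    fix t t' assume t: "t \<in> I" "t' \<in> I - {t}"
    have "(\<Sum>u<\<mu> t. \<Sum>u'<\<mu> t'. P t u t' u') \<le> (\<Sum>u<\<mu> t. \<Sum>u'<\<mu> t'. ?c (I - {t'}) (\<mu>(t := \<mu> t + \<mu> t')))"
      unfolding P_def using t by (intro sum_mono of_nat_mono card_join[OF I]) auto
    then show "(\<Sum>u<\<mu> t. \<Sum>u'<\<mu> t'. P t u t' u') \<le> real (\<mu> t) * (real (\<mu> t') * ?c (I - {t'}) (\<mu>(t := \<mu> t + \<mu> t')))"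
      by simp
  qed
  have R_le: "R \<le> (\<Sum>t\<in>I. real (\<mu> t) * (real n * ?c (I - {t}) \<mu>))"
    unfolding R_def
  proof (rule sum_mono)
    fix t assume t: "t \<in> I"
    have "(\<Sum>u<\<mu> t. D t u) \<le> (\<Sum>u<\<mu> t. real n * ?c (I - {t}) \<mu>)"
      unfolding D_def of_nat_mult[symmetric]
      by (intro sum_mono of_nat_mono card_departures_le[where \<mu> = \<mu>, OF I t]) auto
    then show "(\<Sum>u<\<mu> t. D t u) \<le> real (\<mu> t) * (real n * ?c (I - {t}) \<mu>)" by simp
  qed
  have R_ge: "(\<Sum>t\<in>I. real (\<mu> t) * (real n * ?c (I - {t}) \<mu>)) \<le> R + (\<Sum>t\<in>I. real (\<mu> t) * (real ?d * ?c (I - {t}) \<mu> +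
            (\<Sum>r=1..\<mu> t. ?c I (\<mu>(t := r)))))"
    unfolding R_def sum.distrib[symmetric]
  proof (rule sum_mono)
    fix t assume t: "t \<in> I"
    have le: "real n * ?c (I - {t}) \<mu> \<le> D t u + (real ?d * ?c (I - {t}) \<mu> + (\<Sum>r=1..\<mu> t. ?c I (\<mu>(t := r))))"
      if "u < \<mu> t" for u
    proof -
      have "real n * ?c (I - {t}) \<mu> \<le> D t u + real (sum \<mu> (I - {t})) * ?c (I - {t}) \<mu> + (\<Sum>r=1..\<mu> t. ?c I (\<mu>(t := r)))"
        unfolding D_def using of_nat_mono[OF card_departures_ge[where \<mu> = \<mu>, OF I t that \<sigma>], where 'a = real]
        by (simp only: of_nat_add of_nat_mult of_nat_sum)
      moreover have "real (sum \<mu> (I - {t})) * ?c (I - {t}) \<mu> \<le> real ?d * ?c (I - {t}) \<mu>"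
        using I by (intro mult_right_mono of_nat_mono sum_mono2) auto
      ultimately show ?thesis by linarith
    qed
    have "real (\<mu> t) * (real n * ?c (I - {t}) \<mu>) = (\<Sum>u<\<mu> t. real n * ?c (I - {t}) \<mu>)" by simp
    also have "\<dots> \<le> (\<Sum>u<\<mu> t. D t u + (real ?d * ?c (I - {t}) \<mu> + (\<Sum>r=1..\<mu> t. ?c I (\<mu>(t := r)))))"
      using le by (intro sum_mono) auto
    also have "\<dots> = (\<Sum>u<\<mu> t. D t u) + real (\<mu> t) * (real ?d * ?c (I - {t}) \<mu> + (\<Sum>r=1..\<mu> t. ?c I (\<mu>(t := r))))"
      by (simp only: sum.distrib sum_constant card_lessThan) (simp add: algebra_simps)
    finally show "real (\<mu> t) * (real n * ?c (I - {t}) \<mu>) \<le> (\<Sum>u<\<mu> t. D t u) +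
      real (\<mu> t) * (real ?d * ?c (I - {t}) \<mu> + (\<Sum>r=1..\<mu> t. ?c I (\<mu>(t := r))))" .
  qed
  have abs: "\<bar>(x + 2 * r + (2 * z + y)) - (x + 2 * s + 2 * z)\<bar> \<le> 2 * e + f"
    if "r \<le> s" "s \<le> r + e" "0 \<le> y" "y \<le> f" for x r z y s e f :: real
    using that by (simp add: abs_le_iff)
  show ?thesis
    unfolding main C_def[symmetric] by (rule abs[OF R_le R_ge J_nonneg J_le])
qed

section \<open>Passage to the mean over the walk\<close>

definition mean_count :: "nat \<Rightarrow> nat \<Rightarrow> nat set \<Rightarrow> (nat \<Rightarrow> nat) \<Rightarrow> real" where
  "mean_count n k I \<mu> = measure_pmf.expectation (transposition_walk n k) (cycle_count n I \<mu>)"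

lemma finite_transpositions: "finite (transpositions n)"
proof -
  have "transpositions n \<subseteq> (\<lambda>(a, b). Transposition.transpose a b) ` ({1..n} \<times> {1..n})"
    by (force simp: transpositions_def)
  then show ?thesis by (rule finite_subset) simp
qed

lemma transpositions_permutes: "h \<in> transpositions n \<Longrightarrow> h permutes {1..n}"
  by (auto simp: transpositions_def intro!: permutes_swap_id)

lemma set_transposition_pmf:
  assumes "n \<ge> 2"
  shows "set_pmf (transposition_pmf n) = transpositions n"
proof -
  have "card (transpositions n) > 0" using assms by (simp add: card_transpositions)
  then have "transpositions n \<noteq> {}" by (metis card.empty less_irrefl)
  then show ?thesis by (simp add: transposition_pmf_def finite_transpositions)
qed

lemma set_transposition_walk:
  assumes "n \<ge> 2"
  shows "set_pmf (transposition_walk n k) \<subseteq> {\<sigma>. \<sigma> permutes {1..n}}"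
proof (induction k)
  case 0
  then show ?case by (simp add: permutes_id)
next
  case (Suc k)
  then show ?case
    using transpositions_permutes
    by (auto simp: convolution_pmf_def set_transposition_pmf[OF assms] intro!: permutes_compose)
qed

lemma finite_transposition_walk:
  assumes "n \<ge> 2"
  shows "finite (set_pmf (transposition_walk n k))"
  by (rule finite_subset[OF set_transposition_walk[OF assms] finite_permutations]) simp

text \<open>Conditioned on the present state \<sigma>, the next one is
  \<open>h \<circ> \<sigma>\<close> with \<open>h\<close> uniform among
  \<open>n * (n - 1) / 2\<close> transpositions; the denominator has been cleared.\<close>

lemma expectation_walk_Suc:
  fixes g :: "(nat \<Rightarrow> nat) \<Rightarrow> real"
  assumes n: "n \<ge> 2"
  shows "real n * (real n - 1) * measure_pmf.expectation (transposition_walk n (Suc k)) g =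
    measure_pmf.expectation (transposition_walk n k) (\<lambda>\<sigma>. 2 * (\<Sum>h\<in>transpositions n. g (h \<circ> \<sigma>)))"
proof -
  let ?W = "transposition_walk n k" and ?N = "real (n choose 2)"
  have int: "integrable (measure_pmf ?W) f" for f :: "(nat \<Rightarrow> nat) \<Rightarrow> real"
    by (rule integrable_measure_pmf_finite[OF finite_transposition_walk[OF n]])
  have bind: "transposition_walk n (Suc k) = transposition_pmf n \<bind> (\<lambda>h. map_pmf (\<lambda>\<sigma>. h \<circ> \<sigma>) ?W)"
    by (simp add: convolution_pmf_def pair_pmf_def map_bind_pmf bind_return_pmf map_pmf_def bind_assoc_pmf)
  have "measure_pmf.expectation (transposition_walk n (Suc k)) g =
    (\<Sum>h\<in>transpositions n. pmf (transposition_pmf n) h *\<^sub>R measure_pmf.expectation (map_pmf (\<lambda>\<sigma>. h \<circ> \<sigma>) ?W) g)"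
    unfolding bind
    by (rule pmf_expectation_bind)
      (use finite_transposition_walk[OF n] in \<open>auto simp: finite_transpositions set_transposition_pmf[OF n]\<close>)
  also have "\<dots> = (\<Sum>h\<in>transpositions n. (1 / ?N) * measure_pmf.expectation ?W (\<lambda>\<sigma>. g (h \<circ> \<sigma>)))"
    by (intro sum.cong refl) (simp add: pmf_transposition_pmf[OF n])
  also have "\<dots> = (1 / ?N) * measure_pmf.expectation ?W (\<lambda>\<sigma>. \<Sum>h\<in>transpositions n. g (h \<circ> \<sigma>))"
    using int by (simp add: sum_distrib_left Bochner_Integration.integral_sum)
  finally have mean: "?N * measure_pmf.expectation (transposition_walk n (Suc k)) g =
    measure_pmf.expectation ?W (\<lambda>\<sigma>. \<Sum>h\<in>transpositions n. g (h \<circ> \<sigma>))"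
    using n by simp
  have "real n * (real n - 1) = 2 * ?N"
  proof -
    have "even (n * (n - 1))" using n by (cases "even n") auto
    then have "2 * (n choose 2) = n * (n - 1)" unfolding choose_two by (rule dvd_mult_div_cancel)
    then have "real (2 * (n choose 2)) = real (n * (n - 1))" by simp
    then show ?thesis using n by (simp add: of_nat_diff)
  qed
  then show ?thesis using int by (simp only: mult.assoc mean integral_mult_right_zero)
qed

theorem mean_count_step:
  assumes I: "finite I" and f: "f \<notin> I" and n: "sum \<mu> I + 1 \<le> n" "2 \<le> n"
  shows "\<bar>real n * (real n - 1) * mean_count n (Suc k) I \<mu> -
      ((real n - real (sum \<mu> I)) * (real n - real (sum \<mu> I) - 1) * mean_count n k I \<mu> +
       2 * (\<Sum>t\<in>I. real (\<mu> t) * (real n * mean_count n k (I - {t}) \<mu>)) +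
       2 * (\<Sum>t\<in>I. \<Sum>v<\<mu> t. \<Sum>u<v. mean_count n k (insert f I) (\<mu>(t := \<mu> t - (v - u), f := v - u))))\<bar>
    \<le> 2 * (\<Sum>t\<in>I. real (\<mu> t) * (real (sum \<mu> I) * mean_count n k (I - {t}) \<mu> +
            (\<Sum>r=1..\<mu> t. mean_count n k I (\<mu>(t := r))))) +
      (\<Sum>t\<in>I. \<Sum>t'\<in>I - {t}. real (\<mu> t) * (real (\<mu> t') * mean_count n k (I - {t'}) (\<mu>(t := \<mu> t + \<mu> t'))))"
proof -
  let ?W = "measure_pmf (transposition_walk n k)"
  have int: "integrable ?W g" for g :: "(nat \<Rightarrow> nat) \<Rightarrow> real"
    by (rule integrable_measure_pmf_finite[OF finite_transposition_walk[OF n(2)]])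
  define X where "X \<sigma> = 2 * (\<Sum>h\<in>transpositions n. cycle_count n I \<mu> (h \<circ> \<sigma>)) -
      ((real n - real (sum \<mu> I)) * (real n - real (sum \<mu> I) - 1) * cycle_count n I \<mu> \<sigma> +
       2 * (\<Sum>t\<in>I. real (\<mu> t) * (real n * cycle_count n (I - {t}) \<mu> \<sigma>)) +
       2 * (\<Sum>t\<in>I. \<Sum>v<\<mu> t. \<Sum>u<v. cycle_count n (insert f I) (\<mu>(t := \<mu> t - (v - u), f := v - u)) \<sigma>))" for \<sigma>
  define Y where "Y \<sigma> = 2 * (\<Sum>t\<in>I. real (\<mu> t) * (real (sum \<mu> I) * cycle_count n (I - {t}) \<mu> \<sigma> +
            (\<Sum>r=1..\<mu> t. cycle_count n I (\<mu>(t := r)) \<sigma>))) +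
      (\<Sum>t\<in>I. \<Sum>t'\<in>I - {t}. real (\<mu> t) * (real (\<mu> t') * cycle_count n (I - {t'}) (\<mu>(t := \<mu> t + \<mu> t')) \<sigma>))" for \<sigma>
  have EX: "integral\<^sup>L ?W X = real n * (real n - 1) * mean_count n (Suc k) I \<mu> -
      ((real n - real (sum \<mu> I)) * (real n - real (sum \<mu> I) - 1) * mean_count n k I \<mu> +
       2 * (\<Sum>t\<in>I. real (\<mu> t) * (real n * mean_count n k (I - {t}) \<mu>)) +
       2 * (\<Sum>t\<in>I. \<Sum>v<\<mu> t. \<Sum>u<v. mean_count n k (insert f I) (\<mu>(t := \<mu> t - (v - u), f := v - u))))"
    unfolding X_def mean_count_def expectation_walk_Suc[OF n(2)]
    by (simp only: Bochner_Integration.integral_diff[OF int int] Bochner_Integration.integral_add[OF int int]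
      Bochner_Integration.integral_sum[OF int] integral_mult_right_zero)
  have EY: "integral\<^sup>L ?W Y = 2 * (\<Sum>t\<in>I. real (\<mu> t) * (real (sum \<mu> I) * mean_count n k (I - {t}) \<mu> +
            (\<Sum>r=1..\<mu> t. mean_count n k I (\<mu>(t := r))))) +
      (\<Sum>t\<in>I. \<Sum>t'\<in>I - {t}. real (\<mu> t) * (real (\<mu> t') * mean_count n k (I - {t'}) (\<mu>(t := \<mu> t + \<mu> t'))))"
    unfolding Y_def mean_count_def
    by (simp only: Bochner_Integration.integral_add[OF int int]
      Bochner_Integration.integral_sum[OF int] integral_mult_right_zero)
  have "AE \<sigma> in ?W. \<bar>X \<sigma>\<bar> \<le> Y \<sigma>"
  proof (rule AE_pmfI)
    fix \<sigma> assume "\<sigma> \<in> set_pmf (transposition_walk n k)"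
    then have "\<sigma> permutes {1..n}" using set_transposition_walk[OF n(2)] by blast
    from cycle_count_step[OF I f this n(1)] show "\<bar>X \<sigma>\<bar> \<le> Y \<sigma>" unfolding X_def Y_def .
  qed
  then have "integral\<^sup>L ?W (\<lambda>\<sigma>. \<bar>X \<sigma>\<bar>) \<le> integral\<^sup>L ?W Y"
    by (rule integral_mono_AE[OF int int])
  then have "\<bar>integral\<^sup>L ?W X\<bar> \<le> integral\<^sup>L ?W Y"
    using integral_abs_bound[of ?W X] by linarith
  then show ?thesis unfolding EX EY .
qed

lemma mean_count_nonneg: "0 \<le> mean_count n k I \<mu>"
  unfolding mean_count_def by (intro Bochner_Integration.integral_nonneg) simp

text \<open>A cycle word of known length is determined by its first letter, for which there are at
  most \<open>n\<close> choices.\<close>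

lemma card_cycle_families_remove_le:
  assumes I: "finite I" and t: "t \<in> I" and pos: "0 < \<mu> t"
  shows "card (cycle_families n \<sigma> I \<mu>) \<le> n * card (cycle_families n \<sigma> (I - {t}) \<mu>)"
proof -
  have "card (cycle_families n \<sigma> I \<mu>) \<le> card (cycle_families n \<sigma> (I - {t}) \<mu> \<times> {1..n})"
  proof (rule card_inj_on_le[where f = "\<lambda>w. (w(t := undefined), hd (w t))"])
    show "finite (cycle_families n \<sigma> (I - {t}) \<mu> \<times> {1..n})" using I by (simp add: finite_cycle_families)
    have ne: "w t \<noteq> []" if "w \<in> cycle_families n \<sigma> I \<mu>" for w
      using that pos placementsD(1)[of w n I \<mu> t] t by (auto simp: cycle_families_def)
    show "inj_on (\<lambda>w. (w(t := undefined), hd (w t))) (cycle_families n \<sigma> I \<mu>)"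
    proof (rule inj_onI)
      fix w x assume w: "w \<in> cycle_families n \<sigma> I \<mu>" and x: "x \<in> cycle_families n \<sigma> I \<mu>"
        and eq: "(w(t := undefined), hd (w t)) = (x(t := undefined), hd (x t))"
      have "w t = trail \<sigma> (\<mu> t) (hd (w t))" "x t = trail \<sigma> (\<mu> t) (hd (x t))"
        using cycle_word_trail(1)[OF ne[OF w], of \<sigma>] cycle_word_trail(1)[OF ne[OF x], of \<sigma>] w x t
          placementsD(1)[of w n I \<mu> t] placementsD(1)[of x n I \<mu> t]
        by (auto simp: cycle_families_def)
      then have "w t = x t" using eq by simp
      then show "w = x" using eq by (metis fun_upd_triv fun_upd_upd prod.inject)
    qed
    show "(\<lambda>w. (w(t := undefined), hd (w t))) ` cycle_families n \<sigma> I \<mu> \<subseteq> cycle_families n \<sigma> (I - {t}) \<mu> \<times> {1..n}"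
    proof (rule image_subsetI)
      fix w assume w: "w \<in> cycle_families n \<sigma> I \<mu>"
      then have wp: "w \<in> placements n I \<mu>" by (simp add: cycle_families_def)
      have "hd (w t) \<in> {1..n}" using placementsD(3)[OF wp t] hd_in_set[OF ne[OF w]] by blast
      moreover have "w(t := undefined) \<in> cycle_families n \<sigma> (I - {t}) \<mu>"
        using placements_remove[OF wp, of t] w by (simp add: cycle_families_def)
      ultimately show "(w(t := undefined), hd (w t)) \<in> cycle_families n \<sigma> (I - {t}) \<mu> \<times> {1..n}" by simp
    qed
  qed
  then show ?thesis by (simp add: card_cartesian_product mult.commute)
qed

lemma cycle_families_cong:
  assumes "\<And>t. t \<in> I \<Longrightarrow> \<mu> t = \<nu> t"
  shows "cycle_families n \<sigma> I \<mu> = cycle_families n \<sigma> I \<nu>"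
  using assms by (auto simp: cycle_families_def placements_def)

lemma mean_count_cong:
  assumes "\<And>t. t \<in> I \<Longrightarrow> \<mu> t = \<nu> t"
  shows "mean_count n k I \<mu> = mean_count n k I \<nu>"
  unfolding mean_count_def using cycle_families_cong[OF assms] by simp

lemma mean_count_empty [simp]: "mean_count n k {} \<mu> = 1"
proof -
  have "cycle_families n \<sigma> {} \<mu> = {\<lambda>_. undefined}" for \<sigma>
    by (auto simp: cycle_families_def placements_def disjoint_family_on_def)
  then show ?thesis by (simp add: mean_count_def)
qed

lemma mean_count_remove_le:
  assumes "finite I" "t \<in> I" "0 < \<mu> t" "2 \<le> n"
  shows "mean_count n k I \<mu> \<le> real n * mean_count n k (I - {t}) \<mu>"
proof -
  have int: "integrable (measure_pmf (transposition_walk n k)) g" for g :: "(nat \<Rightarrow> nat) \<Rightarrow> real"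
    by (rule integrable_measure_pmf_finite[OF finite_transposition_walk[OF assms(4)]])
  have le: "cycle_count n I \<mu> \<sigma> \<le> real n * cycle_count n (I - {t}) \<mu> \<sigma>" for \<sigma>
    using of_nat_mono[OF card_cycle_families_remove_le[where \<mu> = \<mu>, OF assms(1-3)], where 'a = real] by simp
  have "mean_count n k I \<mu> \<le> measure_pmf.expectation (transposition_walk n k) (\<lambda>\<sigma>. real n * cycle_count n (I - {t}) \<mu> \<sigma>)"
    unfolding mean_count_def
  proof (rule integral_mono)
    fix \<sigma> show "cycle_count n I \<mu> \<sigma> \<le> real n * cycle_count n (I - {t}) \<mu> \<sigma>" by (rule le)
  qed (rule int)+
  also have "\<dots> = real n * mean_count n k (I - {t}) \<mu>"
    unfolding mean_count_def using int by simp
  finally show ?thesis .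
qed

lemma mean_count_le_power:
  assumes "finite I" "\<And>t. t \<in> I \<Longrightarrow> 0 < \<mu> t" "2 \<le> n"
  shows "mean_count n k I \<mu> \<le> real n ^ card I"
  using assms
proof (induction I rule: finite_induct)
  case (insert t I)
  have "mean_count n k (insert t I) \<mu> \<le> real n * mean_count n k (insert t I - {t}) \<mu>"
    using insert by (intro mean_count_remove_le) auto
  also have "insert t I - {t} = I" using insert by auto
  also have "real n * mean_count n k I \<mu> \<le> real n * real n ^ card I"
    using insert by (intro mult_left_mono) auto
  finally show ?case using insert by simp
qed simp

text \<open>The time step. For a family with \<open>d\<close> points,
  \<open>(n - d) * (n - d - 1) / (n * (n - 1))\<close> equals \<open>1 - rate n * d\<close> plus
  \<open>d * (d + 1) / (n * (n - 1))\<close>, and the removal of a word has coefficient exactly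
  \<open>rate n\<close> times its length.\<close>

definition rate :: "nat \<Rightarrow> real" where "rate n = 2 / (real n - 1)"

definition outs :: "(nat set \<Rightarrow> (nat \<Rightarrow> nat) \<Rightarrow> real) \<Rightarrow> nat set \<Rightarrow> (nat \<Rightarrow> nat) \<Rightarrow> real" where
  "outs M I \<mu> = (\<Sum>t\<in>I. real (\<mu> t) * M (I - {t}) \<mu>)"

definition cuts :: "nat \<Rightarrow> (nat set \<Rightarrow> (nat \<Rightarrow> nat) \<Rightarrow> real) \<Rightarrow> nat set \<Rightarrow> (nat \<Rightarrow> nat) \<Rightarrow> real" where
  "cuts f M I \<mu> = (\<Sum>t\<in>I. \<Sum>v<\<mu> t. \<Sum>u<v. M (insert f I) (\<mu>(t := \<mu> t - (v - u), f := v - u)))"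

text \<open>The exceptions to departures: the starting point lies in another word, or its orbit
  closes within \<open>\<mu> t\<close> steps.\<close>

definition shortened :: "(nat set \<Rightarrow> (nat \<Rightarrow> nat) \<Rightarrow> real) \<Rightarrow> nat set \<Rightarrow> (nat \<Rightarrow> nat) \<Rightarrow> real" where
  "shortened M I \<mu> = (\<Sum>t\<in>I. real (\<mu> t) * (real (sum \<mu> I) * M (I - {t}) \<mu> + (\<Sum>r=1..\<mu> t. M I (\<mu>(t := r)))))"

definition joins :: "(nat set \<Rightarrow> (nat \<Rightarrow> nat) \<Rightarrow> real) \<Rightarrow> nat set \<Rightarrow> (nat \<Rightarrow> nat) \<Rightarrow> real" where
  "joins M I \<mu> = (\<Sum>t\<in>I. \<Sum>t'\<in>I - {t}. real (\<mu> t) * (real (\<mu> t') * M (I - {t'}) (\<mu>(t := \<mu> t + \<mu> t'))))"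

text \<open>The increment is corrected for the decay caused by moving one of the
  \<open>sum \<mu> I\<close> points and is measured per unit of time. In this scale removals have
  the lengths as coefficients, cuts have \<open>1 / n\<close>, and so has every other term; the
  \<open>d * (d + 1)\<close> left over from the decay joins the error.\<close>

lemma mean_count_drift:
  assumes I: "finite I" "f \<notin> I" and n: "sum \<mu> I + 1 \<le> n" "2 \<le> n"
  shows "\<bar>(mean_count n (Suc k) I \<mu> - (1 - rate n * real (sum \<mu> I)) * mean_count n k I \<mu>) / rate n -
      (outs (mean_count n k) I \<mu> + cuts f (mean_count n k) I \<mu> / real n)\<bar>
    \<le> (real (sum \<mu> I * (sum \<mu> I + 1)) * mean_count n k I \<mu> + shortened (mean_count n k) I \<mu> +
        joins (mean_count n k) I \<mu>) / real n"
proof -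
  define d where "d = real (sum \<mu> I)"
  let ?M = "mean_count n k" and ?M' = "mean_count n (Suc k) I \<mu>"
  define N where "N = real n"
  have N: "N \<ge> 2" using n by (simp add: N_def)
  have "outs ?M I \<mu> * N = (\<Sum>t\<in>I. real (\<mu> t) * (real n * mean_count n k (I - {t}) \<mu>))"
    unfolding outs_def N_def sum_distrib_right by (intro sum.cong refl) simp
  then have main: "\<bar>N * (N - 1) * ?M' - ((N - d) * (N - d - 1) * ?M I \<mu> + 2 * (outs ?M I \<mu> * N) + 2 * cuts f ?M I \<mu>)\<bar>
    \<le> 2 * shortened ?M I \<mu> + joins ?M I \<mu>"
    using mean_count_step[OF I n, of k] unfolding cuts_def shortened_def joins_def d_def N_def by simp
  have joins0: "0 \<le> joins ?M I \<mu>"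
    unfolding joins_def by (intro sum_nonneg mult_nonneg_nonneg mean_count_nonneg of_nat_0_le_iff)
  have M0: "0 \<le> ?M I \<mu>" by (rule mean_count_nonneg)
  have d0: "0 \<le> d" unfolding d_def by (rule of_nat_0_le_iff)
  have eq: "(?M' - (1 - rate n * d) * ?M I \<mu>) / rate n - (outs ?M I \<mu> + cuts f ?M I \<mu> / N) =
    (N * (N - 1) * ?M' - ((N - d) * (N - d - 1) * ?M I \<mu> + 2 * (outs ?M I \<mu> * N) + 2 * cuts f ?M I \<mu>)) / (2 * N) +
      d * (d + 1) * ?M I \<mu> / (2 * N)"
  proof -
    have r: "rate n = 2 / (N - 1)" by (simp add: rate_def N_def)
    have "(x - (1 - 2 / (N - 1) * d) * m) / (2 / (N - 1)) - (s + c / N) =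
      (N * (N - 1) * x - ((N - d) * (N - d - 1) * m + 2 * (s * N) + 2 * c)) / (2 * N) + d * (d + 1) * m / (2 * N)" for x m s c
      using N by (simp add: divide_simps) (simp add: algebra_simps)
    then show ?thesis unfolding r .
  qed
  have "\<bar>(?M' - (1 - rate n * d) * ?M I \<mu>) / rate n - (outs ?M I \<mu> + cuts f ?M I \<mu> / N)\<bar> \<le>
    (2 * shortened ?M I \<mu> + joins ?M I \<mu>) / (2 * N) + d * (d + 1) * ?M I \<mu> / (2 * N)"
  proof -
    have "\<bar>(N * (N - 1) * ?M' - ((N - d) * (N - d - 1) * ?M I \<mu> + 2 * (outs ?M I \<mu> * N) + 2 * cuts f ?M I \<mu>)) / (2 * N)\<bar>
      \<le> (2 * shortened ?M I \<mu> + joins ?M I \<mu>) / (2 * N)"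
      using main N by (simp add: abs_divide divide_right_mono)
    moreover have "0 \<le> d * (d + 1) * ?M I \<mu> / (2 * N)" using M0 N d0 by simp
    ultimately show ?thesis unfolding eq by linarith
  qed
  also have "\<dots> \<le> (d * (d + 1) * ?M I \<mu> + shortened ?M I \<mu> + joins ?M I \<mu>) / N"
  proof -
    have "0 \<le> d * (d + 1) * ?M I \<mu>" using M0 d0 by simp
    then have "(2 * shortened ?M I \<mu> + joins ?M I \<mu> + d * (d + 1) * ?M I \<mu>) / (2 * N) \<le>
      (2 * (d * (d + 1) * ?M I \<mu> + shortened ?M I \<mu> + joins ?M I \<mu>)) / (2 * N)"
      using N joins0 by (intro divide_right_mono) simp_all
    then show ?thesis by (simp only: add_divide_distrib[symmetric] mult_divide_mult_cancel_left_if) simp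
  qed
  finally show ?thesis by (simp add: d_def N_def mult.commute algebra_simps)
qed

section \<open>Domination up to powers of the logarithm\<close>

text \<open>\<open>short\<close> keeps the elapsed time below a power of the logarithm.
  \<open>decay\<close> keeps \<open>(1 - rate n) ^ k\<close> above \<open>1 / n\<close>, up to
  logarithms, for all \<open>k \<le> T n\<close> with \<open>n\<close> large, so that errors of
  order \<open>1 / n\<close> are absorbed by it.\<close>

locale time_window =
  fixes T :: "nat \<Rightarrow> nat"
  assumes short: "\<forall>\<^sub>F n in sequentially. rate n * real (T n) \<le> ln (real n) ^ 2"
    and decay: "\<exists>K. \<forall>\<^sub>F n in sequentially. 1 / real n \<le> ln (real n) ^ K * (1 - rate n) ^ T n"
begin

text \<open>One exponent \<open>K\<close> serves all times up to \<open>T n\<close>. A constant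
  factor has no place of its own, because \<open>ln n\<close> eventually exceeds it.\<close>

definition dominated :: "(nat \<Rightarrow> nat \<Rightarrow> real) \<Rightarrow> (nat \<Rightarrow> nat \<Rightarrow> real) \<Rightarrow> bool" (infix "\<preceq>" 50) where
  "f \<preceq> g \<longleftrightarrow> (\<exists>K. \<forall>\<^sub>F n in sequentially. \<forall>k\<le>T n. \<bar>f n k\<bar> \<le> ln (real n) ^ K * g n k)"

text \<open>The discrete form of \<open>exp (- s)\<close> at time \<open>s = rate n * k\<close>. As
  a power it decays by exactly \<open>1 - rate n\<close> in each step.\<close>

definition \<theta> :: "nat \<Rightarrow> nat \<Rightarrow> real" where "\<theta> n k = (1 - rate n) ^ k"

lemma ln_large: "\<forall>\<^sub>F n in sequentially. c \<le> ln (real n)"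
  using filterlim_compose[OF ln_at_top filterlim_real_sequentially]
  by (simp add: filterlim_at_top)

lemma dominatedI:
  assumes "\<forall>\<^sub>F n in sequentially. \<forall>k\<le>T n. \<bar>f n k\<bar> \<le> g n k"
  shows "f \<preceq> g"
  unfolding dominated_def using assms by (intro exI[of _ 0]) simp

text \<open>Nonnegativity of \<open>g\<close> follows from that of \<open>\<bar>f n k\<bar>\<close>
  and positivity of the power of the logarithm. All larger exponents are offered so that two
  dominations can be brought to a common one.\<close>

lemma dominatedE:
  assumes "f \<preceq> g"
  obtains K where "\<And>K'. K \<le> K' \<Longrightarrow> \<forall>\<^sub>F n in sequentially. \<forall>k\<le>T n. \<bar>f n k\<bar> \<le> ln (real n) ^ K' * g n k \<and> 0 \<le> g n k"
proof -
  obtain K where K: "\<forall>\<^sub>F n in sequentially. \<forall>k\<le>T n. \<bar>f n k\<bar> \<le> ln (real n) ^ K * g n k"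
    using assms by (auto simp: dominated_def)
  show ?thesis
  proof (rule that[of K])
    fix K' assume "K \<le> K'"
    from K ln_large[of 1] show "\<forall>\<^sub>F n in sequentially. \<forall>k\<le>T n. \<bar>f n k\<bar> \<le> ln (real n) ^ K' * g n k \<and> 0 \<le> g n k"
    proof eventually_elim
      case (elim n)
      show ?case
      proof (intro allI impI)
        fix k assume k: "k \<le> T n"
        have "0 \<le> ln (real n) ^ K * g n k" using elim(1) k abs_ge_zero order_trans by blast
        moreover have "0 < ln (real n) ^ K" using elim(2) by (intro zero_less_power) linarith
        ultimately have g: "0 \<le> g n k" by (simp add: zero_le_mult_iff)
        have "ln (real n) ^ K * g n k \<le> ln (real n) ^ K' * g n k"
          using elim(2) g \<open>K \<le> K'\<close> by (intro mult_right_mono power_increasing)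
        then show "\<bar>f n k\<bar> \<le> ln (real n) ^ K' * g n k \<and> 0 \<le> g n k" using elim(1) k g by force
      qed
    qed
  qed
qed

lemma dominated_nonneg: "f \<preceq> g \<Longrightarrow> \<forall>\<^sub>F n in sequentially. \<forall>k\<le>T n. 0 \<le> g n k"
  by (erule dominatedE) (drule meta_spec, drule meta_mp[OF _ order_refl], auto elim: eventually_mono)

lemma dominated_trans [trans]:
  assumes "f \<preceq> g" "g \<preceq> h"
  shows "f \<preceq> h"
proof -
  obtain K where K: "\<And>K'. K \<le> K' \<Longrightarrow> \<forall>\<^sub>F n in sequentially. \<forall>k\<le>T n. \<bar>f n k\<bar> \<le> ln (real n) ^ K' * g n k \<and> 0 \<le> g n k"
    using dominatedE[OF assms(1)] by blast
  obtain K2 where K2: "\<And>K'. K2 \<le> K' \<Longrightarrow> \<forall>\<^sub>F n in sequentially. \<forall>k\<le>T n. \<bar>g n k\<bar> \<le> ln (real n) ^ K' * h n k \<and> 0 \<le> h n k"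
    using dominatedE[OF assms(2)] by blast
  have "\<forall>\<^sub>F n in sequentially. \<forall>k\<le>T n. \<bar>f n k\<bar> \<le> ln (real n) ^ (K + K2) * h n k"
    using K[OF order_refl] K2[OF order_refl] ln_large[of 1]
  proof eventually_elim
    case (elim n)
    show ?case
    proof (intro allI impI)
      fix k assume k: "k \<le> T n"
      have "\<bar>f n k\<bar> \<le> ln (real n) ^ K * g n k" using elim k by blast
      also have "\<dots> \<le> ln (real n) ^ K * (ln (real n) ^ K2 * h n k)"
        using elim(2,3) k by (intro mult_left_mono) force+
      finally show "\<bar>f n k\<bar> \<le> ln (real n) ^ (K + K2) * h n k" by (simp add: power_add mult.assoc)
    qed
  qed
  then show ?thesis unfolding dominated_def by blast
qed

lemma dominated_le:
  assumes "f \<preceq> g" "\<forall>\<^sub>F n in sequentially. \<forall>k\<le>T n. \<bar>f' n k\<bar> \<le> \<bar>f n k\<bar>"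
  shows "f' \<preceq> g"
proof -
  obtain K where "\<forall>\<^sub>F n in sequentially. \<forall>k\<le>T n. \<bar>f n k\<bar> \<le> ln (real n) ^ K * g n k"
    using assms(1) by (auto simp: dominated_def)
  with assms(2) have "\<forall>\<^sub>F n in sequentially. \<forall>k\<le>T n. \<bar>f' n k\<bar> \<le> ln (real n) ^ K * g n k"
    by eventually_elim force
  then show ?thesis unfolding dominated_def by blast
qed

lemma dominated_ge:
  assumes "f \<preceq> g" "\<forall>\<^sub>F n in sequentially. \<forall>k\<le>T n. 0 \<le> g n k \<longrightarrow> g n k \<le> h n k"
  shows "f \<preceq> h"
proof -
  from dominated_nonneg[OF assms(1)] assms(2) have "\<forall>\<^sub>F n in sequentially. \<forall>k\<le>T n. \<bar>g n k\<bar> \<le> h n k"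
    by eventually_elim simp
  then have "g \<preceq> h" by (rule dominatedI)
  with assms(1) show ?thesis by (rule dominated_trans)
qed

lemma dominated_cong:
  assumes "f \<preceq> g" "\<forall>\<^sub>F n in sequentially. \<forall>k\<le>T n. f' n k = f n k"
  shows "f' \<preceq> g"
  using assms(2) by (intro dominated_le[OF assms(1)]) (auto elim: eventually_mono)

lemma dominated_mult:
  assumes "f \<preceq> g" "f' \<preceq> g'"
  shows "(\<lambda>n k. f n k * f' n k) \<preceq> (\<lambda>n k. g n k * g' n k)"
proof -
  obtain K where K: "\<And>K'. K \<le> K' \<Longrightarrow> \<forall>\<^sub>F n in sequentially. \<forall>k\<le>T n. \<bar>f n k\<bar> \<le> ln (real n) ^ K' * g n k \<and> 0 \<le> g n k"
    using dominatedE[OF assms(1)] by blast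
  obtain K2 where K2: "\<And>K'. K2 \<le> K' \<Longrightarrow> \<forall>\<^sub>F n in sequentially. \<forall>k\<le>T n. \<bar>f' n k\<bar> \<le> ln (real n) ^ K' * g' n k \<and> 0 \<le> g' n k"
    using dominatedE[OF assms(2)] by blast
  have "\<forall>\<^sub>F n in sequentially. \<forall>k\<le>T n. \<bar>f n k * f' n k\<bar> \<le> ln (real n) ^ (K + K2) * (g n k * g' n k)"
    using K[OF order_refl] K2[OF order_refl]
  proof eventually_elim
    case (elim n)
    show ?case
    proof (intro allI impI)
      fix k assume k: "k \<le> T n"
      have "\<bar>f n k\<bar> * \<bar>f' n k\<bar> \<le> (ln (real n) ^ K * g n k) * (ln (real n) ^ K2 * g' n k)"
        using elim k by (intro mult_mono) (auto intro: order_trans[OF abs_ge_zero])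
      then show "\<bar>f n k * f' n k\<bar> \<le> ln (real n) ^ (K + K2) * (g n k * g' n k)"
        by (simp add: abs_mult power_add mult_ac)
    qed
  qed
  then show ?thesis unfolding dominated_def by blast
qed

lemma dominated_add:
  assumes "f \<preceq> g" "f' \<preceq> g"
  shows "(\<lambda>n k. f n k + f' n k) \<preceq> g"
proof -
  obtain K where K: "\<And>K'. K \<le> K' \<Longrightarrow> \<forall>\<^sub>F n in sequentially. \<forall>k\<le>T n. \<bar>f n k\<bar> \<le> ln (real n) ^ K' * g n k \<and> 0 \<le> g n k"
    using dominatedE[OF assms(1)] by blast
  obtain K2 where K2: "\<And>K'. K2 \<le> K' \<Longrightarrow> \<forall>\<^sub>F n in sequentially. \<forall>k\<le>T n. \<bar>f' n k\<bar> \<le> ln (real n) ^ K' * g n k \<and> 0 \<le> g n k"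
    using dominatedE[OF assms(2)] by blast
  have "\<forall>\<^sub>F n in sequentially. \<forall>k\<le>T n. \<bar>f n k + f' n k\<bar> \<le> ln (real n) ^ Suc (K + K2) * g n k"
    using K[OF le_add1[of K K2]] K2[OF le_add2[of K2 K]] ln_large[of 2]
  proof eventually_elim
    case (elim n)
    show ?case
    proof (intro allI impI)
      fix k assume k: "k \<le> T n"
      have le: "\<bar>f n k\<bar> \<le> ln (real n) ^ (K + K2) * g n k" "\<bar>f' n k\<bar> \<le> ln (real n) ^ (K + K2) * g n k"
        and g: "0 \<le> g n k" using elim(1,2) k by auto
      have "\<bar>f n k + f' n k\<bar> \<le> 2 * (ln (real n) ^ (K + K2) * g n k)" using le by linarith
      also have "\<dots> \<le> ln (real n) * (ln (real n) ^ (K + K2) * g n k)"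
        using elim(3) g by (intro mult_right_mono) auto
      finally show "\<bar>f n k + f' n k\<bar> \<le> ln (real n) ^ Suc (K + K2) * g n k" by (simp add: mult.assoc)
    qed
  qed
  then show ?thesis unfolding dominated_def by blast
qed

lemma dominated_uminus: "f \<preceq> g \<Longrightarrow> (\<lambda>n k. - f n k) \<preceq> g"
  by (rule dominated_le) auto

lemma dominated_diff:
  "f \<preceq> g \<Longrightarrow> f' \<preceq> g \<Longrightarrow> (\<lambda>n k. f n k - f' n k) \<preceq> g"
  using dominated_add[OF _ dominated_uminus, of f g f'] by simp

lemma dominated_const: "(\<lambda>n k. c) \<preceq> (\<lambda>n k. 1)"
  unfolding dominated_def using ln_large[of "\<bar>c\<bar>"] by (intro exI[of _ 1]) (auto elim: eventually_mono)

lemma dominated_cmult: "f \<preceq> g \<Longrightarrow> (\<lambda>n k. c * f n k) \<preceq> g"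
  using dominated_mult[OF dominated_const[of c], of f g] by simp

lemma dominated_refl:
  assumes "\<forall>\<^sub>F n in sequentially. \<forall>k\<le>T n. 0 \<le> g n k"
  shows "g \<preceq> g"
  by (rule dominatedI) (use assms in \<open>auto elim: eventually_mono\<close>)

lemma dominated_zero:
  assumes "\<forall>\<^sub>F n in sequentially. \<forall>k\<le>T n. 0 \<le> g n k"
  shows "(\<lambda>n k. 0) \<preceq> g"
  by (rule dominatedI) (use assms in simp)

lemma dominated_sum:
  assumes "\<And>a. a \<in> A \<Longrightarrow> f a \<preceq> g" "\<forall>\<^sub>F n in sequentially. \<forall>k\<le>T n. 0 \<le> g n k"
  shows "(\<lambda>n k. \<Sum>a\<in>A. f a n k) \<preceq> g"
  using assms(1)
  by (induction A rule: infinite_finite_induct) (auto intro: dominated_zero[OF assms(2)] dominated_add)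

lemma dominated_prod:
  assumes "\<And>a. a \<in> A \<Longrightarrow> f a \<preceq> g a"
  shows "(\<lambda>n k. \<Prod>a\<in>A. f a n k) \<preceq> (\<lambda>n k. \<Prod>a\<in>A. g a n k)"
  using assms
  by (induction A rule: infinite_finite_induct) (auto intro: dominated_const dominated_mult)

lemma dominated_power:
  "f \<preceq> g \<Longrightarrow> (\<lambda>n k. f n k ^ m) \<preceq> (\<lambda>n k. g n k ^ m)"
  by (induction m) (auto intro: dominated_const dominated_mult)

lemma rate_small: "0 < c \<Longrightarrow> \<forall>\<^sub>F n in sequentially. rate n \<le> c"
proof -
  assume "0 < c"
  have "(\<lambda>n. rate n) \<longlonglongrightarrow> 0" unfolding rate_def by real_asymp
  then show ?thesis using order_tendstoD(2)[of rate 0 sequentially c] \<open>0 < c\<close>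
    by (auto elim: eventually_mono)
qed

lemma rate_pos: "\<forall>\<^sub>F n in sequentially. 0 < rate n"
  using eventually_ge_at_top[of 2] by eventually_elim (simp add: rate_def)

lemma time_dominated: "(\<lambda>n k. rate n * real k) \<preceq> (\<lambda>n k. 1)"
proof -
  have "\<forall>\<^sub>F n in sequentially. \<forall>k\<le>T n. \<bar>rate n * real k\<bar> \<le> ln (real n) ^ 2 * 1"
    using short rate_pos
  proof eventually_elim
    case (elim n)
    show ?case
    proof (intro allI impI)
      fix k assume "k \<le> T n"
      then have "rate n * real k \<le> rate n * real (T n)" using elim by simp
      also note elim(1)
      finally show "\<bar>rate n * real k\<bar> \<le> ln (real n) ^ 2 * 1" using elim by simp
    qed
  qed
  then show ?thesis unfolding dominated_def by blast
qed

lemma theta_bounds: "\<forall>\<^sub>F n in sequentially. \<forall>k. 0 < \<theta> n k \<and> \<theta> n k \<le> 1"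
  using rate_small[of "1/2", simplified] rate_pos
  by eventually_elim (simp add: \<theta>_def power_le_one)

lemma inverse_dominated_theta: "(\<lambda>n k. 1 / real n) \<preceq> \<theta>"
proof -
  obtain K where K: "\<forall>\<^sub>F n in sequentially. 1 / real n \<le> ln (real n) ^ K * (1 - rate n) ^ T n"
    using decay by blast
  have "\<forall>\<^sub>F n in sequentially. \<forall>k\<le>T n. \<bar>1 / real n\<bar> \<le> ln (real n) ^ K * \<theta> n k"
    using K rate_small[of "1/2", simplified] rate_pos ln_large[of 0]
  proof eventually_elim
    case (elim n)
    show ?case
    proof (intro allI impI)
      fix k assume "k \<le> T n"
      then have "(1 - rate n) ^ T n \<le> (1 - rate n) ^ k" using elim by (intro power_decreasing) auto
      then have "ln (real n) ^ K * (1 - rate n) ^ T n \<le> ln (real n) ^ K * \<theta> n k"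
        unfolding \<theta>_def using elim by (intro mult_left_mono) auto
      then show "\<bar>1 / real n\<bar> \<le> ln (real n) ^ K * \<theta> n k" using elim by simp
    qed
  qed
  then show ?thesis unfolding dominated_def by blast
qed

text \<open>
  Duhamel's principle: a source dominated by \<open>g\<close> adds at most the elapsed time
  \<open>rate n * T n \<le> ln n ^ 2\<close> times \<open>g\<close>, which the powers of the logarithm absorb.
\<close>

lemma dominated_evolution:
  assumes start: "(\<lambda>n k. e n 0) \<preceq> (\<lambda>n k. g n 0)"
    and drift: "(\<lambda>n k. (e n (Suc k) - (1 - rate n * real d) * e n k) / rate n) \<preceq> g"
    and growth: "\<forall>\<^sub>F n in sequentially. \<forall>k<T n. (1 - rate n) ^ d * g n k \<le> g n (Suc k)"
  shows "e \<preceq> g"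
proof -
  obtain K where K: "\<And>K'. K \<le> K' \<Longrightarrow> \<forall>\<^sub>F n in sequentially. \<forall>k\<le>T n. \<bar>e n 0\<bar> \<le> ln (real n) ^ K' * g n 0 \<and> 0 \<le> g n 0"
    using dominatedE[OF start] by blast
  obtain K2 where K2: "\<And>K'. K2 \<le> K' \<Longrightarrow> \<forall>\<^sub>F n in sequentially. \<forall>k\<le>T n.
      \<bar>(e n (Suc k) - (1 - rate n * real d) * e n k) / rate n\<bar> \<le> ln (real n) ^ K' * g n k \<and> 0 \<le> g n k"
    using dominatedE[OF drift] by blast
  define \<kappa> where "\<kappa> = K + K2"
  have "K \<le> \<kappa>" "K2 \<le> \<kappa>" by (simp_all add: \<kappa>_def)
  have half: "\<forall>\<^sub>F n in sequentially. 1 / 2 \<le> 1 - rate n * real d"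
  proof -
    have "\<forall>\<^sub>F n in sequentially. rate n \<le> 1 / (2 * (real d + 1))" by (rule rate_small) simp
    with rate_pos show ?thesis
    proof eventually_elim
      case (elim n)
      have "rate n * real d \<le> 1 / (2 * (real d + 1)) * real d" using elim by (intro mult_right_mono) auto
      also have "\<dots> \<le> 1 / 2" by (simp add: field_simps)
      finally show ?case by simp
    qed
  qed
  have "\<forall>\<^sub>F n in sequentially. \<forall>k\<le>T n. \<bar>e n k\<bar> \<le> ln (real n) ^ (\<kappa> + 4) * g n k"
    using K[OF \<open>K \<le> \<kappa>\<close>] K2[OF \<open>K2 \<le> \<kappa>\<close>] growth half rate_pos short ln_large[of 2] rate_small[of 1, simplified]
  proof eventually_elim
    case (elim n)
    define L where "L = ln (real n)"
    have L: "2 \<le> L" using elim by (simp add: L_def)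
    \<comment> \<open>By Bernoulli's inequality the linear decay factor of the recursion is at most
      \<open>(1 - rate n) ^ d\<close>, the decay that \<open>growth\<close> grants to
      \<open>g\<close>. So the homogeneous part never outgrows \<open>g\<close>.\<close>
    have bern: "1 - rate n * real d \<le> (1 - rate n) ^ d"
      using Bernoulli_inequality[of "- rate n" d] elim by (simp add: mult.commute)
    \<comment> \<open>The 2 appears because the source of a step is measured by
      \<open>g n k\<close>, which can be twice \<open>g n (Suc k)\<close>.\<close>
    have *: "\<bar>e n k\<bar> \<le> L ^ \<kappa> * (1 + 2 * rate n * real k) * g n k" if "k \<le> T n" for k
      using that
    proof (induction k)
      case 0
      then show ?case using spec[OF elim(1), of 0] by (simp add: L_def)
    next
      case (Suc k)
      then have k: "k \<le> T n" "k < T n" by auto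
      have g: "0 \<le> g n k" and dr: "\<bar>(e n (Suc k) - (1 - rate n * real d) * e n k) / rate n\<bar> \<le> L ^ \<kappa> * g n k"
        using elim(2) k(1) by (auto simp: L_def)
      have gS: "(1 - rate n) ^ d * g n k \<le> g n (Suc k)" using elim(3) k(2) by blast
      have "1 / 2 * g n k \<le> (1 - rate n) ^ d * g n k"
        using elim(4) bern g by (intro mult_right_mono) auto
      then have g2: "g n k \<le> 2 * g n (Suc k)" using gS by linarith
      have "\<bar>e n (Suc k) - (1 - rate n * real d) * e n k\<bar> \<le> rate n * (L ^ \<kappa> * g n k)"
        using dr elim(5) by (simp add: abs_divide divide_le_eq mult.commute)
      then have "\<bar>e n (Suc k)\<bar> \<le> \<bar>(1 - rate n * real d) * e n k\<bar> + rate n * (L ^ \<kappa> * g n k)"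
        by linarith
      also have "\<bar>(1 - rate n * real d) * e n k\<bar> = (1 - rate n * real d) * \<bar>e n k\<bar>"
        using elim(4) by (simp add: abs_mult)
      also have "\<dots> \<le> (1 - rate n) ^ d * (L ^ \<kappa> * (1 + 2 * rate n * real k) * g n k)"
        using Suc.IH[OF k(1)] bern elim(4) by (intro mult_mono) auto
      also have "\<dots> = L ^ \<kappa> * (1 + 2 * rate n * real k) * ((1 - rate n) ^ d * g n k)" by simp
      also have "\<dots> \<le> L ^ \<kappa> * (1 + 2 * rate n * real k) * g n (Suc k)"
        using gS L elim(5) by (intro mult_left_mono) auto
      also have "rate n * (L ^ \<kappa> * g n k) \<le> rate n * (L ^ \<kappa> * (2 * g n (Suc k)))"
        using g2 L elim(5) by (intro mult_left_mono) auto
      finally show ?case by (simp add: algebra_simps)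
    qed
    show ?case
    proof (intro allI impI)
      fix k assume k: "k \<le> T n"
      have g: "0 \<le> g n k" using elim(2) k by blast
      have "rate n * real k \<le> rate n * real (T n)" using k elim(5) by simp
      also have "\<dots> \<le> L ^ 2" using elim(6) by (simp add: L_def)
      finally have "1 + 2 * rate n * real k \<le> 1 + 2 * L ^ 2" by simp
      also have "\<dots> \<le> L ^ 4"
      proof -
        have "4 \<le> L ^ 2" using power_mono[OF L, of 2] by simp
        then have "4 * L ^ 2 \<le> L ^ 2 * L ^ 2" by (intro mult_right_mono) auto
        then show ?thesis using \<open>4 \<le> L ^ 2\<close> by (simp add: power_add[symmetric])
      qed
      finally have "L ^ \<kappa> * (1 + 2 * rate n * real k) * g n k \<le> L ^ \<kappa> * L ^ 4 * g n k"
        using L g by (intro mult_right_mono mult_left_mono) auto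
      then show "\<bar>e n k\<bar> \<le> ln (real n) ^ (\<kappa> + 4) * g n k"
        using *[OF k] by (simp add: power_add L_def)
    qed
  qed
  then show ?thesis unfolding dominated_def by blast
qed

end

section \<open>Profiles of the mean and of the error\<close>

definition cut_at :: "(nat \<Rightarrow> nat) \<Rightarrow> nat \<Rightarrow> nat \<Rightarrow> nat \<Rightarrow> nat \<Rightarrow> nat" where
  "cut_at \<mu> t f r = \<mu>(t := \<mu> t - r, f := r)"

definition valid :: "nat set \<Rightarrow> (nat \<Rightarrow> nat) \<Rightarrow> bool" where
  "valid I \<mu> \<longleftrightarrow> finite I \<and> (\<forall>t\<in>I. 0 < \<mu> t)"

lemma valid_remove: "valid I \<mu> \<Longrightarrow> valid (I - {t}) \<mu>"
  by (simp add: valid_def)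

lemma valid_cut: "valid I \<mu> \<Longrightarrow> t \<in> I \<Longrightarrow> f \<notin> I \<Longrightarrow> 0 < r \<Longrightarrow> r < \<mu> t \<Longrightarrow> valid (insert f I) (cut_at \<mu> t f r)"
  by (auto simp: valid_def cut_at_def)

lemma valid_join: "valid I \<mu> \<Longrightarrow> t \<in> I \<Longrightarrow> valid (I - {t'}) (\<mu>(t := \<mu> t + \<mu> t'))"
  by (auto simp: valid_def)

lemma sum_remove_add: "finite I \<Longrightarrow> t \<in> I \<Longrightarrow> sum \<mu> (I - {t}) + \<mu> t = (sum \<mu> I :: nat)"
  by (simp add: sum.remove add.commute)

lemma sum_cut:
  assumes "finite I" "t \<in> I" "f \<notin> I" "r < \<mu> t"
  shows "sum (cut_at \<mu> t f r) (insert f I) = sum \<mu> I"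
proof -
  have "sum (cut_at \<mu> t f r) (insert f I) = r + sum (cut_at \<mu> t f r) I"
    using assms by (simp add: cut_at_def)
  also have "sum (cut_at \<mu> t f r) I = cut_at \<mu> t f r t + sum (cut_at \<mu> t f r) (I - {t})"
    by (rule sum.remove[OF assms(1,2)])
  also have "cut_at \<mu> t f r t = \<mu> t - r" using assms by (auto simp: cut_at_def)
  also have "sum (cut_at \<mu> t f r) (I - {t}) = sum \<mu> (I - {t})"
    using assms by (intro sum.cong) (auto simp: cut_at_def)
  finally show ?thesis using assms sum_remove_add[of I t \<mu>] by simp
qed

lemma sum_join:
  assumes "finite I" "t \<in> I" "t' \<in> I" "t \<noteq> t'"
  shows "sum (\<mu>(t := \<mu> t + \<mu> t')) (I - {t'}) = (sum \<mu> I :: nat)"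
proof -
  have "sum (\<mu>(t := \<mu> t + \<mu> t')) (I - {t'}) = (\<mu> t + \<mu> t') + sum \<mu> (I - {t'} - {t})"
    using assms by (subst sum.remove[of _ t]) auto
  moreover have "sum \<mu> I = \<mu> t' + (\<mu> t + sum \<mu> (I - {t'} - {t}))"
    using assms sum.remove[of I t' \<mu>] sum.remove[of "I - {t'}" t \<mu>] by simp
  ultimately show ?thesis by simp
qed

lemma card_le_sum: "valid I \<mu> \<Longrightarrow> card I \<le> sum \<mu> I"
  unfolding valid_def using sum_mono[of I "\<lambda>_. 1" \<mu>] by (auto simp: Suc_le_eq)

context time_window
begin

text \<open>
  \<open>V\<close> is the size of the mean, up to powers of the logarithm. In \<open>E\<close> one factor is replaced by \<open>\<theta>\<close>;
  a relative error of order \<open>\<theta>\<close> in the whole product would not propagate, because the trees formed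
  early, when \<open>\<theta>\<close> is not small, persist.
\<close>

definition v :: "nat \<Rightarrow> nat \<Rightarrow> nat \<Rightarrow> real" where "v i n k = 1 + real n * \<theta> n k ^ i"

definition V :: "nat set \<Rightarrow> (nat \<Rightarrow> nat) \<Rightarrow> nat \<Rightarrow> nat \<Rightarrow> real" where
  "V I \<mu> n k = (\<Prod>t\<in>I. v (\<mu> t) n k)"

definition E :: "nat set \<Rightarrow> (nat \<Rightarrow> nat) \<Rightarrow> nat \<Rightarrow> nat \<Rightarrow> real" where
  "E I \<mu> n k = (\<Sum>t\<in>I. \<theta> n k * V (I - {t}) \<mu> n k)"

text \<open>Collects bounds that hold for all large \<open>n\<close> and for every \<open>k\<close>,
  so that pointwise inequalities can be proved without filters.\<close>

definition good :: "nat \<Rightarrow> bool" where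
  "good n \<longleftrightarrow> 2 \<le> n \<and> 0 < rate n \<and> rate n \<le> 1 / 2 \<and> (\<forall>k. 0 < \<theta> n k \<and> \<theta> n k \<le> 1)"

lemma eventually_good: "eventually good sequentially"
  using eventually_ge_at_top[of 2] rate_pos rate_small[of "1/2", simplified] theta_bounds
  by eventually_elim (simp add: good_def)

lemma eventually_goodI: "(\<And>n k. good n \<Longrightarrow> P n k) \<Longrightarrow> \<forall>\<^sub>F n in sequentially. \<forall>k\<le>T n. P n k"
  using eventually_good by eventually_elim auto

lemma theta_power_le: "good n \<Longrightarrow> 0 < r \<Longrightarrow> \<theta> n k ^ r \<le> \<theta> n k"
  using power_decreasing[of 1 r "\<theta> n k"] by (auto simp: good_def less_imp_le)

lemma v_ge_1: "good n \<Longrightarrow> 1 \<le> v i n k"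
  by (auto simp: v_def good_def less_imp_le)

lemma v_pos: "good n \<Longrightarrow> 0 < v i n k"
  using v_ge_1[of n i k] by linarith

lemma v_mono: "good n \<Longrightarrow> i \<le> j \<Longrightarrow> v j n k \<le> v i n k"
  by (auto simp: v_def good_def less_imp_le intro!: mult_left_mono power_decreasing)

lemma V_ge_1: "good n \<Longrightarrow> 1 \<le> V I \<mu> n k"
  unfolding V_def by (rule prod_ge_1) (rule v_ge_1)

lemma V_pos: "good n \<Longrightarrow> 0 < V I \<mu> n k"
  using V_ge_1[of n I \<mu> k] by linarith

lemma E_nonneg: "good n \<Longrightarrow> 0 \<le> E I \<mu> n k"
  unfolding E_def by (intro sum_nonneg mult_nonneg_nonneg) (auto simp: good_def less_imp_le V_pos)

lemma V_remove: "finite I \<Longrightarrow> t \<in> I \<Longrightarrow> V I \<mu> n k = v (\<mu> t) n k * V (I - {t}) \<mu> n k"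
  by (simp add: V_def prod.remove)

lemma V_cong: "(\<And>t. t \<in> I \<Longrightarrow> \<mu> t = \<nu> t) \<Longrightarrow> V I \<mu> n k = V I \<nu> n k"
  by (simp add: V_def)

lemma V_remove_le:
  assumes "good n" "finite I"
  shows "V (I - {t}) \<mu> n k \<le> V I \<mu> n k"
proof (cases "t \<in> I")
  case True
  have "1 * V (I - {t}) \<mu> n k \<le> v (\<mu> t) n k * V (I - {t}) \<mu> n k"
    using assms by (intro mult_right_mono v_ge_1) (auto simp: V_pos less_imp_le)
  then show ?thesis using V_remove[OF assms(2) True] by simp
qed simp

lemma V_update: "finite I \<Longrightarrow> t \<in> I \<Longrightarrow> V I (\<mu>(t := r)) n k = v r n k * V (I - {t}) \<mu> n k"
  using V_remove[of I t "\<mu>(t := r)"] V_cong[of "I - {t}" "\<mu>(t := r)" \<mu>] by simp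

lemma V_cut:
  assumes "finite I" "t \<in> I" "f \<notin> I"
  shows "V (insert f I) (cut_at \<mu> t f r) n k = v r n k * (v (\<mu> t - r) n k * V (I - {t}) \<mu> n k)"
proof -
  have "t \<noteq> f" using assms by auto
  have "V (insert f I) (cut_at \<mu> t f r) n k = v r n k * V I (cut_at \<mu> t f r) n k"
    using assms by (simp add: V_def cut_at_def)
  also have "V I (cut_at \<mu> t f r) n k = V I (\<mu>(t := \<mu> t - r)) n k"
    using assms by (intro V_cong) (auto simp: cut_at_def)
  finally show ?thesis using assms by (simp add: V_update)
qed

lemma V_join:
  assumes "finite I" "t \<in> I" "t' \<in> I" "t \<noteq> t'"
  shows "V (I - {t'}) (\<mu>(t := c)) n k = v c n k * V (I - {t} - {t'}) \<mu> n k"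
proof -
  have "I - {t'} - {t} = I - {t} - {t'}" by auto
  then show ?thesis using V_update[of "I - {t'}" t \<mu> c] assms by simp
qed

text \<open>Let \<open>X = n * \<theta> ^ a\<close> and \<open>Y = n * \<theta> ^ b\<close>, both at
  most \<open>n\<close>. Then \<open>X * Y\<close> is \<open>n\<close> times the corresponding term
  for \<open>a + b\<close>, and \<open>1 + X + Y \<le> 3 * n\<close>. So a cut, with its coefficient
  \<open>1 / n\<close>, exceeds the profile of the uncut family by at most a constant.\<close>

lemma v_cut_le:
  assumes "good n"
  shows "v a n k * v b n k \<le> 3 * real n * v (a + b) n k"
proof -
  have th: "0 \<le> \<theta> n k ^ a" "\<theta> n k ^ a \<le> 1" "0 \<le> \<theta> n k ^ b" "\<theta> n k ^ b \<le> 1"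
    using assms by (auto simp: good_def less_imp_le power_le_one)
  have n: "2 \<le> real n" using assms by (simp add: good_def)
  define X Y where "X = real n * \<theta> n k ^ a" and "Y = real n * \<theta> n k ^ b"
  have "X \<le> real n * 1" "Y \<le> real n * 1" "0 \<le> X" "0 \<le> Y"
    unfolding X_def Y_def using th n by (simp_all add: mult_left_le)
  moreover have "v a n k * v b n k = 1 + X + Y + X * Y" "3 * real n * v (a + b) n k = 3 * real n + 3 * (X * Y)"
    by (simp_all add: v_def X_def Y_def power_add algebra_simps)
  moreover have "0 \<le> X * Y" using \<open>0 \<le> X\<close> \<open>0 \<le> Y\<close> by simp
  ultimately show ?thesis using n by linarith
qed

lemma v_over_n:
  assumes "good n" "0 < i"
  shows "v i n k / real n \<le> 1 / real n + \<theta> n k"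
  using theta_power_le[OF assms, of k] assms by (simp add: v_def good_def field_simps)

text \<open>The summand 1 does not decay at all, and the other summand decays by exactly
  \<open>(1 - rate n) ^ i\<close>.\<close>

lemma v_growth: "good n \<Longrightarrow> (1 - rate n) ^ i * v i n k \<le> v i n (Suc k)"
proof -
  assume g: "good n"
  have "(1 - rate n) ^ i \<le> 1" using g by (intro power_le_one) (auto simp: good_def)
  moreover have "(1 - rate n) ^ i * v i n k = (1 - rate n) ^ i + real n * \<theta> n (Suc k) ^ i"
    by (simp add: v_def \<theta>_def distrib_left power_mult_distrib mult.left_commute)
  ultimately show ?thesis by (simp add: v_def)
qed

lemma V_growth: "good n \<Longrightarrow> (1 - rate n) ^ sum \<mu> I * V I \<mu> n k \<le> V I \<mu> n (Suc k)"
  unfolding V_def power_sum prod.distrib[symmetric]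
  by (intro prod_mono conjI v_growth mult_nonneg_nonneg) (auto simp: good_def v_pos less_imp_le)

text \<open>The factor \<theta> standing in for a word decays by \<open>1 - rate n\<close>. Lengths
  are positive, so this is no faster than the decay \<open>(1 - rate n) ^ \<mu> t\<close> granted to
  that word.\<close>

lemma E_growth:
  assumes g: "good n" and v: "valid I \<mu>"
  shows "(1 - rate n) ^ sum \<mu> I * E I \<mu> n k \<le> E I \<mu> n (Suc k)"
  unfolding E_def sum_distrib_left
proof (rule sum_mono)
  fix t assume t: "t \<in> I"
  have fin: "finite I" and pos: "0 < \<mu> t" using v t by (auto simp: valid_def)
  have p: "0 \<le> 1 - rate n" "1 - rate n \<le> 1" using g by (auto simp: good_def)
  have "(1 - rate n) ^ sum \<mu> I * (\<theta> n k * V (I - {t}) \<mu> n k) =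
    ((1 - rate n) ^ \<mu> t * \<theta> n k) * ((1 - rate n) ^ sum \<mu> (I - {t}) * V (I - {t}) \<mu> n k)"
    unfolding sum_remove_add[OF fin t, of \<mu>, symmetric] power_add by (simp only: mult_ac)
  also have "\<dots> \<le> \<theta> n (Suc k) * V (I - {t}) \<mu> n (Suc k)"
  proof (rule mult_mono)
    have "(1 - rate n) ^ \<mu> t \<le> (1 - rate n) ^ 1" using p pos by (intro power_decreasing) auto
    then show "(1 - rate n) ^ \<mu> t * \<theta> n k \<le> \<theta> n (Suc k)"
      using p by (auto simp: \<theta>_def intro!: mult_right_mono)
    show "(1 - rate n) ^ sum \<mu> (I - {t}) * V (I - {t}) \<mu> n k \<le> V (I - {t}) \<mu> n (Suc k)"
      by (rule V_growth[OF g])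
    show "0 \<le> \<theta> n (Suc k)" using g by (auto simp: good_def less_imp_le)
    show "0 \<le> (1 - rate n) ^ sum \<mu> (I - {t}) * V (I - {t}) \<mu> n k"
      using p V_pos[OF g] by (simp add: less_imp_le)
  qed
  finally show "(1 - rate n) ^ sum \<mu> I * (\<theta> n k * V (I - {t}) \<mu> n k) \<le> \<theta> n (Suc k) * V (I - {t}) \<mu> n (Suc k)" .
qed

lemma theta_V_le_E:
  assumes "good n" "finite I" "t \<in> I"
  shows "\<theta> n k * V (I - {t}) \<mu> n k \<le> E I \<mu> n k"
  unfolding E_def
  by (rule member_le_sum[OF assms(3) _ assms(2)]) (use assms(1) in \<open>auto simp: good_def less_imp_le V_pos\<close>)

lemma E_remove_le:
  assumes "good n" "finite I"
  shows "E (I - {t}) \<mu> n k \<le> E I \<mu> n k"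
proof -
  have "E (I - {t}) \<mu> n k \<le> (\<Sum>s\<in>I - {t}. \<theta> n k * V (I - {s}) \<mu> n k)"
    unfolding E_def
  proof (rule sum_mono)
    fix s
    have "I - {t} - {s} = I - {s} - {t}" by auto
    then show "\<theta> n k * V (I - {t} - {s}) \<mu> n k \<le> \<theta> n k * V (I - {s}) \<mu> n k"
      using V_remove_le[OF assms(1), of "I - {s}" t] assms by (auto simp: good_def less_imp_le intro!: mult_left_mono)
  qed
  also have "\<dots> \<le> E I \<mu> n k"
    unfolding E_def using assms
    by (intro sum_mono2) (auto simp: good_def less_imp_le V_pos)
  finally show ?thesis .
qed

text \<open>If the factor replaced by \<theta> is one of the two halves, the other half divided by
  \<open>n\<close> is at most 2, and the two cases together give 4. If it belongs to another word,
  \<open>v_cut_le\<close> applies with constant 3.\<close>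

lemma E_cut_le:
  assumes g: "good n" and v: "valid I \<mu>" and t: "t \<in> I" and f: "f \<notin> I" and r: "0 < r" "r < \<mu> t"
  shows "E (insert f I) (cut_at \<mu> t f r) n k / real n \<le> 4 * E I \<mu> n k"
proof -
  have fin: "finite I" using v by (simp add: valid_def)
  have tf: "t \<noteq> f" using t f by auto
  let ?c = "cut_at \<mu> t f r" and ?\<theta> = "\<theta> n k"
  have n: "2 \<le> real n" and th: "0 < ?\<theta>" "?\<theta> \<le> 1" using g by (auto simp: good_def)
  have small: "?\<theta> * v a n k / real n \<le> 2 * ?\<theta>" if "0 < a" for a
  proof -
    have "1 / real n \<le> 1" using n by simp
    then have "v a n k / real n \<le> 2" using v_over_n[OF g that, of k] th by linarith
    then have "?\<theta> * (v a n k / real n) \<le> ?\<theta> * 2" using th by (intro mult_left_mono) auto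
    then show ?thesis by simp
  qed
  have Vnn: "0 \<le> V J \<nu> n k" for J \<nu> using V_pos[OF g] less_imp_le by blast
  have "E (insert f I) ?c n k = ?\<theta> * V (insert f I - {f}) ?c n k + (\<Sum>s\<in>I. ?\<theta> * V (insert f I - {s}) ?c n k)"
    unfolding E_def using fin f by simp
  also have "(\<Sum>s\<in>I. ?\<theta> * V (insert f I - {s}) ?c n k) =
    ?\<theta> * V (insert f I - {t}) ?c n k + (\<Sum>s\<in>I - {t}. ?\<theta> * V (insert f I - {s}) ?c n k)"
    by (rule sum.remove[OF fin t])
  also have "V (insert f I - {f}) ?c n k = v (\<mu> t - r) n k * V (I - {t}) \<mu> n k"
  proof -
    have "insert f I - {f} = I" using f by auto
    moreover have "V I ?c n k = V I (\<mu>(t := \<mu> t - r)) n k"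
      using f by (intro V_cong) (auto simp: cut_at_def)
    ultimately show ?thesis using V_update[OF fin t] by simp
  qed
  also have "V (insert f I - {t}) ?c n k = v r n k * V (I - {t}) \<mu> n k"
  proof -
    have "insert f I - {t} = insert f (I - {t})" using tf by auto
    moreover have "V (insert f (I - {t})) ?c n k = v r n k * V (I - {t}) ?c n k"
      using f fin by (simp add: V_def cut_at_def)
    moreover have "V (I - {t}) ?c n k = V (I - {t}) \<mu> n k"
      using f by (intro V_cong) (auto simp: cut_at_def)
    ultimately show ?thesis by simp
  qed
  finally have eq: "E (insert f I) ?c n k / real n = ?\<theta> * v (\<mu> t - r) n k / real n * V (I - {t}) \<mu> n k +
    ?\<theta> * v r n k / real n * V (I - {t}) \<mu> n k + (\<Sum>s\<in>I - {t}. ?\<theta> * V (insert f I - {s}) ?c n k / real n)"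
    by (simp add: add_divide_distrib sum_divide_distrib)
  have "?\<theta> * v (\<mu> t - r) n k / real n * V (I - {t}) \<mu> n k \<le> 2 * ?\<theta> * V (I - {t}) \<mu> n k"
    using small[of "\<mu> t - r"] r Vnn by (intro mult_right_mono) auto
  moreover have "?\<theta> * v r n k / real n * V (I - {t}) \<mu> n k \<le> 2 * ?\<theta> * V (I - {t}) \<mu> n k"
    using small[of r] r Vnn by (intro mult_right_mono) auto
  moreover have "(\<Sum>s\<in>I - {t}. ?\<theta> * V (insert f I - {s}) ?c n k / real n) \<le> (\<Sum>s\<in>I - {t}. 4 * (?\<theta> * V (I - {s}) \<mu> n k))"
  proof (rule sum_mono)
    fix s assume s: "s \<in> I - {t}"
    have ins: "insert f I - {s} = insert f (I - {s})" using s f by auto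
    have "V (insert f I - {s}) ?c n k = v r n k * (v (\<mu> t - r) n k * V (I - {s} - {t}) \<mu> n k)"
      unfolding ins using fin s t f by (intro V_cut) auto
    also have "\<dots> = v r n k * v (\<mu> t - r) n k * V (I - {s} - {t}) \<mu> n k" by simp
    also have "\<dots> \<le> 3 * real n * v (r + (\<mu> t - r)) n k * V (I - {s} - {t}) \<mu> n k"
      using v_cut_le[OF g] Vnn by (intro mult_right_mono) auto
    also have "\<dots> = 3 * real n * V (I - {s}) \<mu> n k"
      using V_remove[of "I - {s}" t \<mu> n k] fin s t r by simp
    finally have "V (insert f I - {s}) ?c n k / real n \<le> 3 * V (I - {s}) \<mu> n k"
      using n by (simp add: divide_le_eq mult_ac)
    also have "\<dots> \<le> 4 * V (I - {s}) \<mu> n k" using Vnn by simp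
    finally have "?\<theta> * (V (insert f I - {s}) ?c n k / real n) \<le> ?\<theta> * (4 * V (I - {s}) \<mu> n k)"
      using th by (intro mult_left_mono) auto
    then show "?\<theta> * V (insert f I - {s}) ?c n k / real n \<le> 4 * (?\<theta> * V (I - {s}) \<mu> n k)" by simp
  qed
  ultimately have "E (insert f I) ?c n k / real n \<le> 4 * (?\<theta> * V (I - {t}) \<mu> n k) + (\<Sum>s\<in>I - {t}. 4 * (?\<theta> * V (I - {s}) \<mu> n k))"
    unfolding eq by linarith
  also have "\<dots> = 4 * E I \<mu> n k"
    unfolding E_def sum_distrib_left by (rule sum.remove[OF fin t, symmetric])
  finally show ?thesis .
qed

lemma dominated_over_n: "f \<preceq> g \<Longrightarrow> (\<lambda>n k. f n k / real n) \<preceq> (\<lambda>n k. g n k / real n)"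
  using dominated_mult[OF _ dominated_refl[of "\<lambda>n k. 1 / real n"], of f g] by simp

lemma v_over_n_dominated: "0 < i \<Longrightarrow> (\<lambda>n k. v i n k / real n) \<preceq> \<theta>"
proof -
  assume "0 < i"
  have "(\<lambda>n k. 1 / real n + \<theta> n k) \<preceq> \<theta>"
    by (intro dominated_add inverse_dominated_theta dominated_refl eventually_goodI) (auto simp: good_def less_imp_le)
  then show ?thesis
  proof (rule dominated_le, intro eventually_goodI)
    fix n k assume g: "good n"
    have "0 \<le> v i n k / real n" using v_pos[OF g, of i k] by simp
    then show "\<bar>v i n k / real n\<bar> \<le> \<bar>1 / real n + \<theta> n k\<bar>"
      using v_over_n[OF g \<open>0 < i\<close>, of k] by linarith
  qed
qed

lemma V_dominated_refl: "V I \<mu> \<preceq> V I \<mu>"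
  by (intro dominated_refl eventually_goodI less_imp_le V_pos)

text \<open>Division by \<open>n\<close> turns a factor \<open>v i\<close> into \<theta> up to
  logarithms, which is precisely the exchange made in \<open>E\<close>. Errors with coefficient
  \<open>1 / n\<close> are charged to \<open>E\<close> in this way.\<close>

lemma vV_over_n_dominated:
  assumes "finite I" "t \<in> I" "0 < i"
  shows "(\<lambda>n k. v i n k * V (I - {t}) \<mu> n k / real n) \<preceq> E I \<mu>"
proof -
  have "(\<lambda>n k. v i n k / real n * V (I - {t}) \<mu> n k) \<preceq> (\<lambda>n k. \<theta> n k * V (I - {t}) \<mu> n k)"
    by (intro dominated_mult v_over_n_dominated assms V_dominated_refl)
  then have "(\<lambda>n k. v i n k / real n * V (I - {t}) \<mu> n k) \<preceq> E I \<mu>"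
    by (rule dominated_ge) (intro eventually_goodI impI theta_V_le_E assms)
  then show ?thesis by simp
qed

end

lemma cuts_cut_at: "cuts f M I \<mu> = (\<Sum>t\<in>I. \<Sum>v<\<mu> t. \<Sum>u<v. M (insert f I) (cut_at \<mu> t f (v - u)))"
  by (simp add: cuts_def cut_at_def)

text \<open>\<open>2 * sum \<mu> I - card I\<close> orders the inductions on families: a removal
  lowers it by \<open>2 * \<mu> t - 1\<close>, and a cut by 1. Positive lengths give
  \<open>card I \<le> sum \<mu> I\<close>, so the subtraction does not truncate.\<close>

lemma rank_remove:
  assumes "valid I \<mu>" "t \<in> I"
  shows "2 * sum \<mu> (I - {t}) - card (I - {t}) < 2 * sum \<mu> I - card I"
proof -
  have fin: "finite I" and "0 < \<mu> t" using assms by (auto simp: valid_def)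
  moreover have "card (I - {t}) \<le> sum \<mu> (I - {t})" by (rule card_le_sum[OF valid_remove[OF assms(1)]])
  moreover have "card I = Suc (card (I - {t}))" by (rule card.remove[OF fin assms(2)])
  moreover note sum_remove_add[OF fin assms(2), of \<mu>]
  ultimately show ?thesis by linarith
qed

lemma rank_cut:
  assumes "valid I \<mu>" "t \<in> I" "f \<notin> I" "0 < r" "r < \<mu> t"
  shows "2 * sum (cut_at \<mu> t f r) (insert f I) - card (insert f I) < 2 * sum \<mu> I - card I"
proof -
  have fin: "finite I" using assms by (auto simp: valid_def)
  have "card (insert f I) \<le> sum (cut_at \<mu> t f r) (insert f I)"
    by (rule card_le_sum[OF valid_cut]) (use assms in auto)
  moreover have "card (insert f I) = Suc (card I)" using fin assms by simp
  moreover note sum_cut[where \<mu> = \<mu>, OF fin assms(2,3,5)]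
  ultimately show ?thesis by linarith
qed

context time_window
begin

abbreviation mean :: "nat set \<Rightarrow> (nat \<Rightarrow> nat) \<Rightarrow> nat \<Rightarrow> nat \<Rightarrow> real" where
  "mean I \<mu> n k \<equiv> mean_count n k I \<mu>"

definition remainder :: "nat set \<Rightarrow> (nat \<Rightarrow> nat) \<Rightarrow> nat \<Rightarrow> nat \<Rightarrow> real" where
  "remainder I \<mu> n k = (real (sum \<mu> I * (sum \<mu> I + 1)) * mean_count n k I \<mu> +
     shortened (mean_count n k) I \<mu> + joins (mean_count n k) I \<mu>) / real n"

lemma remainder_dominated:
  assumes v: "valid I \<mu>" and g: "\<forall>\<^sub>F n in sequentially. \<forall>k\<le>T n. 0 \<le> g n k"
    and self: "(\<lambda>n k. mean I \<mu> n k / real n) \<preceq> g"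
    and remove: "\<And>t. t \<in> I \<Longrightarrow> (\<lambda>n k. mean (I - {t}) \<mu> n k / real n) \<preceq> g"
    and short: "\<And>t r. t \<in> I \<Longrightarrow> 0 < r \<Longrightarrow> r \<le> \<mu> t \<Longrightarrow> (\<lambda>n k. mean I (\<mu>(t := r)) n k / real n) \<preceq> g"
    and join: "\<And>t t'. t \<in> I \<Longrightarrow> t' \<in> I \<Longrightarrow> t \<noteq> t' \<Longrightarrow>
      (\<lambda>n k. mean (I - {t'}) (\<mu>(t := \<mu> t + \<mu> t')) n k / real n) \<preceq> g"
  shows "remainder I \<mu> \<preceq> g"
proof -
  have "(\<lambda>n k. real (sum \<mu> I * (sum \<mu> I + 1)) * (mean I \<mu> n k / real n) +
    (\<Sum>t\<in>I. real (\<mu> t) * (real (sum \<mu> I) * (mean (I - {t}) \<mu> n k / real n) + (\<Sum>r=1..\<mu> t. mean I (\<mu>(t := r)) n k / real n))) +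
    (\<Sum>t\<in>I. \<Sum>t'\<in>I - {t}. real (\<mu> t) * (real (\<mu> t') * (mean (I - {t'}) (\<mu>(t := \<mu> t + \<mu> t')) n k / real n)))) \<preceq> g"
    by (intro dominated_add dominated_sum dominated_cmult g self remove short join) auto
  then show ?thesis
    unfolding remainder_def shortened_def joins_def
    by (simp only: add_divide_distrib sum_divide_distrib times_divide_eq_right[symmetric])
qed

lemma drift_remainder:
  assumes v: "valid I \<mu>" and f: "f \<notin> I"
  shows "\<forall>\<^sub>F n in sequentially. \<forall>k\<le>T n.
    \<bar>(mean I \<mu> n (Suc k) - (1 - rate n * real (sum \<mu> I)) * mean I \<mu> n k) / rate n -
      (outs (mean_count n k) I \<mu> + cuts f (mean_count n k) I \<mu> / real n)\<bar> \<le> \<bar>remainder I \<mu> n k\<bar>"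
  using eventually_ge_at_top[of "max 2 (sum \<mu> I + 1)"]
proof eventually_elim
  case (elim n)
  show ?case
  proof (intro allI impI)
    fix k
    have "finite I" using v by (simp add: valid_def)
    moreover have "sum \<mu> I + 1 \<le> n" "2 \<le> n" using elim by simp_all
    ultimately show "\<bar>(mean I \<mu> n (Suc k) - (1 - rate n * real (sum \<mu> I)) * mean I \<mu> n k) / rate n -
      (outs (mean_count n k) I \<mu> + cuts f (mean_count n k) I \<mu> / real n)\<bar> \<le> \<bar>remainder I \<mu> n k\<bar>"
      unfolding remainder_def using f by (intro order_trans[OF mean_count_drift abs_ge_self])
  qed
qed

lemma outs_dominated:
  assumes "\<And>t. t \<in> I \<Longrightarrow> M (I - {t}) \<mu> \<preceq> g" "\<forall>\<^sub>F n in sequentially. \<forall>k\<le>T n. 0 \<le> g n k"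
  shows "(\<lambda>n k. outs (\<lambda>I \<mu>. M I \<mu> n k) I \<mu>) \<preceq> g"
  unfolding outs_def by (intro dominated_sum dominated_cmult assms)

lemma cuts_dominated:
  assumes "\<And>t r. t \<in> I \<Longrightarrow> 0 < r \<Longrightarrow> r < \<mu> t \<Longrightarrow> (\<lambda>n k. M (insert f I) (cut_at \<mu> t f r) n k / real n) \<preceq> g"
    and "\<forall>\<^sub>F n in sequentially. \<forall>k\<le>T n. 0 \<le> g n k"
  shows "(\<lambda>n k. cuts f (\<lambda>I \<mu>. M I \<mu> n k) I \<mu> / real n) \<preceq> g"
  unfolding cuts_cut_at sum_divide_distrib by (intro dominated_sum assms) auto

text \<open>
  The trivial bound \<open>n ^ card I\<close> exceeds \<open>V\<close> by at most a power \<open>n ^ q\<close>. A join gains a factor \<open>1 / n\<close>,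
  so the bound with exponent \<open>Suc q\<close> suffices for the joined families to lower the exponent to \<open>q\<close>;
  the families obtained by a removal or a cut precede \<open>\<mu>\<close> in the order of induction.
\<close>

lemma mean_dominated_step:
  assumes IH: "\<And>I \<mu>. valid I \<mu> \<Longrightarrow> sum \<mu> I \<le> D \<Longrightarrow> mean I \<mu> \<preceq> (\<lambda>n k. real n ^ Suc q * V I \<mu> n k)"
    and "valid I \<mu>" "sum \<mu> I \<le> D"
  shows "mean I \<mu> \<preceq> (\<lambda>n k. real n ^ q * V I \<mu> n k)"
  using assms(2,3)
proof (induction "2 * sum \<mu> I - card I" arbitrary: I \<mu> rule: less_induct)
  case less
  let ?g = "\<lambda>n k. real n ^ q * V I \<mu> n k"
  have v: "valid I \<mu>" and fin: "finite I" and le: "sum \<mu> I \<le> D" using less.prems by (auto simp: valid_def)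
  obtain f where f: "f \<notin> I" using ex_new_if_finite[OF infinite_UNIV_nat fin] by blast
  have g: "\<forall>\<^sub>F n in sequentially. \<forall>k\<le>T n. 0 \<le> ?g n k"
    by (intro eventually_goodI mult_nonneg_nonneg) (auto simp: V_pos less_imp_le)
  have up: "(\<lambda>n k. M n k / real n) \<preceq> ?g"
    if M: "M \<preceq> (\<lambda>n k. real n ^ Suc q * W n k)" and W: "\<And>n k. good n \<Longrightarrow> W n k \<le> V I \<mu> n k" for M W
  proof (rule dominated_ge[OF dominated_over_n[OF M]], intro eventually_goodI impI)
    fix n k assume n: "good n"
    have "real n ^ Suc q * W n k / real n = real n ^ q * W n k" using n by (simp add: good_def)
    also have "\<dots> \<le> ?g n k" using W[OF n] by (intro mult_left_mono) auto
    finally show "real n ^ Suc q * W n k / real n \<le> ?g n k" .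
  qed
  have remove: "mean (I - {t}) \<mu> \<preceq> ?g" if t: "t \<in> I" for t
  proof (rule dominated_ge)
    have "sum \<mu> (I - {t}) \<le> D" using sum_remove_add[OF fin t, of \<mu>] le by linarith
    then show "mean (I - {t}) \<mu> \<preceq> (\<lambda>n k. real n ^ q * V (I - {t}) \<mu> n k)"
      using less.hyps[OF rank_remove[OF v t] valid_remove[OF v]] by blast
    show "\<forall>\<^sub>F n in sequentially. \<forall>k\<le>T n. 0 \<le> real n ^ q * V (I - {t}) \<mu> n k \<longrightarrow> real n ^ q * V (I - {t}) \<mu> n k \<le> ?g n k"
      by (intro eventually_goodI impI mult_left_mono V_remove_le fin) auto
  qed
  have cut: "(\<lambda>n k. mean (insert f I) (cut_at \<mu> t f r) n k / real n) \<preceq> ?g" if t: "t \<in> I" and r: "0 < r" "r < \<mu> t" for t r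
  proof -
    have "sum (cut_at \<mu> t f r) (insert f I) \<le> D" using sum_cut[where \<mu> = \<mu>, OF fin t f r(2)] le by simp
    then have "mean (insert f I) (cut_at \<mu> t f r) \<preceq> (\<lambda>n k. real n ^ q * V (insert f I) (cut_at \<mu> t f r) n k)"
      using less.hyps[OF rank_cut[OF v t f r] valid_cut[OF v t f r]] by blast
    from dominated_over_n[OF this]
    have "(\<lambda>n k. mean (insert f I) (cut_at \<mu> t f r) n k / real n) \<preceq> (\<lambda>n k. 3 * ?g n k)"
    proof (rule dominated_ge, intro eventually_goodI impI)
      fix n k assume n: "good n"
      have "V (insert f I) (cut_at \<mu> t f r) n k = v r n k * v (\<mu> t - r) n k * V (I - {t}) \<mu> n k"
        by (simp add: V_cut[OF fin t f])
      also have "\<dots> \<le> 3 * real n * v (r + (\<mu> t - r)) n k * V (I - {t}) \<mu> n k"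
        using V_pos[OF n, of "I - {t}" \<mu> k] by (intro mult_right_mono v_cut_le n) auto
      also have "\<dots> = 3 * real n * V I \<mu> n k" using V_remove[OF fin t, of \<mu> n k] r by simp
      finally have "V (insert f I) (cut_at \<mu> t f r) n k / real n \<le> 3 * V I \<mu> n k"
        using n by (simp add: good_def divide_le_eq mult_ac)
      then have "real n ^ q * (V (insert f I) (cut_at \<mu> t f r) n k / real n) \<le> real n ^ q * (3 * V I \<mu> n k)"
        by (intro mult_left_mono) auto
      then show "real n ^ q * V (insert f I) (cut_at \<mu> t f r) n k / real n \<le> 3 * ?g n k" by simp
    qed
    also have "(\<lambda>n k. 3 * ?g n k) \<preceq> ?g" by (intro dominated_cmult dominated_refl g)
    finally show ?thesis .
  qed
  have "remainder I \<mu> \<preceq> ?g"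
  proof (rule remainder_dominated[OF v g])
    show "(\<lambda>n k. mean I \<mu> n k / real n) \<preceq> ?g" by (rule up[OF IH[OF v le]]) simp
  next
    fix t assume t: "t \<in> I"
    have "sum \<mu> (I - {t}) \<le> D" using sum_remove_add[OF fin t, of \<mu>] le by linarith
    then show "(\<lambda>n k. mean (I - {t}) \<mu> n k / real n) \<preceq> ?g"
      by (intro up[OF IH[OF valid_remove[OF v]]] V_remove_le fin)
  next
    fix t r assume t: "t \<in> I" and r: "0 < r" "r \<le> \<mu> t"
    \<comment> \<open>The induction hypothesis for the shortened family would bring the profile
      \<open>v r\<close>, which is larger than \<open>v (\<mu> t)\<close>. Instead, one word costs
      at most a factor \<open>n\<close>, which cancels \<open>1 / n\<close> and leaves the family
      without \<open>t\<close>.\<close>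
    show "(\<lambda>n k. mean I (\<mu>(t := r)) n k / real n) \<preceq> ?g"
    proof (rule dominated_le[OF remove[OF t]], intro eventually_goodI)
      fix n k assume n: "good n"
      have eq: "mean (I - {t}) (\<mu>(t := r)) n k = mean (I - {t}) \<mu> n k"
        by (rule mean_count_cong) auto
      have "mean I (\<mu>(t := r)) n k \<le> real n * mean (I - {t}) (\<mu>(t := r)) n k"
        using fin t r n by (intro mean_count_remove_le) (auto simp: good_def)
      then have "mean I (\<mu>(t := r)) n k / real n \<le> mean (I - {t}) \<mu> n k"
        unfolding eq using n by (simp only: good_def) (simp add: divide_le_eq mult.commute)
      then show "\<bar>mean I (\<mu>(t := r)) n k / real n\<bar> \<le> \<bar>mean (I - {t}) \<mu> n k\<bar>"
        using mean_count_nonneg[of n k I "\<mu>(t := r)"] mean_count_nonneg[of n k "I - {t}" \<mu>] by simp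
    qed
  next
    fix t t' assume t: "t \<in> I" "t' \<in> I" "t \<noteq> t'"
    have "sum (\<mu>(t := \<mu> t + \<mu> t')) (I - {t'}) \<le> D" using sum_join[OF fin t, of \<mu>] le by simp
    then show "(\<lambda>n k. mean (I - {t'}) (\<mu>(t := \<mu> t + \<mu> t')) n k / real n) \<preceq> ?g"
    proof (intro up[OF IH[OF valid_join[OF v t(1)]]])
      fix n k assume n: "good n"
      have "V (I - {t'}) (\<mu>(t := \<mu> t + \<mu> t')) n k = v (\<mu> t + \<mu> t') n k * V (I - {t} - {t'}) \<mu> n k"
        by (rule V_join[OF fin t])
      also have "\<dots> \<le> v (\<mu> t) n k * V (I - {t}) \<mu> n k"
        using n fin by (intro mult_mono v_mono V_remove_le) (auto simp: v_pos V_pos less_imp_le)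
      also have "\<dots> = V I \<mu> n k" by (rule V_remove[OF fin t(1), symmetric])
      finally show "V (I - {t'}) (\<mu>(t := \<mu> t + \<mu> t')) n k \<le> V I \<mu> n k" .
    qed
  qed
  then have rem: "(\<lambda>n k. (mean I \<mu> n (Suc k) - (1 - rate n * real (sum \<mu> I)) * mean I \<mu> n k) / rate n -
      (outs (mean_count n k) I \<mu> + cuts f (mean_count n k) I \<mu> / real n)) \<preceq> ?g"
    by (rule dominated_le[OF _ drift_remainder[OF v f]])
  have "(\<lambda>n k. outs (mean_count n k) I \<mu> + cuts f (mean_count n k) I \<mu> / real n) \<preceq> ?g"
    using outs_dominated[of I "mean", OF remove g] cuts_dominated[of I \<mu> "mean" f, OF cut g]
    by (intro dominated_add)
  from dominated_add[OF this rem]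
  have drift: "(\<lambda>n k. (mean I \<mu> n (Suc k) - (1 - rate n * real (sum \<mu> I)) * mean I \<mu> n k) / rate n) \<preceq> ?g"
    by simp
  show ?case
  proof (rule dominated_evolution[OF _ drift])
    show "(\<lambda>n k. mean I \<mu> n 0) \<preceq> (\<lambda>n k. ?g n 0)"
    proof (rule dominatedI, intro eventually_goodI)
      fix n k :: nat assume n: "good n"
      have "mean I \<mu> n 0 \<le> real n ^ card I"
        using v n by (intro mean_count_le_power) (auto simp: valid_def good_def)
      also have "\<dots> \<le> (\<Prod>t\<in>I. v (\<mu> t) n 0)"
        unfolding prod_constant[symmetric] by (intro prod_mono) (simp add: v_def \<theta>_def)
      also have "\<dots> = 1 * V I \<mu> n 0" by (simp add: V_def)
      also have "\<dots> \<le> ?g n 0"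
        using n V_pos[OF n, of I \<mu> 0] by (intro mult_right_mono one_le_power) (auto simp: good_def)
      finally show "\<bar>mean I \<mu> n 0\<bar> \<le> ?g n 0" using mean_count_nonneg[of n 0 I \<mu>] by simp
    qed
    show "\<forall>\<^sub>F n in sequentially. \<forall>k<T n. (1 - rate n) ^ sum \<mu> I * ?g n k \<le> ?g n (Suc k)"
      using eventually_good
    proof eventually_elim
      case (elim n)
      show ?case
      proof (intro allI impI)
        fix k
        have "real n ^ q * ((1 - rate n) ^ sum \<mu> I * V I \<mu> n k) \<le> real n ^ q * V I \<mu> n (Suc k)"
          by (intro mult_left_mono V_growth elim) auto
        then show "(1 - rate n) ^ sum \<mu> I * ?g n k \<le> ?g n (Suc k)" by (simp add: mult.left_commute)
      qed
    qed
  qed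
qed

text \<open>Downward induction on the excess power of \<open>n\<close>. It starts at
  \<open>D = sum \<mu> I\<close>, where the trivial bound suffices, and treats all families with at
  most \<open>D\<close> points at once, a class closed under removals, cuts and joins.\<close>

lemma mean_dominated:
  assumes "valid I \<mu>"
  shows "mean I \<mu> \<preceq> V I \<mu>"
proof -
  define D where "D = sum \<mu> I"
  have "\<forall>I \<mu>. valid I \<mu> \<longrightarrow> sum \<mu> I \<le> D \<longrightarrow> mean I \<mu> \<preceq> (\<lambda>n k. real n ^ 0 * V I \<mu> n k)"
  proof (rule inc_induct[of 0 D], simp)
    show "\<forall>I \<mu>. valid I \<mu> \<longrightarrow> sum \<mu> I \<le> D \<longrightarrow> mean I \<mu> \<preceq> (\<lambda>n k. real n ^ D * V I \<mu> n k)"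
    proof (intro allI impI dominatedI eventually_goodI)
      fix I \<mu> and n k :: nat assume v: "valid I \<mu>" "sum \<mu> I \<le> D" and n: "good n"
      have "mean I \<mu> n k \<le> real n ^ card I"
        using v n by (intro mean_count_le_power) (auto simp: valid_def good_def)
      also have "\<dots> \<le> real n ^ D"
        using card_le_sum[OF v(1)] v(2) n by (intro power_increasing) (auto simp: good_def)
      also have "\<dots> \<le> real n ^ D * V I \<mu> n k"
        using V_ge_1[OF n, of I \<mu> k] mult_left_mono[of 1 "V I \<mu> n k" "real n ^ D"] by simp
      finally show "\<bar>mean I \<mu> n k\<bar> \<le> real n ^ D * V I \<mu> n k" using mean_count_nonneg[of n k I \<mu>] by simp
    qed
  next
    fix q assume IH: "\<forall>I \<mu>. valid I \<mu> \<longrightarrow> sum \<mu> I \<le> D \<longrightarrow> mean I \<mu> \<preceq> (\<lambda>n k. real n ^ Suc q * V I \<mu> n k)"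
    show "\<forall>I \<mu>. valid I \<mu> \<longrightarrow> sum \<mu> I \<le> D \<longrightarrow> mean I \<mu> \<preceq> (\<lambda>n k. real n ^ q * V I \<mu> n k)"
      using mean_dominated_step[of D q] IH by blast
  qed
  then show ?thesis using assms by (auto simp: D_def)
qed

end

section \<open>The approximating product\<close>

lemma one_minus_power_taylor:
  fixes p :: real
  assumes "0 \<le> p" "p \<le> 1"
  shows "\<bar>(1 - p) ^ i - 1 + real i * p\<bar> \<le> real i ^ 2 * p ^ 2"
proof (induction i)
  case (Suc i)
  have "(1 - p) ^ Suc i - 1 + real (Suc i) * p = (1 - p) * ((1 - p) ^ i - 1 + real i * p) + real i * p ^ 2"
    by (simp add: algebra_simps power2_eq_square)
  then have "\<bar>(1 - p) ^ Suc i - 1 + real (Suc i) * p\<bar> \<le> \<bar>(1 - p) * ((1 - p) ^ i - 1 + real i * p)\<bar> + \<bar>real i * p ^ 2\<bar>"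
    by (simp only: abs_triangle_ineq)
  also have "\<dots> = (1 - p) * \<bar>(1 - p) ^ i - 1 + real i * p\<bar> + real i * p ^ 2"
    using assms by (simp add: abs_mult)
  also have "\<dots> \<le> 1 * (real i ^ 2 * p ^ 2) + real i * p ^ 2"
    using assms Suc by (intro add_right_mono mult_mono) auto
  also have "\<dots> \<le> real (Suc i) ^ 2 * p ^ 2"
  proof -
    have "real i ^ 2 + real i \<le> real (Suc i) ^ 2" by (simp add: power2_eq_square algebra_simps)
    then have "(real i ^ 2 + real i) * p ^ 2 \<le> real (Suc i) ^ 2 * p ^ 2" by (intro mult_right_mono) auto
    then show ?thesis by (simp add: distrib_right)
  qed
  finally show ?case .
qed simp

lemma power_add_taylor:
  fixes p y :: real
  assumes "0 \<le> p" "p \<le> 1" "0 \<le> y"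
  shows "\<bar>(y + p) ^ m - y ^ m - real m * p * y ^ (m - 1)\<bar> \<le> real m ^ 2 * p ^ 2 * (1 + y) ^ m"
proof (induction m)
  case (Suc m)
  define r where "r = (y + p) ^ m - y ^ m - real m * p * y ^ (m - 1)"
  have yy: "real m * (y * y ^ (m - 1)) = real m * y ^ m" by (cases m) auto
  have "(y + p) ^ Suc m - y ^ Suc m - real (Suc m) * p * y ^ (Suc m - 1) =
    (y + p) * r + real m * p ^ 2 * y ^ (m - 1) + p * (real m * (y * y ^ (m - 1)) - real m * y ^ m)"
    unfolding r_def by (simp add: algebra_simps power2_eq_square)
  then have eq: "(y + p) ^ Suc m - y ^ Suc m - real (Suc m) * p * y ^ (Suc m - 1) =
    (y + p) * r + real m * p ^ 2 * y ^ (m - 1)" unfolding yy by simp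
  have "y ^ (m - 1) \<le> (1 + y) ^ (m - 1)" using assms by (intro power_mono) auto
  also have "\<dots> \<le> (1 + y) ^ Suc m" using assms by (intro power_increasing) auto
  finally have y: "y ^ (m - 1) \<le> (1 + y) ^ Suc m" .
  have "\<bar>(y + p) * r + real m * p ^ 2 * y ^ (m - 1)\<bar> \<le> \<bar>(y + p) * r\<bar> + \<bar>real m * p ^ 2 * y ^ (m - 1)\<bar>"
    by (rule abs_triangle_ineq)
  also have "\<bar>(y + p) * r\<bar> \<le> (1 + y) * (real m ^ 2 * p ^ 2 * (1 + y) ^ m)"
    unfolding abs_mult using assms Suc by (intro mult_mono) (auto simp: r_def)
  also have "\<bar>real m * p ^ 2 * y ^ (m - 1)\<bar> \<le> real m * p ^ 2 * (1 + y) ^ Suc m"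
    using assms y by (simp add: abs_mult mult_left_mono)
  also have "(1 + y) * (real m ^ 2 * p ^ 2 * (1 + y) ^ m) + real m * p ^ 2 * (1 + y) ^ Suc m =
    (real m ^ 2 + real m) * (p ^ 2 * (1 + y) ^ Suc m)" by (simp add: algebra_simps)
  also have "\<dots> \<le> real (Suc m) ^ 2 * (p ^ 2 * (1 + y) ^ Suc m)"
    using assms by (intro mult_right_mono) (auto simp: power2_eq_square algebra_simps)
  finally show ?case unfolding eq by (simp add: mult.assoc)
qed simp

text \<open>One step \<open>p\<close> of the discrete form of \<open>exp (- i * y) * y ^ m\<close>,
  relative to its exponential factor, against the derivative
  \<open>- i * y ^ m + m * y ^ (m - 1)\<close>. The three summands of the constant bound the
  remainders of the two factors and the product of their linear terms.\<close>

lemma product_taylor: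
  fixes p y :: real
  assumes "0 \<le> p" "p \<le> 1" "0 \<le> y"
  shows "\<bar>(1 - p) ^ i * (y + p) ^ m - y ^ m + real i * p * y ^ m - real m * p * y ^ (m - 1)\<bar>
    \<le> (real i ^ 2 + (1 + real i) * real m ^ 2 + real i * real m) * (p ^ 2 * (1 + y) ^ m)"
proof -
  let ?z = "p ^ 2 * (1 + y) ^ m"
  have "(1 - p) ^ i * (y + p) ^ m - y ^ m + real i * p * y ^ m - real m * p * y ^ (m - 1) =
    ((1 - p) ^ i - 1 + real i * p) * (y + p) ^ m +
    (1 - real i * p) * ((y + p) ^ m - y ^ m - real m * p * y ^ (m - 1)) - real i * real m * p ^ 2 * y ^ (m - 1)"
    by (simp add: algebra_simps power2_eq_square)
  moreover have "\<bar>((1 - p) ^ i - 1 + real i * p) * (y + p) ^ m\<bar> \<le> (real i ^ 2 * p ^ 2) * (1 + y) ^ m"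
    unfolding abs_mult using assms one_minus_power_taylor[OF assms(1,2), of i]
    by (intro mult_mono) (auto simp: power_abs intro!: power_mono)
  moreover have "\<bar>(1 - real i * p) * ((y + p) ^ m - y ^ m - real m * p * y ^ (m - 1))\<bar> \<le>
    (1 + real i) * (real m ^ 2 * p ^ 2 * (1 + y) ^ m)"
  proof -
    have "\<bar>1 - real i * p\<bar> \<le> 1 + real i"
      using assms mult_left_le[of p "real i"] by (simp add: abs_le_iff) (smt (verit) mult_nonneg_nonneg of_nat_0_le_iff)
    then show ?thesis
      unfolding abs_mult using power_add_taylor[OF assms, of m] by (intro mult_mono) auto
  qed
  moreover have "\<bar>real i * real m * p ^ 2 * y ^ (m - 1)\<bar> \<le> real i * real m * p ^ 2 * (1 + y) ^ m"
  proof -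
    have "y ^ (m - 1) \<le> (1 + y) ^ (m - 1)" using assms by (intro power_mono) auto
    also have "\<dots> \<le> (1 + y) ^ m" using assms by (intro power_increasing) auto
    finally show ?thesis using assms by (simp add: abs_mult mult_left_mono)
  qed
  ultimately have "\<bar>(1 - p) ^ i * (y + p) ^ m - y ^ m + real i * p * y ^ m - real m * p * y ^ (m - 1)\<bar> \<le>
    (real i ^ 2 * p ^ 2) * (1 + y) ^ m + (1 + real i) * (real m ^ 2 * p ^ 2 * (1 + y) ^ m) + real i * real m * p ^ 2 * (1 + y) ^ m"
    by linarith
  then show ?thesis by (simp add: algebra_simps)
qed

context time_window
begin

text \<open>
  \<open>tree_weight i\<close> is \<open>i / i!\<close> times Cayley's number \<open>i ^ (i - 2)\<close> of trees on \<open>i\<close> points.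
\<close>

definition tree :: "nat \<Rightarrow> nat \<Rightarrow> nat \<Rightarrow> real" where
  "tree i n k = tree_weight i * (real n * \<theta> n k ^ i * (rate n * real k) ^ (i - 1))"

definition b :: "nat \<Rightarrow> nat \<Rightarrow> nat \<Rightarrow> real" where "b i n k = 1 + tree i n k"

definition B :: "nat set \<Rightarrow> (nat \<Rightarrow> nat) \<Rightarrow> nat \<Rightarrow> nat \<Rightarrow> real" where
  "B I \<mu> n k = (\<Prod>t\<in>I. b (\<mu> t) n k)"

definition gain :: "nat \<Rightarrow> nat \<Rightarrow> nat \<Rightarrow> real" where
  "gain i n k = b i n (Suc k) - b i n k"

text \<open>The equation for a single length \<open>i\<close>, per unit of time, has a decay at rate
  \<open>i\<close>, a source \<open>i\<close> from the removal of the word and a quadratic source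
  from its cuts. \<open>defect\<close> is the amount by which \<open>b i\<close> fails to satisfy
  it.\<close>

definition defect :: "nat \<Rightarrow> nat \<Rightarrow> nat \<Rightarrow> real" where
  "defect i n k = gain i n k / rate n + real i * b i n k - real i -
     (\<Sum>v<i. \<Sum>u<v. b (v - u) n k * b (i - (v - u)) n k / real n)"

lemma theta_dominated_refl: "\<theta> \<preceq> \<theta>"
  by (intro dominated_refl eventually_goodI) (auto simp: good_def less_imp_le)

lemma tree_dominated: "tree i \<preceq> (\<lambda>n k. real n * \<theta> n k ^ i)"
proof -
  have "(\<lambda>n k. real n * \<theta> n k ^ i) \<preceq> (\<lambda>n k. real n * \<theta> n k ^ i)"
    by (intro dominated_refl eventually_goodI) (auto simp: good_def less_imp_le)
  from dominated_cmult[OF dominated_mult[OF this dominated_power[OF time_dominated, of "i - 1"]], of "tree_weight i"]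
  show ?thesis unfolding tree_def by simp
qed

lemma tree_over_n_dominated:
  assumes "0 < i"
  shows "(\<lambda>n k. tree i n k / real n) \<preceq> \<theta>"
proof (rule dominated_ge[OF dominated_over_n[OF tree_dominated]], intro eventually_goodI impI)
  fix n k assume "good n"
  then show "real n * \<theta> n k ^ i / real n \<le> \<theta> n k"
    using theta_power_le[OF _ assms, of n k] by (simp add: good_def)
qed

lemma v_dominated_refl: "v i \<preceq> v i"
  by (intro dominated_refl eventually_goodI less_imp_le v_pos)

lemma one_dominated_v: "(\<lambda>n k. 1) \<preceq> v i"
  by (rule dominatedI, intro eventually_goodI) (simp add: v_ge_1)

lemma b_dominated: "b i \<preceq> v i"
proof -
  have "tree i \<preceq> v i"
    by (rule dominated_ge[OF tree_dominated]) (intro eventually_goodI impI, simp add: v_def)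
  from dominated_add[OF one_dominated_v this] show ?thesis unfolding b_def .
qed

lemma B_dominated: "B I \<mu> \<preceq> V I \<mu>"
  unfolding B_def V_def by (intro dominated_prod b_dominated)

text \<open>In \<open>b * b / n\<close> the products \<open>tree * tree / n\<close> sum, by
  \<open>tree_weight_recurrence\<close>, to the term coming from the derivative of
  \<open>(rate n * k) ^ (i - 1)\<close>. It is subtracted from the increment and leaves the
  discretisation error; the terms \<open>1 / n\<close> and \<open>tree / n\<close> remain beside
  it.\<close>

lemma defect_eq:
  assumes n: "good n" and i: "0 < i"
  shows "defect i n k = tree_weight i * (real n * \<theta> n k ^ i) *
      (((1 - rate n) ^ i * (rate n * real k + rate n) ^ (i - 1) - (rate n * real k) ^ (i - 1)
        + real i * rate n * (rate n * real k) ^ (i - 1)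
        - real (i - 1) * rate n * (rate n * real k) ^ (i - 1 - 1)) / rate n) -
    (\<Sum>v<i. \<Sum>u<v. 1 / real n + tree (v - u) n k / real n + tree (i - (v - u)) n k / real n)"
proof -
  define p where "p = rate n"
  define y where "y = p * real k"
  define N where "N = real n"
  define h where "h = \<theta> n k"
  have p: "0 < p" and N: "0 < N" using n by (auto simp: good_def p_def N_def)
  have "(\<Sum>v<i. \<Sum>u<v. b (v - u) n k * b (i - (v - u)) n k / N) =
    (\<Sum>v<i. \<Sum>u<v. (1 / N + tree (v - u) n k / N + tree (i - (v - u)) n k / N) +
      N * h ^ i * y ^ (i - 2) * (tree_weight (v - u) * tree_weight (i - (v - u))))"
  proof (intro sum.cong refl)
    fix v u assume "v \<in> {..<i}" "u \<in> {..<v}"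
    then have r: "0 < v - u" "0 < i - (v - u)" "(v - u) + (i - (v - u)) = i" by auto
    have "tree (v - u) n k * tree (i - (v - u)) n k / N = N * h ^ i * y ^ (i - 2) * (tree_weight (v - u) * tree_weight (i - (v - u)))"
    proof -
      have "h ^ (v - u) * h ^ (i - (v - u)) = h ^ i" using r by (simp add: power_add[symmetric])
      moreover have "y ^ (v - u - 1) * y ^ (i - (v - u) - 1) = y ^ (i - 2)"
      proof -
        have "(v - u - 1) + (i - (v - u) - 1) = i - 2" using r by linarith
        then show ?thesis by (simp only: power_add[symmetric])
      qed
      moreover have "tree (v - u) n k * tree (i - (v - u)) n k / N = N * (h ^ (v - u) * h ^ (i - (v - u))) *
        (y ^ (v - u - 1) * y ^ (i - (v - u) - 1)) * (tree_weight (v - u) * tree_weight (i - (v - u)))"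
        using N unfolding tree_def N_def[symmetric] h_def[symmetric] p_def[symmetric] y_def[symmetric] by (simp add: field_simps)
      ultimately show ?thesis by simp
    qed
    then show "b (v - u) n k * b (i - (v - u)) n k / N = (1 / N + tree (v - u) n k / N + tree (i - (v - u)) n k / N) +
      N * h ^ i * y ^ (i - 2) * (tree_weight (v - u) * tree_weight (i - (v - u)))"
      by (simp add: b_def ring_distribs add_divide_distrib)
  qed
  also have "\<dots> = (\<Sum>v<i. \<Sum>u<v. 1 / N + tree (v - u) n k / N + tree (i - (v - u)) n k / N) +
    N * h ^ i * y ^ (i - 2) * (real (i - 1) * tree_weight i)"
    unfolding tree_weight_recurrence[symmetric] sum_distrib_left by (simp only: sum.distrib)
  finally have S: "(\<Sum>v<i. \<Sum>u<v. b (v - u) n k * b (i - (v - u)) n k / N) =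
    (\<Sum>v<i. \<Sum>u<v. 1 / N + tree (v - u) n k / N + tree (i - (v - u)) n k / N) +
    N * h ^ i * y ^ (i - 2) * (real (i - 1) * tree_weight i)" .
  have "\<theta> n (Suc k) ^ i = h ^ i * (1 - p) ^ i"
    by (simp add: \<theta>_def h_def p_def power_mult_distrib mult.commute)
  moreover have "rate n * real (Suc k) = y + p" by (simp add: y_def p_def algebra_simps)
  ultimately have "gain i n k = tree_weight i * (N * h ^ i) * ((1 - p) ^ i * (y + p) ^ (i - 1) - y ^ (i - 1))"
    unfolding gain_def b_def tree_def N_def[symmetric] h_def[symmetric] p_def[symmetric] y_def[symmetric] by (simp add: algebra_simps)
  moreover have "b i n k = 1 + tree_weight i * (N * h ^ i) * y ^ (i - 1)"
    by (simp add: b_def tree_def N_def h_def y_def p_def)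
  \<comment> \<open>Here \<open>c\<close> is the tree weight, \<open>W\<close> the common factor
    \<open>n * \<theta> ^ i\<close>, \<open>P\<close> and \<open>Q\<close> the new and the old value
    of the remaining factor, \<open>Z\<close> the next lower power of the time, and
    \<open>S0\<close> the leftover sum.\<close>
  moreover have "c * W * (P - Q) / p + j * (1 + c * W * Q) - j - (S0 + W * Z * (m * c)) =
    c * W * ((P - Q + j * p * Q - m * p * Z) / p) - S0" for c W P Q j S0 Z m
    using p by (simp add: field_simps)
  moreover have "i - 1 - 1 = i - 2" by simp
  ultimately show ?thesis
    unfolding defect_def N_def[symmetric] S p_def[symmetric] by (simp only: h_def[symmetric] y_def[symmetric] p_def[symmetric])
qed

text \<open>The discretisation error is of order \<open>rate n ^ 2\<close> times
  \<open>n * \<theta> ^ i\<close>. Division by the step takes one factor \<open>rate n\<close>; the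
  other cancels \<open>n\<close> because \<open>n * rate n \<le> 4\<close>. What is left is \<theta>
  times powers of the elapsed time.\<close>

lemma defect_dominated:
  assumes i: "0 < i"
  shows "defect i \<preceq> \<theta>"
proof -
  define C where "C = real i ^ 2 + (1 + real i) * real (i - 1) ^ 2 + real i * real (i - 1)"
  define R where "R n k = tree_weight i * (real n * \<theta> n k ^ i) *
      (((1 - rate n) ^ i * (rate n * real k + rate n) ^ (i - 1) - (rate n * real k) ^ (i - 1)
        + real i * rate n * (rate n * real k) ^ (i - 1)
        - real (i - 1) * rate n * (rate n * real k) ^ (i - 1 - 1)) / rate n)" for n k
  have tw: "0 \<le> tree_weight i" by (simp add: tree_weight_def)
  have C: "0 \<le> C" by (simp add: C_def)
  have "(\<lambda>n k. (4 * tree_weight i * C) * (\<theta> n k * (1 + rate n * real k) ^ (i - 1))) \<preceq> (\<lambda>n k. \<theta> n k * 1 ^ (i - 1))"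
    by (intro dominated_cmult dominated_mult theta_dominated_refl dominated_power dominated_add dominated_const time_dominated)
  then have R: "R \<preceq> (\<lambda>n k. \<theta> n k * 1 ^ (i - 1))"
  proof (rule dominated_le, intro eventually_goodI)
    fix n k assume n: "good n"
    define p where "p = rate n"
    define y where "y = p * real k"
    have p: "0 < p" "p \<le> 1" and y: "0 \<le> y" and n2: "2 \<le> real n" using n by (auto simp: good_def p_def y_def)
    have th: "0 \<le> \<theta> n k" using n by (auto simp: good_def less_imp_le)
    define X where "X = (1 - p) ^ i * (y + p) ^ (i - 1) - y ^ (i - 1) + real i * p * y ^ (i - 1) - real (i - 1) * p * y ^ (i - 1 - 1)"
    have "\<bar>X\<bar> \<le> C * (p ^ 2 * (1 + y) ^ (i - 1))"
      unfolding X_def C_def using p y by (intro product_taylor) auto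
    then have "\<bar>X\<bar> / p \<le> C * (p ^ 2 * (1 + y) ^ (i - 1)) / p" using p by (intro divide_right_mono) auto
    also have "\<dots> = C * (p * (1 + y) ^ (i - 1))" using p by (simp add: power2_eq_square)
    finally have X: "\<bar>X\<bar> / p \<le> C * (p * (1 + y) ^ (i - 1))" .
    have np: "real n * p \<le> 4" using n2 by (simp add: p_def rate_def field_simps)
    have "\<bar>R n k\<bar> = tree_weight i * (real n * \<theta> n k ^ i) * (\<bar>X\<bar> / p)"
      unfolding R_def p_def[symmetric] y_def[symmetric] X_def[symmetric] using tw th p by (simp add: abs_mult)
    also have "\<dots> \<le> tree_weight i * (real n * \<theta> n k) * (C * (p * (1 + y) ^ (i - 1)))"
      using tw th X theta_power_le[OF n i, of k] p by (intro mult_mono mult_left_mono mult_nonneg_nonneg) auto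
    also have "\<dots> = (real n * p) * (tree_weight i * C * (\<theta> n k * (1 + y) ^ (i - 1)))" by simp
    also have "\<dots> \<le> 4 * (tree_weight i * C * (\<theta> n k * (1 + y) ^ (i - 1)))"
      using np tw C th y by (intro mult_right_mono mult_nonneg_nonneg) auto
    also have "\<dots> = 4 * tree_weight i * C * (\<theta> n k * (1 + y) ^ (i - 1))" by simp
    finally show "\<bar>R n k\<bar> \<le> \<bar>4 * tree_weight i * C * (\<theta> n k * (1 + rate n * real k) ^ (i - 1))\<bar>"
      unfolding y_def p_def by linarith
  qed
  have "(\<lambda>n k. \<Sum>v<i. \<Sum>u<v. 1 / real n + tree (v - u) n k / real n + tree (i - (v - u)) n k / real n) \<preceq> \<theta>"
    by (intro dominated_sum dominated_add inverse_dominated_theta tree_over_n_dominated dominated_nonneg[OF theta_dominated_refl]) auto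
  with R have "(\<lambda>n k. R n k - (\<Sum>v<i. \<Sum>u<v. 1 / real n + tree (v - u) n k / real n + tree (i - (v - u)) n k / real n)) \<preceq> \<theta>"
    by (intro dominated_diff) simp_all
  then show ?thesis
    by (rule dominated_cong) (intro eventually_goodI, simp only: R_def defect_eq[OF _ i])
qed

end

section \<open>Families of cycles of the identity\<close>

lemma cycle_families_id_long:
  assumes "t \<in> I" "2 \<le> \<mu> t"
  shows "cycle_families n id I \<mu> = {}"
proof -
  have False if w: "w \<in> cycle_families n id I \<mu>" for w
  proof -
    have len: "length (w t) = \<mu> t" and dist: "distinct (w t)" and rot: "rotate1 (w t) = w t"
      using w assms(1) by (auto simp: cycle_families_def dest: placementsD(1,2))
    obtain a b ys where "w t = a # b # ys" using len assms(2) by (cases "w t"; cases "tl (w t)") auto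
    then show False using rot dist by simp
  qed
  then show ?thesis by blast
qed

lemma num_cycles_1_id: "num_cycles n 1 id = n"
proof -
  have "cyclic_on id {x}" for x :: nat
    using orbit_eq_singleton_iff[of id x] by (simp add: cyclic_on_def)
  then have "{C. C \<subseteq> {1..n} \<and> cyclic_on id C \<and> card C = 1} = (\<lambda>x. {x}) ` {1..n}"
    by (auto simp: card_1_singleton_iff)
  then show ?thesis by (simp add: num_cycles_def card_image)
qed

lemma mean_count_0: "mean_count n 0 I \<mu> = cycle_count n I \<mu> id"
  by (simp add: mean_count_def)

lemma mean_count_0_ones:
  assumes "finite I" "\<And>t. t \<in> I \<Longrightarrow> \<mu> t = 1"
  shows "mean_count n 0 I \<mu> = (\<Prod>m<card I. real (n - m))"
proof -
  have "cycle_families n id I \<mu> = cycle_families n id I (\<lambda>_. 1)"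
    by (rule cycle_families_cong) (use assms in auto)
  then have "mean_count n 0 I \<mu> = cycle_count n I (\<lambda>_. 1) id" by (simp add: mean_count_0)
  also have "\<dots> = real (\<Prod>m<card I. 1 * (num_cycles n 1 id - m))"
    by (subst card_cycle_families_const) (use assms in auto)
  also have "\<dots> = (\<Prod>m<card I. real (n - m))"
    unfolding num_cycles_1_id by simp
  finally show ?thesis .
qed

lemma power_diff_le:
  fixes a b :: real
  assumes "0 \<le> b" "b \<le> a"
  shows "a ^ l - b ^ l \<le> real l * (a - b) * a ^ (l - 1)"
proof (induction l)
  case (Suc l)
  have "a ^ Suc l - b ^ Suc l = a * (a ^ l - b ^ l) + (a - b) * b ^ l" by (simp add: algebra_simps)
  also have "\<dots> \<le> a * (real l * (a - b) * a ^ (l - 1)) + (a - b) * a ^ l"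
    using assms Suc by (intro add_mono mult_left_mono power_mono) auto
  also have "a * (real l * (a - b) * a ^ (l - 1)) = real l * (a - b) * a ^ l"
    by (cases l) auto
  finally show ?case by (simp add: algebra_simps)
qed simp

context time_window
begin

lemma gain_eq:
  assumes "rate n \<noteq> 0"
  shows "gain i n k = rate n * (defect i n k - real i * b i n k + real i +
     (\<Sum>v<i. \<Sum>u<v. b (v - u) n k * b (i - (v - u)) n k / real n))"
  using assms by (simp add: defect_def)

lemma theta_dominated_v: "\<theta> \<preceq> v i"
proof -
  have "\<theta> \<preceq> (\<lambda>n k. 1)"
    by (rule dominatedI, intro eventually_goodI) (auto simp: good_def less_imp_le)
  also have "\<dots> \<preceq> v i" by (rule one_dominated_v)
  finally show ?thesis .
qed

lemma rate_dominated_refl: "(\<lambda>n k. rate n) \<preceq> (\<lambda>n k. rate n)"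
  by (intro dominated_refl eventually_goodI) (auto simp: good_def)

text \<open>The definition of \<open>defect\<close> is solved for the increment. Every term is then
  at most \<open>v i\<close> up to logarithms, the cut terms by \<open>v_cut_le\<close>.\<close>

lemma gain_dominated:
  assumes i: "0 < i"
  shows "gain i \<preceq> (\<lambda>n k. rate n * v i n k)"
proof -
  have vnn: "\<forall>\<^sub>F n in sequentially. \<forall>k\<le>T n. 0 \<le> v i n k"
    by (rule dominated_nonneg[OF v_dominated_refl])
  have bb: "(\<lambda>n k. b (v' - u) n k * b (i - (v' - u)) n k / real n) \<preceq> v i" if "v' < i" "u < v'" for v' u
  proof -
    have "(\<lambda>n k. b (v' - u) n k * b (i - (v' - u)) n k / real n) \<preceq> (\<lambda>n k. v (v' - u) n k * v (i - (v' - u)) n k / real n)"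
      by (intro dominated_over_n dominated_mult b_dominated)
    then have "(\<lambda>n k. b (v' - u) n k * b (i - (v' - u)) n k / real n) \<preceq> (\<lambda>n k. 3 * v i n k)"
    proof (rule dominated_ge, intro eventually_goodI impI)
      fix n k assume n: "good n"
      have "(v' - u) + (i - (v' - u)) = i" using that by simp
      then show "v (v' - u) n k * v (i - (v' - u)) n k / real n \<le> 3 * v i n k"
        using v_cut_le[OF n, of "v' - u" k "i - (v' - u)"] n by (simp add: good_def divide_le_eq mult_ac)
    qed
    also have "(\<lambda>n k. 3 * v i n k) \<preceq> v i" by (intro dominated_cmult v_dominated_refl)
    finally show ?thesis .
  qed
  have "(\<lambda>n k. defect i n k - real i * b i n k + real i * 1 +
     (\<Sum>v<i. \<Sum>u<v. b (v - u) n k * b (i - (v - u)) n k / real n)) \<preceq> v i"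
    by (intro dominated_add dominated_diff dominated_sum dominated_cmult b_dominated bb vnn one_dominated_v
        dominated_trans[OF defect_dominated[OF i] theta_dominated_v]) auto
  from dominated_mult[OF rate_dominated_refl this] show ?thesis
    by (rule dominated_cong) (intro eventually_goodI, simp add: gain_eq good_def)
qed

definition linear_part :: "nat set \<Rightarrow> (nat \<Rightarrow> nat) \<Rightarrow> nat \<Rightarrow> nat \<Rightarrow> real" where
  "linear_part I \<mu> n k = (\<Sum>t\<in>I. gain (\<mu> t) n k * B (I - {t}) \<mu> n k)"

lemma linear_part_dominated:
  assumes "valid I \<mu>"
  shows "linear_part I \<mu> \<preceq> (\<lambda>n k. rate n * V I \<mu> n k)"
  unfolding linear_part_def
proof (rule dominated_sum)
  fix t assume t: "t \<in> I"
  have "(\<lambda>n k. gain (\<mu> t) n k * B (I - {t}) \<mu> n k) \<preceq> (\<lambda>n k. (rate n * v (\<mu> t) n k) * V (I - {t}) \<mu> n k)"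
    using assms t by (intro dominated_mult gain_dominated B_dominated) (auto simp: valid_def)
  moreover have "(rate n * v (\<mu> t) n k) * V (I - {t}) \<mu> n k = rate n * V I \<mu> n k" for n k
    using V_remove[of I t \<mu> n k] assms t by (simp add: valid_def)
  ultimately show "(\<lambda>n k. gain (\<mu> t) n k * B (I - {t}) \<mu> n k) \<preceq> (\<lambda>n k. rate n * V I \<mu> n k)" by simp
next
  show "\<forall>\<^sub>F n in sequentially. \<forall>k\<le>T n. 0 \<le> rate n * V I \<mu> n k"
    by (intro eventually_goodI mult_nonneg_nonneg) (auto simp: good_def V_pos less_imp_le)
qed

text \<open>The increment of a product minus its linear part consists of terms with at least two
  increments, each bringing a factor \<open>rate n\<close>. The induction splits off one factor of
  the product; where three powers of \<open>rate n\<close> arise, the surplus one is dropped as it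
  is at most 1.\<close>

lemma quadratic_part_dominated:
  assumes "valid I \<mu>"
  shows "(\<lambda>n k. B I \<mu> n (Suc k) - B I \<mu> n k - linear_part I \<mu> n k) \<preceq> (\<lambda>n k. rate n ^ 2 * V I \<mu> n k)"
proof -
  have "finite I" using assms by (simp add: valid_def)
  then show ?thesis using assms
  proof (induction I rule: finite_induct)
    case empty
    have "(\<lambda>n k. 0) \<preceq> (\<lambda>n k. rate n ^ 2 * V {} \<mu> n k)"
      by (intro dominated_zero eventually_goodI) (simp add: V_def)
    then show ?case by (simp add: B_def linear_part_def)
  next
    case (insert s I)
    have vI: "valid I \<mu>" and s: "0 < \<mu> s" using insert.prems by (auto simp: valid_def)
    define Q where "Q = (\<lambda>n k. B I \<mu> n (Suc k) - B I \<mu> n k - linear_part I \<mu> n k)"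
    note Q = insert.IH[OF vI, folded Q_def]
    have lin: "linear_part (insert s I) \<mu> n k = gain (\<mu> s) n k * B I \<mu> n k + b (\<mu> s) n k * linear_part I \<mu> n k" for n k
    proof -
      have "gain (\<mu> t) n k * B (insert s I - {t}) \<mu> n k = b (\<mu> s) n k * (gain (\<mu> t) n k * B (I - {t}) \<mu> n k)"
        if "t \<in> I" for t
      proof -
        have "insert s I - {t} = insert s (I - {t})" using insert.hyps that by auto
        then show ?thesis using insert.hyps by (simp add: B_def)
      qed
      then have "(\<Sum>t\<in>I. gain (\<mu> t) n k * B (insert s I - {t}) \<mu> n k) = b (\<mu> s) n k * linear_part I \<mu> n k"
        unfolding linear_part_def sum_distrib_left by (rule sum.cong[OF refl])
      moreover have "insert s I - {s} = I" using insert.hyps by auto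
      ultimately show ?thesis unfolding linear_part_def[of "insert s I"] sum.insert[OF insert.hyps] by simp
    qed
    have eq: "B (insert s I) \<mu> n (Suc k) - B (insert s I) \<mu> n k - linear_part (insert s I) \<mu> n k =
      b (\<mu> s) n k * Q n k + gain (\<mu> s) n k * linear_part I \<mu> n k + gain (\<mu> s) n k * Q n k" for n k
    proof -
      have "B (insert s I) \<mu> n k' = b (\<mu> s) n k' * B I \<mu> n k'" for k'
        using insert.hyps by (simp add: B_def)
      then show ?thesis unfolding lin Q_def gain_def by (simp add: algebra_simps)
    qed
    have Vs: "V (insert s I) \<mu> n k = v (\<mu> s) n k * V I \<mu> n k" for n k
      using insert.hyps by (simp add: V_def)
    have g: "gain (\<mu> s) \<preceq> (\<lambda>n k. rate n * v (\<mu> s) n k)" by (rule gain_dominated[OF s])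
    have "(\<lambda>n k. b (\<mu> s) n k * Q n k) \<preceq> (\<lambda>n k. v (\<mu> s) n k * (rate n ^ 2 * V I \<mu> n k))"
      by (intro dominated_mult b_dominated Q)
    moreover have "(\<lambda>n k. gain (\<mu> s) n k * linear_part I \<mu> n k) \<preceq> (\<lambda>n k. (rate n * v (\<mu> s) n k) * (rate n * V I \<mu> n k))"
      by (intro dominated_mult g linear_part_dominated vI)
    moreover have "(\<lambda>n k. gain (\<mu> s) n k * Q n k) \<preceq> (\<lambda>n k. v (\<mu> s) n k * (rate n ^ 2 * V I \<mu> n k))"
    proof (rule dominated_ge[OF dominated_mult[OF g Q]], intro eventually_goodI impI)
      fix n k assume n: "good n"
      have "rate n * (v (\<mu> s) n k * (rate n ^ 2 * V I \<mu> n k)) \<le> 1 * (v (\<mu> s) n k * (rate n ^ 2 * V I \<mu> n k))"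
        using n v_pos[OF n, of "\<mu> s" k] V_pos[OF n, of I \<mu> k]
        by (intro mult_right_mono mult_nonneg_nonneg) (auto simp: good_def)
      then show "rate n * v (\<mu> s) n k * (rate n ^ 2 * V I \<mu> n k) \<le> v (\<mu> s) n k * (rate n ^ 2 * V I \<mu> n k)"
        by (simp add: mult.assoc)
    qed
    moreover have "(rate n * v (\<mu> s) n k) * (rate n * V I \<mu> n k) = v (\<mu> s) n k * (rate n ^ 2 * V I \<mu> n k)" for n k
      by (simp add: power2_eq_square)
    ultimately have "(\<lambda>n k. b (\<mu> s) n k * Q n k + gain (\<mu> s) n k * linear_part I \<mu> n k + gain (\<mu> s) n k * Q n k)
      \<preceq> (\<lambda>n k. v (\<mu> s) n k * (rate n ^ 2 * V I \<mu> n k))"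
      by (intro dominated_add) simp_all
    moreover have "v (\<mu> s) n k * (rate n ^ 2 * V I \<mu> n k) = rate n ^ 2 * V (insert s I) \<mu> n k" for n k
      by (simp add: Vs)
    ultimately show ?case unfolding eq by simp
  qed
qed

lemma V_over_n_dominated:
  assumes "valid I \<mu>" "I \<noteq> {}"
  shows "(\<lambda>n k. V I \<mu> n k / real n) \<preceq> E I \<mu>"
proof -
  obtain t where t: "t \<in> I" using assms by blast
  have "finite I" "0 < \<mu> t" using assms t by (auto simp: valid_def)
  then show ?thesis using vV_over_n_dominated[of I t "\<mu> t" \<mu>] t by (simp add: V_remove[OF \<open>finite I\<close> t])
qed

lemma E_nonneg_eventually: "\<forall>\<^sub>F n in sequentially. \<forall>k\<le>T n. 0 \<le> E I \<mu> n k"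
  by (intro eventually_goodI E_nonneg)

text \<open>The equations for single lengths, each multiplied by the factors of the other words, add
  up to the system of the means without its remainder. A \<open>defect\<close> replaces one factor
  by \<theta>, and the quadratic part per unit of time is of order \<open>V / n\<close>; both lie
  within \<open>E\<close>.\<close>

lemma B_drift:
  assumes v: "valid I \<mu>" and f: "f \<notin> I" and ne: "I \<noteq> {}"
  shows "(\<lambda>n k. (B I \<mu> n (Suc k) - (1 - rate n * real (sum \<mu> I)) * B I \<mu> n k) / rate n -
    (outs (\<lambda>I \<mu>. B I \<mu> n k) I \<mu> + cuts f (\<lambda>I \<mu>. B I \<mu> n k) I \<mu> / real n)) \<preceq> E I \<mu>"
proof -
  have fin: "finite I" using v by (simp add: valid_def)
  define Q where "Q = (\<lambda>n k. B I \<mu> n (Suc k) - B I \<mu> n k - linear_part I \<mu> n k)"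
  have "(\<lambda>n k. 1 / rate n * Q n k) \<preceq> (\<lambda>n k. 1 / rate n * (rate n ^ 2 * V I \<mu> n k))"
    unfolding Q_def
    by (intro dominated_mult quadratic_part_dominated v dominated_refl eventually_goodI) (auto simp: good_def)
  then have "(\<lambda>n k. 1 / rate n * Q n k) \<preceq> (\<lambda>n k. 4 * (V I \<mu> n k / real n))"
  proof (rule dominated_ge, intro eventually_goodI impI)
    fix n k assume n: "good n"
    have "1 / rate n * (rate n ^ 2 * V I \<mu> n k) = rate n * V I \<mu> n k"
      using n by (simp add: good_def power2_eq_square)
    also have "\<dots> \<le> 4 / real n * V I \<mu> n k"
      using n V_pos[OF n, of I \<mu> k] by (intro mult_right_mono) (auto simp: good_def rate_def field_simps)
    finally show "1 / rate n * (rate n ^ 2 * V I \<mu> n k) \<le> 4 * (V I \<mu> n k / real n)" by simp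
  qed
  also have "(\<lambda>n k. 4 * (V I \<mu> n k / real n)) \<preceq> E I \<mu>"
    by (intro dominated_cmult V_over_n_dominated v ne)
  finally have Q: "(\<lambda>n k. 1 / rate n * Q n k) \<preceq> E I \<mu>" .
  have "(\<lambda>n k. \<Sum>t\<in>I. defect (\<mu> t) n k * B (I - {t}) \<mu> n k) \<preceq> E I \<mu>"
  proof (rule dominated_sum[OF _ E_nonneg_eventually])
    fix t assume t: "t \<in> I"
    then have "0 < \<mu> t" using v by (simp add: valid_def)
    have "(\<lambda>n k. defect (\<mu> t) n k * B (I - {t}) \<mu> n k) \<preceq> (\<lambda>n k. \<theta> n k * V (I - {t}) \<mu> n k)"
      by (intro dominated_mult defect_dominated B_dominated) fact
    then show "(\<lambda>n k. defect (\<mu> t) n k * B (I - {t}) \<mu> n k) \<preceq> E I \<mu>"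
      by (rule dominated_ge) (intro eventually_goodI impI theta_V_le_E fin t)
  qed
  from dominated_add[OF this Q] show ?thesis
  proof (rule dominated_cong, intro eventually_goodI)
    fix n k assume n: "good n"
    have p: "rate n \<noteq> 0" using n by (simp add: good_def)
    define Bt where "Bt t = B (I - {t}) \<mu> n k" for t
    have Bt: "b (\<mu> t) n k * Bt t = B I \<mu> n k" if "t \<in> I" for t
      using fin that by (simp add: B_def Bt_def prod.remove)
    have "(B I \<mu> n (Suc k) - (1 - rate n * real (sum \<mu> I)) * B I \<mu> n k) / rate n =
      1 / rate n * Q n k + linear_part I \<mu> n k / rate n + real (sum \<mu> I) * B I \<mu> n k"
      unfolding Q_def using p by (simp add: field_simps)
    also have "linear_part I \<mu> n k / rate n = (\<Sum>t\<in>I. (defect (\<mu> t) n k - real (\<mu> t) * b (\<mu> t) n k + real (\<mu> t) +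
     (\<Sum>v<\<mu> t. \<Sum>u<v. b (v - u) n k * b (\<mu> t - (v - u)) n k / real n)) * Bt t)"
      unfolding linear_part_def sum_divide_distrib
      by (intro sum.cong refl) (simp only: gain_eq[OF p] Bt_def, simp add: p)
    also have "\<dots> = (\<Sum>t\<in>I. defect (\<mu> t) n k * Bt t) - (\<Sum>t\<in>I. real (\<mu> t) * (b (\<mu> t) n k * Bt t)) + (\<Sum>t\<in>I. real (\<mu> t) * Bt t) +
      (\<Sum>t\<in>I. (\<Sum>v<\<mu> t. \<Sum>u<v. b (v - u) n k * b (\<mu> t - (v - u)) n k / real n) * Bt t)"
      by (simp only: distrib_right left_diff_distrib sum.distrib sum_subtractf mult.assoc)
    also have "(\<Sum>t\<in>I. real (\<mu> t) * (b (\<mu> t) n k * Bt t)) = real (sum \<mu> I) * B I \<mu> n k"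
      by (simp add: Bt sum_distrib_right)
    also have "(\<Sum>t\<in>I. real (\<mu> t) * Bt t) = outs (\<lambda>I \<mu>. B I \<mu> n k) I \<mu>"
      by (simp add: outs_def Bt_def)
    also have "(\<Sum>t\<in>I. (\<Sum>v<\<mu> t. \<Sum>u<v. b (v - u) n k * b (\<mu> t - (v - u)) n k / real n) * Bt t) =
      cuts f (\<lambda>I \<mu>. B I \<mu> n k) I \<mu> / real n"
      unfolding cuts_cut_at sum_divide_distrib sum_distrib_right
    proof (intro sum.cong refl)
      fix t v u assume t: "t \<in> I"
      have tf: "t \<noteq> f" using t f by auto
      let ?c = "cut_at \<mu> t f (v - u)"
      have "B (insert f I) ?c n k = b (v - u) n k * B I ?c n k"
        using fin f by (simp add: B_def cut_at_def)
      also have "B I ?c n k = b (?c t) n k * B (I - {t}) ?c n k"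
        using fin t by (simp add: B_def prod.remove)
      also have "?c t = \<mu> t - (v - u)" using tf by (simp add: cut_at_def)
      also have "B (I - {t}) ?c n k = Bt t"
        unfolding B_def Bt_def using f by (intro prod.cong) (auto simp: cut_at_def)
      finally show "b (v - u) n k * b (\<mu> t - (v - u)) n k / real n * Bt t = B (insert f I) ?c n k / real n" by simp
    qed
    finally show "(B I \<mu> n (Suc k) - (1 - rate n * real (sum \<mu> I)) * B I \<mu> n k) / rate n -
      (outs (\<lambda>I \<mu>. B I \<mu> n k) I \<mu> + cuts f (\<lambda>I \<mu>. B I \<mu> n k) I \<mu> / real n) =
      (\<Sum>t\<in>I. defect (\<mu> t) n k * B (I - {t}) \<mu> n k) + 1 / rate n * Q n k"
      unfolding Bt_def by simp
  qed
qed

lemma tree_0: "0 < i \<Longrightarrow> tree i n 0 = (if i = 1 then real n else 0)"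
  by (auto simp: tree_def \<theta>_def tree_weight_def)

text \<open>The identity has only fixed points. A longer word makes the mean zero, while its factor
  in \<open>B\<close> is 1; since \<open>\<theta> n 0 = 1\<close>, the product \<open>B\<close> is
  within the corresponding term of \<open>E\<close>. If all lengths are 1, the falling factorial of
  \<open>n\<close> and \<open>(1 + n) ^ l\<close> differ by the order of \<open>n ^ (l - 1)\<close>,
  which is that of \<open>E\<close>.\<close>

lemma start_dominated:
  assumes v: "valid I \<mu>" and ne: "I \<noteq> {}"
  shows "(\<lambda>n k. mean I \<mu> n 0 - B I \<mu> n 0) \<preceq> (\<lambda>n k. E I \<mu> n 0)"
proof (cases "\<exists>t\<in>I. 2 \<le> \<mu> t")
  case True
  then obtain t where t: "t \<in> I" "2 \<le> \<mu> t" by blast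
  have fin: "finite I" using v by (simp add: valid_def)
  show ?thesis
  proof (rule dominatedI, intro eventually_goodI)
    fix n k :: nat assume n: "good n"
    have bv: "0 \<le> b (\<mu> s) n 0 \<and> b (\<mu> s) n 0 \<le> v (\<mu> s) n 0" if "s \<in> I" for s
      using tree_0[of "\<mu> s" n] v that by (auto simp: b_def v_def \<theta>_def valid_def)
    have "B I \<mu> n 0 = b (\<mu> t) n 0 * (\<Prod>s\<in>I - {t}. b (\<mu> s) n 0)"
      unfolding B_def by (rule prod.remove[OF fin t(1)])
    also have "b (\<mu> t) n 0 = 1" using tree_0[of "\<mu> t" n] t(2) by (simp add: b_def)
    also have "1 * (\<Prod>s\<in>I - {t}. b (\<mu> s) n 0) \<le> \<theta> n 0 * V (I - {t}) \<mu> n 0"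
      using bv by (auto simp: \<theta>_def V_def intro!: prod_mono)
    also have "\<dots> \<le> E I \<mu> n 0" by (rule theta_V_le_E[OF n fin t(1)])
    finally have "B I \<mu> n 0 \<le> E I \<mu> n 0" .
    moreover have "0 \<le> B I \<mu> n 0" unfolding B_def using bv by (intro prod_nonneg) auto
    moreover have "mean I \<mu> n 0 = 0" by (simp add: mean_count_0 cycle_families_id_long[where \<mu> = \<mu>, OF t])
    ultimately show "\<bar>mean I \<mu> n 0 - B I \<mu> n 0\<bar> \<le> E I \<mu> n 0" by simp
  qed
next
  case False
  have fin: "finite I" using v by (simp add: valid_def)
  have ones: "\<mu> t = 1" if "t \<in> I" for t using False v that by (force simp: valid_def)
  define l where "l = card I"
  have "(\<lambda>n k. real (l + 1) * E I \<mu> n 0) \<preceq> (\<lambda>n k. E I \<mu> n 0)"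
    by (intro dominated_cmult dominated_refl eventually_goodI E_nonneg)
  then show ?thesis
  proof (rule dominated_le)
    show "\<forall>\<^sub>F n in sequentially. \<forall>k\<le>T n. \<bar>mean I \<mu> n 0 - B I \<mu> n 0\<bar> \<le> \<bar>real (l + 1) * E I \<mu> n 0\<bar>"
      using eventually_ge_at_top[of l] eventually_good
    proof eventually_elim
      case (elim n)
      have B0: "B I \<mu> n 0 = (1 + real n) ^ l"
        unfolding B_def l_def using ones by (simp add: b_def tree_0)
      have E0: "E I \<mu> n 0 = real l * (1 + real n) ^ (l - 1)"
      proof -
        have "V (I - {t}) \<mu> n 0 = (1 + real n) ^ (l - 1)" if "t \<in> I" for t
          unfolding V_def l_def using that fin by (simp add: v_def \<theta>_def)
        then show ?thesis by (simp add: E_def \<theta>_def l_def)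
      qed
      have "mean I \<mu> n 0 = (\<Prod>m<l. real (n - m))"
        unfolding l_def by (rule mean_count_0_ones[OF fin ones])
      moreover have "(\<Prod>m<l. real (n - m)) \<le> (\<Prod>m<l. 1 + real n)" by (intro prod_mono) auto
      moreover have "(\<Prod>m<l. real n - real l) \<le> (\<Prod>m<l. real (n - m))" using elim by (intro prod_mono) auto
      ultimately have M: "mean I \<mu> n 0 \<le> (1 + real n) ^ l" "(real n - real l) ^ l \<le> mean I \<mu> n 0" by simp_all
      have "(1 + real n) ^ l - (real n - real l) ^ l \<le> real l * ((1 + real n) - (real n - real l)) * (1 + real n) ^ (l - 1)"
        using elim by (intro power_diff_le) auto
      also have "\<dots> = real (l + 1) * E I \<mu> n 0" unfolding E0 by simp
      finally have "\<bar>mean I \<mu> n 0 - B I \<mu> n 0\<bar> \<le> real (l + 1) * E I \<mu> n 0" unfolding B0 using M by simp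
      then show ?case by (auto intro: order_trans[OF _ abs_ge_self])
    qed
  qed
qed

text \<open>The difference \<open>D\<close> of mean and product satisfies the same linear recursion.
  Its sources lie within \<open>E\<close>: the differences for removed and cut families by
  induction, the remainder by the bound \<open>V\<close> divided by \<open>n\<close>, and the drift
  error of \<open>B\<close>. The recursion is then integrated by
  \<open>dominated_evolution\<close>.\<close>

theorem mean_approximation:
  assumes "valid I \<mu>"
  shows "(\<lambda>n k. mean I \<mu> n k - B I \<mu> n k) \<preceq> E I \<mu>"
  using assms
proof (induction "2 * sum \<mu> I - card I" arbitrary: I \<mu> rule: less_induct)
  case less
  note v = less.prems
  have fin: "finite I" using v by (simp add: valid_def)
  show ?case
  proof (cases "I = {}")
    case True
    have "(\<lambda>n k. 0) \<preceq> E I \<mu>" by (rule dominated_zero[OF E_nonneg_eventually])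
    then show ?thesis using True by (simp add: B_def)
  next
    case ne: False
    define D where "D I \<mu> n k = mean I \<mu> n k - B I \<mu> n k" for I \<mu> n k
    obtain f where f: "f \<notin> I" using ex_new_if_finite[OF infinite_UNIV_nat fin] by blast
    have up: "(\<lambda>n k. mean J \<nu> n k / real n) \<preceq> E I \<mu>"
      if "valid J \<nu>" "t \<in> I" "0 < c" "\<And>n k. good n \<Longrightarrow> V J \<nu> n k \<le> v c n k * V (I - {t}) \<mu> n k" for J \<nu> t c
    proof -
      have "(\<lambda>n k. mean J \<nu> n k / real n) \<preceq> (\<lambda>n k. v c n k * V (I - {t}) \<mu> n k / real n)"
        by (rule dominated_ge[OF dominated_over_n[OF mean_dominated[OF that(1)]]])
          (intro eventually_goodI impI divide_right_mono that(4), simp_all)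
      also have "\<dots> \<preceq> E I \<mu>" by (rule vV_over_n_dominated[OF fin that(2,3)])
      finally show ?thesis .
    qed
    have "remainder I \<mu> \<preceq> E I \<mu>"
    proof (rule remainder_dominated[OF v E_nonneg_eventually])
      obtain t where t: "t \<in> I" using ne by blast
      show "(\<lambda>n k. mean I \<mu> n k / real n) \<preceq> E I \<mu>"
        by (rule up[OF v t, of "\<mu> t"]) (use v t in \<open>auto simp: valid_def V_remove[OF fin t]\<close>)
    next
      fix t assume t: "t \<in> I"
      show "(\<lambda>n k. mean (I - {t}) \<mu> n k / real n) \<preceq> E I \<mu>"
      proof (rule up[OF valid_remove[OF v] t, of 1])
        fix n k assume n: "good n"
        show "V (I - {t}) \<mu> n k \<le> v 1 n k * V (I - {t}) \<mu> n k"
          using mult_right_mono[OF v_ge_1[OF n, of 1 k], of "V (I - {t}) \<mu> n k"] V_pos[OF n, of "I - {t}" \<mu> k] by simp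
      qed simp
    next
      fix t r assume t: "t \<in> I" and r: "0 < r" "r \<le> \<mu> t"
      have "valid I (\<mu>(t := r))" using v r by (auto simp: valid_def)
      then show "(\<lambda>n k. mean I (\<mu>(t := r)) n k / real n) \<preceq> E I \<mu>"
        by (rule up[OF _ t r(1)]) (simp add: V_update[OF fin t])
    next
      fix t t' assume t: "t \<in> I" "t' \<in> I" "t \<noteq> t'"
      have pos: "0 < \<mu> t + \<mu> t'" using v t by (auto simp: valid_def)
      show "(\<lambda>n k. mean (I - {t'}) (\<mu>(t := \<mu> t + \<mu> t')) n k / real n) \<preceq> E I \<mu>"
      proof (rule up[OF valid_join[OF v t(1)] t(1) pos])
        fix n k assume n: "good n"
        show "V (I - {t'}) (\<mu>(t := \<mu> t + \<mu> t')) n k \<le> v (\<mu> t + \<mu> t') n k * V (I - {t}) \<mu> n k"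
          unfolding V_join[OF fin t] using n fin v_pos[OF n]
          by (intro mult_left_mono V_remove_le) (auto simp: less_imp_le)
      qed
    qed
    then have M: "(\<lambda>n k. (mean I \<mu> n (Suc k) - (1 - rate n * real (sum \<mu> I)) * mean I \<mu> n k) / rate n -
      (outs (mean_count n k) I \<mu> + cuts f (mean_count n k) I \<mu> / real n)) \<preceq> E I \<mu>"
      by (rule dominated_le[OF _ drift_remainder[OF v f]])
    have outs: "(\<lambda>n k. outs (\<lambda>I \<mu>. D I \<mu> n k) I \<mu>) \<preceq> E I \<mu>"
    proof (rule outs_dominated[OF _ E_nonneg_eventually])
      fix t assume t: "t \<in> I"
      show "D (I - {t}) \<mu> \<preceq> E I \<mu>"
        unfolding D_def
        by (rule dominated_ge[OF less.hyps[OF rank_remove[OF v t] valid_remove[OF v]]])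
          (intro eventually_goodI impI E_remove_le fin)
    qed
    have cuts: "(\<lambda>n k. cuts f (\<lambda>I \<mu>. D I \<mu> n k) I \<mu> / real n) \<preceq> E I \<mu>"
    proof (rule cuts_dominated[OF _ E_nonneg_eventually])
      fix t r assume t: "t \<in> I" and r: "0 < r" "r < \<mu> t"
      have "(\<lambda>n k. D (insert f I) (cut_at \<mu> t f r) n k / real n) \<preceq> (\<lambda>n k. 4 * E I \<mu> n k)"
        unfolding D_def
        by (rule dominated_ge[OF dominated_over_n[OF less.hyps[OF rank_cut[OF v t f r] valid_cut[OF v t f r]]]])
          (intro eventually_goodI impI E_cut_le v t f r)
      also have "\<dots> \<preceq> E I \<mu>" by (intro dominated_cmult dominated_refl E_nonneg_eventually)
      finally show "(\<lambda>n k. D (insert f I) (cut_at \<mu> t f r) n k / real n) \<preceq> E I \<mu>" .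
    qed
    have "(\<lambda>n k. (D I \<mu> n (Suc k) - (1 - rate n * real (sum \<mu> I)) * D I \<mu> n k) / rate n) \<preceq> E I \<mu>"
    proof (rule dominated_cong[OF dominated_add[OF dominated_diff[OF M B_drift[OF v f ne]] dominated_add[OF outs cuts]]], intro eventually_goodI)
      fix n k assume "good n"
      have "outs (\<lambda>I \<mu>. D I \<mu> n k) I \<mu> = outs (mean_count n k) I \<mu> - outs (\<lambda>I \<mu>. B I \<mu> n k) I \<mu>"
        by (simp add: outs_def D_def right_diff_distrib sum_subtractf)
      moreover have "cuts f (\<lambda>I \<mu>. D I \<mu> n k) I \<mu> / real n =
        cuts f (mean_count n k) I \<mu> / real n - cuts f (\<lambda>I \<mu>. B I \<mu> n k) I \<mu> / real n"
        by (simp add: cuts_def D_def sum_subtractf diff_divide_distrib)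
      moreover have "(D I \<mu> n (Suc k) - (1 - rate n * real (sum \<mu> I)) * D I \<mu> n k) / rate n =
        (mean I \<mu> n (Suc k) - (1 - rate n * real (sum \<mu> I)) * mean I \<mu> n k) / rate n -
        (B I \<mu> n (Suc k) - (1 - rate n * real (sum \<mu> I)) * B I \<mu> n k) / rate n"
        unfolding D_def diff_divide_distrib[symmetric] by (simp add: algebra_simps)
      ultimately show "(D I \<mu> n (Suc k) - (1 - rate n * real (sum \<mu> I)) * D I \<mu> n k) / rate n =
        (mean I \<mu> n (Suc k) - (1 - rate n * real (sum \<mu> I)) * mean I \<mu> n k) / rate n -
        (outs (mean_count n k) I \<mu> + cuts f (mean_count n k) I \<mu> / real n) -
        ((B I \<mu> n (Suc k) - (1 - rate n * real (sum \<mu> I)) * B I \<mu> n k) / rate n -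
        (outs (\<lambda>I \<mu>. B I \<mu> n k) I \<mu> + cuts f (\<lambda>I \<mu>. B I \<mu> n k) I \<mu> / real n)) +
        (outs (\<lambda>I \<mu>. D I \<mu> n k) I \<mu> + cuts f (\<lambda>I \<mu>. D I \<mu> n k) I \<mu> / real n)" by simp
    qed
    then have "D I \<mu> \<preceq> E I \<mu>"
    proof (rule dominated_evolution[rotated])
      show "(\<lambda>n k. D I \<mu> n 0) \<preceq> (\<lambda>n k. E I \<mu> n 0)" unfolding D_def by (rule start_dominated[OF v ne])
      show "\<forall>\<^sub>F n in sequentially. \<forall>k<T n. (1 - rate n) ^ sum \<mu> I * E I \<mu> n k \<le> E I \<mu> n (Suc k)"
        using eventually_good by eventually_elim (intro allI impI E_growth v)
    qed
    then show ?thesis unfolding D_def .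
  qed
qed

end

section \<open>The critical time\<close>

context
  fixes j :: nat and c :: real
  assumes j: "1 \<le> j"
begin

definition target :: "nat \<Rightarrow> real" where
  "target n = real n / (2 * real j) * (ln (real n) + (real j - 1) * ln (ln (real n)) + c)"

lemma num_steps_bounds:
  "\<forall>\<^sub>F n in sequentially. target n - 1 \<le> real (num_steps j c n) \<and> real (num_steps j c n) \<le> target n"
proof -
  have "\<forall>\<^sub>F n in sequentially. 0 \<le> ln (real n) + (real j - 1) * ln (ln (real n)) + c"
  proof -
    have "\<forall>\<^sub>F n in sequentially. 0 \<le> ln (ln (real n))" by real_asymp
    moreover have "\<forall>\<^sub>F n in sequentially. - c \<le> ln (real n)" by real_asymp
    ultimately show ?thesis
    proof eventually_elim
      case (elim n)
      have "0 \<le> (real j - 1) * ln (ln (real n))" using elim j by (intro mult_nonneg_nonneg) auto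
      then show ?case using elim by linarith
    qed
  qed
  then show ?thesis
  proof eventually_elim
    case (elim n)
    then have "0 \<le> target n" unfolding target_def by (intro mult_nonneg_nonneg) auto
    then show ?case unfolding num_steps_def target_def[symmetric] by linarith
  qed
qed

lemma rate_target: "(\<lambda>n. rate n * target n / ln (real n)) \<longlonglongrightarrow> 1 / real j"
proof -
  have "(\<lambda>n. real n / (real n - 1) / real j * (1 + (real j - 1) * (ln (ln (real n)) / ln (real n)) + c * (1 / ln (real n))))
    \<longlonglongrightarrow> 1 / real j * (1 + (real j - 1) * 0 + c * 0)"
  proof (intro tendsto_intros)
    show "(\<lambda>n. real n / (real n - 1)) \<longlonglongrightarrow> 1" by real_asymp
    show "(\<lambda>n. ln (ln (real n)) / ln (real n)) \<longlonglongrightarrow> 0" by real_asymp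
    show "(\<lambda>n. 1 / ln (real n)) \<longlonglongrightarrow> 0" by real_asymp
  qed (use j in auto)
  moreover have "\<forall>\<^sub>F n in sequentially. real n / (real n - 1) / real j * (1 + (real j - 1) * (ln (ln (real n)) / ln (real n)) + c * (1 / ln (real n)))
     = rate n * target n / ln (real n)"
    using eventually_ge_at_top[of 3]
  proof eventually_elim
    case (elim n)
    then have "0 < ln (real n)" by simp
    then show ?case using elim j unfolding rate_def target_def by (simp add: field_simps)
  qed
  ultimately show ?thesis by (simp add: filterlim_cong)
qed

lemma rate_num_steps: "(\<lambda>n. rate n * real (num_steps j c n) / ln (real n)) \<longlonglongrightarrow> 1 / real j"
proof (rule tendsto_sandwich[OF _ _ _ rate_target])
  have "(\<lambda>n. rate n * target n / ln (real n) - rate n / ln (real n)) \<longlonglongrightarrow> 1 / real j - 0"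
  proof (rule tendsto_diff[OF rate_target])
    show "(\<lambda>n. rate n / ln (real n)) \<longlonglongrightarrow> 0" unfolding rate_def by real_asymp
  qed
  then show "(\<lambda>n. rate n * (target n - 1) / ln (real n)) \<longlonglongrightarrow> 1 / real j"
    by (simp add: algebra_simps diff_divide_distrib)
  have pos: "\<forall>\<^sub>F n in sequentially. 0 < rate n \<and> 0 < ln (real n)"
    using eventually_ge_at_top[of 3] by eventually_elim (simp add: rate_def)
  show "\<forall>\<^sub>F n in sequentially. rate n * (target n - 1) / ln (real n) \<le> rate n * real (num_steps j c n) / ln (real n)"
    using num_steps_bounds pos by eventually_elim (auto intro!: divide_right_mono mult_left_mono)
  show "\<forall>\<^sub>F n in sequentially. rate n * real (num_steps j c n) / ln (real n) \<le> rate n * target n / ln (real n)"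
    using num_steps_bounds pos by eventually_elim (auto intro!: divide_right_mono mult_left_mono)
qed

text \<open>\<open>\<delta> n\<close> is the distance of \<open>n / 2 * ln (1 - rate n)\<close> from
  \<open>- 1\<close>. It is of order \<open>1 / n\<close>, so it stays negligible when multiplied by
  \<open>ln n\<close>. The double logarithm in \<open>target\<close> cancels
  \<open>ln n ^ (j - 1)\<close>, and \<open>c\<close> leaves \<open>exp (- c)\<close>.\<close>

lemma decay_target:
  "(\<lambda>n. real n * ln (real n) ^ (j - 1) * exp (real j * target n * ln (1 - rate n))) \<longlonglongrightarrow> exp (- c)"
proof -
  define \<delta> where "\<delta> n = 1 + real n / 2 * ln (1 - 2 / (real n - 1))" for n :: nat
  have "(\<lambda>n. - c + (ln (real n) * \<delta> n + (real j - 1) * (ln (ln (real n)) * \<delta> n) + c * \<delta> n)) \<longlonglongrightarrow>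
    - c + (0 + (real j - 1) * 0 + c * 0)"
  proof (intro tendsto_intros)
    show "(\<lambda>n. ln (real n) * \<delta> n) \<longlonglongrightarrow> 0" unfolding \<delta>_def by real_asymp
    show "(\<lambda>n. ln (ln (real n)) * \<delta> n) \<longlonglongrightarrow> 0" unfolding \<delta>_def by real_asymp
    show "\<delta> \<longlonglongrightarrow> 0" unfolding \<delta>_def by real_asymp
  qed
  then have "(\<lambda>n. exp (- c + (ln (real n) * \<delta> n + (real j - 1) * (ln (ln (real n)) * \<delta> n) + c * \<delta> n))) \<longlonglongrightarrow> exp (- c)"
    by (intro tendsto_exp) simp
  moreover have "\<forall>\<^sub>F n in sequentially. exp (- c + (ln (real n) * \<delta> n + (real j - 1) * (ln (ln (real n)) * \<delta> n) + c * \<delta> n)) =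
    real n * ln (real n) ^ (j - 1) * exp (real j * target n * ln (1 - rate n))"
    using eventually_ge_at_top[of 3]
  proof eventually_elim
    case (elim n)
    then have ln: "0 < ln (real n)" by simp
    have "real j * target n * ln (1 - rate n) =
      (ln (real n) + (real j - 1) * ln (ln (real n)) + c) * (\<delta> n - 1)"
      using j unfolding target_def \<delta>_def rate_def by (simp add: field_simps)
    then have eq: "- c + (ln (real n) * \<delta> n + (real j - 1) * (ln (ln (real n)) * \<delta> n) + c * \<delta> n) =
      ln (real n) + real (j - 1) * ln (ln (real n)) + real j * target n * ln (1 - rate n)"
      using j by (simp add: algebra_simps of_nat_diff)
    have "exp (real (j - 1) * ln (ln (real n))) = ln (real n) ^ (j - 1)"
      using ln by (simp add: exp_of_nat_mult)
    then show ?case unfolding eq exp_add using elim by simp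
  qed
  ultimately show ?thesis by (simp add: filterlim_cong)
qed

text \<open>Rounding lowers the number of steps by at most 1 and so changes the quantity by at most
  the factor \<open>exp (- j * ln (1 - rate n))\<close>, which tends to 1. Since
  \<open>ln (1 - rate n)\<close> is not positive, the bounds on the number of steps are
  reversed.\<close>

lemma decay_num_steps:
  "(\<lambda>n. real n * ln (real n) ^ (j - 1) * ((1 - rate n) ^ num_steps j c n) ^ j) \<longlonglongrightarrow> exp (- c)"
proof -
  have small: "\<forall>\<^sub>F n in sequentially. 0 < 1 - rate n \<and> ln (1 - rate n) \<le> 0 \<and> 0 \<le> ln (real n)"
    using eventually_ge_at_top[of 4] by eventually_elim (simp add: rate_def field_simps)
  have pow: "((1 - rate n) ^ k) ^ j = exp (real j * real k * ln (1 - rate n))" if "0 < 1 - rate n" for n k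
  proof -
    have "exp (real j * (real k * ln (1 - rate n))) = (exp (ln (1 - rate n)) ^ k) ^ j"
      by (simp only: exp_of_nat_mult)
    then show ?thesis using that by (simp add: mult.assoc)
  qed
  show ?thesis
  proof (rule tendsto_sandwich[OF _ _ decay_target])
    have "(\<lambda>n. real n * ln (real n) ^ (j - 1) * exp (real j * target n * ln (1 - rate n)) * exp (- (real j * ln (1 - rate n))))
      \<longlonglongrightarrow> exp (- c) * exp (- (real j * ln 1))"
    proof (intro tendsto_mult decay_target tendsto_exp tendsto_minus tendsto_const tendsto_ln)
      show "(\<lambda>n. 1 - rate n) \<longlonglongrightarrow> 1" unfolding rate_def by real_asymp
    qed simp
    then show "(\<lambda>n. real n * ln (real n) ^ (j - 1) * exp (real j * (target n - 1) * ln (1 - rate n))) \<longlonglongrightarrow> exp (- c)"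
      by (simp add: algebra_simps exp_add[symmetric] exp_diff exp_minus divide_inverse)
    show "\<forall>\<^sub>F n in sequentially. real n * ln (real n) ^ (j - 1) * exp (real j * target n * ln (1 - rate n)) \<le>
      real n * ln (real n) ^ (j - 1) * ((1 - rate n) ^ num_steps j c n) ^ j"
      using num_steps_bounds small
    proof eventually_elim
      case (elim n)
      have "real j * target n * ln (1 - rate n) \<le> real j * real (num_steps j c n) * ln (1 - rate n)"
        using elim by (intro mult_right_mono_neg mult_left_mono) auto
      then show ?case using elim by (subst pow) (auto intro!: mult_left_mono)
    qed
    show "\<forall>\<^sub>F n in sequentially. real n * ln (real n) ^ (j - 1) * ((1 - rate n) ^ num_steps j c n) ^ j \<le>
      real n * ln (real n) ^ (j - 1) * exp (real j * (target n - 1) * ln (1 - rate n))"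
      using num_steps_bounds small
    proof eventually_elim
      case (elim n)
      have "real j * real (num_steps j c n) * ln (1 - rate n) \<le> real j * (target n - 1) * ln (1 - rate n)"
        using elim by (intro mult_right_mono_neg mult_left_mono) auto
      then show ?case using elim by (subst pow) (auto intro!: mult_left_mono)
    qed
  qed
qed

text \<open>The elapsed time is about \<open>ln n / j\<close>. For the decay,
  \<open>n * ln n ^ (j - 1) * \<theta> ^ j\<close> is bounded below by \<open>exp (- c) / 2\<close>
  and \<open>\<theta> ^ j \<le> \<theta>\<close>; one more logarithm pays for the constant
  \<open>2 * exp c\<close>, so the exponent \<open>j\<close> works.\<close>

lemma time_window_num_steps: "time_window (num_steps j c)"
proof
  have ln: "\<forall>\<^sub>F n in sequentially. K \<le> ln (real n)" for K by real_asymp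
  have "\<forall>\<^sub>F n in sequentially. rate n * real (num_steps j c n) / ln (real n) < 2"
    using order_tendstoD(2)[OF rate_num_steps, of 2] j by (simp add: divide_less_eq)
  then show "\<forall>\<^sub>F n in sequentially. rate n * real (num_steps j c n) \<le> ln (real n) ^ 2"
    using ln[of 2]
  proof eventually_elim
    case (elim n)
    then have "rate n * real (num_steps j c n) \<le> 2 * ln (real n)" by (simp add: divide_less_eq)
    also have "\<dots> \<le> ln (real n) * ln (real n)" using elim by (intro mult_right_mono) auto
    finally show ?case by (simp add: power2_eq_square)
  qed
  have "\<forall>\<^sub>F n in sequentially. exp (- c) / 2 < real n * ln (real n) ^ (j - 1) * ((1 - rate n) ^ num_steps j c n) ^ j"
    by (rule order_tendstoD(1)[OF decay_num_steps]) simp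
  then have "\<forall>\<^sub>F n in sequentially. 1 / real n \<le> ln (real n) ^ j * (1 - rate n) ^ num_steps j c n"
    using ln[of "2 * exp c"] ln[of 1] eventually_ge_at_top[of 4]
  proof eventually_elim
    case (elim n)
    define th where "th = (1 - rate n) ^ num_steps j c n"
    have p: "0 \<le> 1 - rate n" "1 - rate n \<le> 1" using elim by (auto simp: rate_def field_simps)
    have th: "0 \<le> th" "th \<le> 1" unfolding th_def using p by (auto intro: power_le_one)
    have "th ^ j \<le> th" using th j power_decreasing[of 1 j th] by simp
    have "1 = exp (- c) / 2 * (2 * exp c)" by (simp add: exp_minus)
    also have "\<dots> \<le> (real n * ln (real n) ^ (j - 1) * th ^ j) * ln (real n)"
      using elim th by (intro mult_mono) (auto simp: th_def)
    also have "\<dots> \<le> (real n * ln (real n) ^ (j - 1) * th) * ln (real n)"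
      using elim \<open>th ^ j \<le> th\<close> by (intro mult_right_mono mult_left_mono) auto
    also have "\<dots> = real n * (ln (real n) ^ j * th)"
    proof -
      have "ln (real n) ^ j = ln (real n) * ln (real n) ^ (j - 1)" using j by (cases j) auto
      then show ?thesis by simp
    qed
    finally show ?case using elim by (simp add: th_def divide_le_eq mult.commute)
  qed
  then show "\<exists>K. \<forall>\<^sub>F n in sequentially. 1 / real n \<le> ln (real n) ^ K * (1 - rate n) ^ num_steps j c n" by blast
qed

interpretation window: time_window "num_steps j c"
  by (rule time_window_num_steps)

text \<open>The elapsed time contributes \<open>(ln n / j) ^ (j - 1)\<close>. The logarithms are
  those that the double logarithm in the number of steps compensates, and \<open>j ^ (j - 1)\<close>
  cancels the same power in \<open>tree_weight j\<close>, which leaves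
  \<open>1 / j!\<close>.\<close>

lemma tree_num_steps: "(\<lambda>n. window.tree j n (num_steps j c n)) \<longlonglongrightarrow> exp (- c) / fact j"
proof -
  have "(\<lambda>n. tree_weight j * (real n * ln (real n) ^ (j - 1) * ((1 - rate n) ^ num_steps j c n) ^ j *
      (rate n * real (num_steps j c n) / ln (real n)) ^ (j - 1)))
    \<longlonglongrightarrow> tree_weight j * (exp (- c) * (1 / real j) ^ (j - 1))"
    by (intro tendsto_intros decay_num_steps rate_num_steps)
  moreover have "tree_weight j * (exp (- c) * (1 / real j) ^ (j - 1)) = exp (- c) / fact j"
    using j by (simp add: tree_weight_def power_divide)
  moreover have "\<forall>\<^sub>F n in sequentially. tree_weight j * (real n * ln (real n) ^ (j - 1) * ((1 - rate n) ^ num_steps j c n) ^ j *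
      (rate n * real (num_steps j c n) / ln (real n)) ^ (j - 1)) = window.tree j n (num_steps j c n)"
    using eventually_ge_at_top[of 3]
  proof eventually_elim
    case (elim n)
    then have "0 < ln (real n)" by simp
    then show ?case by (simp add: window.tree_def window.\<theta>_def power_divide)
  qed
  ultimately show ?thesis by (simp add: filterlim_cong)
qed

text \<open>The factors of \<open>V\<close> stay bounded at the critical time because
  \<open>n * \<theta> ^ j\<close> does. The remaining \<theta> is estimated through its
  \<open>j\<close>-th power, at most a bounded quantity over \<open>n\<close>, which beats every
  power of the logarithm.\<close>

lemma error_num_steps:
  "(\<lambda>n. ln (real n) ^ K * window.E {..<m} (\<lambda>_. j) n (num_steps j c n)) \<longlonglongrightarrow> 0"
proof -
  define th where "th n = (1 - rate n) ^ num_steps j c n" for n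
  define X where "X n = real n * ln (real n) ^ (j - 1) * th n ^ j" for n
  have X: "X \<longlonglongrightarrow> exp (- c)" unfolding X_def th_def by (rule decay_num_steps)
  have "(\<lambda>n. X n * (ln (real n) ^ (K * j) / real n)) \<longlonglongrightarrow> exp (- c) * 0"
  proof (intro tendsto_mult X)
    show "(\<lambda>n. ln (real n) ^ (K * j) / real n) \<longlonglongrightarrow> 0" by real_asymp
  qed
  then have lim: "(\<lambda>n. X n * (ln (real n) ^ (K * j) / real n)) \<longlonglongrightarrow> 0" by simp
  have th0: "\<forall>\<^sub>F n in sequentially. 0 \<le> th n \<and> 1 \<le> ln (real n)"
  proof -
    have "\<forall>\<^sub>F n in sequentially. 1 \<le> ln (real n)" by real_asymp
    with eventually_ge_at_top[of 3] show ?thesis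
      by eventually_elim (simp add: th_def rate_def field_simps)
  qed
  have "(\<lambda>n. (ln (real n) ^ K * th n) ^ j) \<longlonglongrightarrow> 0"
  proof (rule tendsto_sandwich[OF _ _ tendsto_const lim])
    show "\<forall>\<^sub>F n in sequentially. 0 \<le> (ln (real n) ^ K * th n) ^ j" using th0 by eventually_elim simp
    show "\<forall>\<^sub>F n in sequentially. (ln (real n) ^ K * th n) ^ j \<le> X n * (ln (real n) ^ (K * j) / real n)"
      using th0 eventually_ge_at_top[of 1]
    proof eventually_elim
      case (elim n)
      have "1 * th n ^ j \<le> ln (real n) ^ (j - 1) * th n ^ j"
        using elim by (intro mult_right_mono one_le_power) auto
      then have "ln (real n) ^ (K * j) * th n ^ j \<le> ln (real n) ^ (K * j) * (ln (real n) ^ (j - 1) * th n ^ j)"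
        using elim by (intro mult_left_mono) auto
      then show ?case using elim by (simp add: X_def power_mult_distrib power_mult mult_ac)
    qed
  qed
  then have "(\<lambda>n. root j ((ln (real n) ^ K * th n) ^ j)) \<longlonglongrightarrow> root j 0"
    by (rule tendsto_real_root)
  moreover have "\<forall>\<^sub>F n in sequentially. root j ((ln (real n) ^ K * th n) ^ j) = ln (real n) ^ K * th n"
    using th0 by eventually_elim (use j in \<open>auto simp: real_root_power_cancel\<close>)
  ultimately have small: "(\<lambda>n. ln (real n) ^ K * th n) \<longlonglongrightarrow> 0" by (simp add: filterlim_cong)
  have "\<forall>\<^sub>F n in sequentially. X n < exp (- c) + 1"
    by (rule order_tendstoD(2)[OF X]) simp
  then have bound: "\<forall>\<^sub>F n in sequentially. \<bar>ln (real n) ^ K * window.E {..<m} (\<lambda>_. j) n (num_steps j c n)\<bar> \<le>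
    \<bar>ln (real n) ^ K * th n\<bar> * (real m * (exp (- c) + 2) ^ (m - 1))"
    using th0
  proof eventually_elim
    case (elim n)
    have "window.V ({..<m} - {t}) (\<lambda>_. j) n (num_steps j c n) = (1 + real n * th n ^ j) ^ (m - 1)" if "t < m" for t
      using that by (simp add: window.V_def window.v_def window.\<theta>_def th_def)
    then have E: "window.E {..<m} (\<lambda>_. j) n (num_steps j c n) = real m * (th n * (1 + real n * th n ^ j) ^ (m - 1))"
      by (simp add: window.E_def window.\<theta>_def th_def)
    have "1 * (real n * th n ^ j) \<le> ln (real n) ^ (j - 1) * (real n * th n ^ j)"
      using elim by (intro mult_right_mono one_le_power) auto
    then have "real n * th n ^ j \<le> exp (- c) + 1" using elim by (simp add: X_def mult_ac)
    then have "(1 + real n * th n ^ j) ^ (m - 1) \<le> (exp (- c) + 2) ^ (m - 1)"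
      using elim by (intro power_mono) auto
    then have "(ln (real n) ^ K * th n) * (real m * (1 + real n * th n ^ j) ^ (m - 1)) \<le>
      (ln (real n) ^ K * th n) * (real m * (exp (- c) + 2) ^ (m - 1))"
      using elim by (intro mult_left_mono) auto
    then show ?case unfolding E using elim by (simp add: abs_mult mult_ac)
  qed
  show ?thesis
    by (rule Lim_null_comparison[where g = "\<lambda>n. \<bar>ln (real n) ^ K * th n\<bar> * (real m * (exp (- c) + 2) ^ (m - 1))"])
      (use bound tendsto_mult_left_zero[OF tendsto_rabs_zero[OF small]] in simp_all)
qed

lemma mean_num_steps:
  "(\<lambda>n. mean_count n (num_steps j c n) {..<m} (\<lambda>_. j)) \<longlonglongrightarrow> (1 + exp (- c) / fact j) ^ m"
proof -
  let ?T = "num_steps j c"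
  have v: "valid {..<m} (\<lambda>_. j)" using j by (simp add: valid_def)
  obtain K where K: "\<forall>\<^sub>F n in sequentially. \<forall>k\<le>?T n.
      \<bar>mean_count n k {..<m} (\<lambda>_. j) - window.B {..<m} (\<lambda>_. j) n k\<bar> \<le> ln (real n) ^ K * window.E {..<m} (\<lambda>_. j) n k"
    using window.mean_approximation[OF v] by (auto simp: window.dominated_def)
  have "(\<lambda>n. mean_count n (?T n) {..<m} (\<lambda>_. j) - window.B {..<m} (\<lambda>_. j) n (?T n)) \<longlonglongrightarrow> 0"
    by (rule Lim_null_comparison[OF _ error_num_steps[of K m]]) (use K in eventually_elim, simp)
  moreover have "(\<lambda>n. window.B {..<m} (\<lambda>_. j) n (?T n)) \<longlonglongrightarrow> (1 + exp (- c) / fact j) ^ m"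
    unfolding window.B_def window.b_def prod_constant card_lessThan by (intro tendsto_intros tree_num_steps)
  ultimately show ?thesis using tendsto_add by fastforce
qed

text \<open>Division by \<open>j ^ m * m!\<close> forgets the starting points and the order of the
  words. The power of \<open>j\<close> is the origin of the factor \<open>1 / j\<close> in the
  Poisson parameter.\<close>

lemma binomial_moment_num_steps:
  "(\<lambda>n. measure_pmf.expectation (transposition_walk n (num_steps j c n)) (\<lambda>\<sigma>. real (num_cycles n j \<sigma> choose m)))
    \<longlonglongrightarrow> (1 / real j * (1 + exp (- c) / fact j)) ^ m / fact m"
proof -
  have eq: "mean_count n k {..<m} (\<lambda>_. j) / (real j ^ m * fact m) =
    measure_pmf.expectation (transposition_walk n k) (\<lambda>\<sigma>. real (num_cycles n j \<sigma> choose m))" for n k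
    using j by (simp add: mean_count_def card_cycle_families_binomial)
  have "(\<lambda>n. mean_count n (num_steps j c n) {..<m} (\<lambda>_. j) / (real j ^ m * fact m)) \<longlonglongrightarrow>
    (1 + exp (- c) / fact j) ^ m / (real j ^ m * fact m)"
    using j by (intro tendsto_divide mean_num_steps tendsto_const) auto
  then show ?thesis unfolding eq by (simp add: power_mult_distrib power_divide)
qed

end

theorem theorem1p4:
  fixes j :: nat and c :: real
  assumes "j \<ge> 1"
  shows "weak_conv_m
    (\<lambda>n. distr (measure_pmf (transposition_walk n (num_steps j c n))) borel
           (\<lambda>p. real (num_cycles n j p)))
    (distr (measure_pmf (poisson_pmf (1 / real j * (1 + exp (- c) / fact j)))) borel real)"
proof -
  define rt where "rt = 1 / real j * (1 + exp (- c) / fact j)"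
  have "0 < 1 + exp (- c) / fact j" by (intro add_pos_pos divide_pos_pos) auto
  then have rt: "0 < rt" using assms unfolding rt_def by (intro mult_pos_pos) auto
  define P where "P n = map_pmf (num_cycles n j) (transposition_walk n (num_steps j c n))" for n
  \<comment> \<open>For \<open>n < 2\<close> there is no transposition, so the law of a step is
    unspecified and its support is not known to be finite. A point mass is put in its place, as the
    moment criterion asks for finite support at every \<open>n\<close>.\<close>
  define Q where "Q n = (if n \<ge> 2 then P n else return_pmf 0)" for n
  have "(\<lambda>n. pmf (Q n) r) \<longlonglongrightarrow> rt ^ r / fact r * exp (- rt)" for r
  proof (rule pmf_tendsto_poisson)
    show "finite (set_pmf (Q n))" for n
      by (simp add: Q_def P_def finite_transposition_walk)
    fix m
    have "\<forall>\<^sub>F n in sequentially. measure_pmf.expectation (transposition_walk n (num_steps j c n)) (\<lambda>\<sigma>. real (num_cycles n j \<sigma> choose m)) =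
      measure_pmf.expectation (Q n) (\<lambda>N. real (N choose m))"
      using eventually_ge_at_top[of 2] by eventually_elim (simp add: Q_def P_def)
    then show "(\<lambda>n. measure_pmf.expectation (Q n) (\<lambda>N. real (N choose m))) \<longlonglongrightarrow> rt ^ m / fact m"
      using binomial_moment_num_steps[OF assms, of c m] unfolding rt_def by (rule Lim_transform_eventually[rotated])
  qed
  moreover have "\<forall>\<^sub>F n in sequentially. pmf (Q n) r = pmf (P n) r" for r
    using eventually_ge_at_top[of 2] by eventually_elim (simp add: Q_def)
  ultimately have "(\<lambda>n. pmf (P n) r) \<longlonglongrightarrow> pmf (poisson_pmf rt) r" for r
    unfolding pmf_poisson[OF rt] by (rule Lim_transform_eventually)
  then have "weak_conv_m (\<lambda>n. distr (measure_pmf (P n)) borel real) (distr (measure_pmf (poisson_pmf rt)) borel real)"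
    by (rule weak_conv_m_nat_pmf)
  moreover have "distr (measure_pmf (P n)) borel real =
    distr (measure_pmf (transposition_walk n (num_steps j c n))) borel (\<lambda>p. real (num_cycles n j p))" for n
    unfolding P_def map_pmf_rep_eq by (subst distr_distr) (auto simp: o_def)
  ultimately show ?thesis unfolding rt_def by simp
qed

end
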